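(* Let $\omega$ be an open strict interval of $\mathbb T$. The set $\mathcal{NC}_{L^2}(\omega,T)$ does not depend on $T$: for all $T',T > 0$, $\mathcal{NC}_{L^2}(\omega,T) = \mathcal{NC}_{L^2}(\omega,T')$.
   Context: $\mathbb T$ is the complex unit circle, identified with $\mathbb R/2\pi\mathbb Z$ via $x\mapsto e^{ix}$. An open strict interval of $\mathbb T$ is an open arc $\{e^{ix}:a<x<b\}$ with $0<b-a<2\pi$. Functions are complex valued; $f\in L^2(\mathbb T)$ is written $f(e^{ix})=\sum_{n\in\mathbb Z}\widehat f(n)e^{inx}$. Let $S(t)f(e^{ix})=\sum_{n}\widehat f(n)e^{-|n|t}e^{inx}$ (the semigroup generated by $-|D|$, $|D|f=\sum_n|n|\widehat f(n)e^{inx}$). The $L^2$ control system (half-heat equation) is $(\partial_t+|D|)f=\mathbf 1_\omega u$, $f(0,\cdot)=f_0\in L^2(\mathbb T)$, with control $u\in L^2([0,T]\times\omega)$; its solution satisfies $f(T,\cdot)=S(T)f_0+\int_0^TS(T-s)(\mathbf 1_\omega u(s,\cdot))\,ds$, where $\mathbf 1_\omega u$ is the extension of $u$ by $0$ outside $\omega$. $\mathcal{NC}_{L^2}(\omega,T)$ is the set of $f_0\in L^2(\mathbb T)$ for which there is $u\in L^2([0,T]\times\omega)$ with $f(T,\cdot)=0$. *)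

theory Defs
  imports "HOL-Analysis.Analysis"
begin

text \<open>
  Functions on the circle are functions on \<open>complex\<close>, of which only the restriction to the
  unit circle matters. The circle carries its Borel sets and the arc length \<open>dx\<close>
  (total mass \<open>2\<pi>\<close>) transported by \<open>x \<mapsto> e\<^sup>i\<^sup>x\<close>.
\<close>

definition circle_measure :: "complex measure" where
  "circle_measure =
     distr (restrict_space lborel {0..<2 * pi}) (restrict_space borel (sphere 0 1)) cis"

definition open_strict_interval :: "complex set \<Rightarrow> bool" where
  "open_strict_interval \<omega> \<longleftrightarrow>
     (\<exists>a b::real. 0 < b - a \<and> b - a < 2 * pi \<and> \<omega> = cis ` {a<..<b})"

text \<open>
  Elements of \<open>L\<^sup>2\<close> are represented by functions rather than by classes modulo almost everywhere
  equality; equality of elements of \<open>L\<^sup>2\<close> is then expressed by \<open>AE\<close>.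
\<close>

definition L2 :: "'a measure \<Rightarrow> ('a \<Rightarrow> complex) set" where
  "L2 M = {f \<in> borel_measurable M. integrable M (\<lambda>x. (norm (f x))\<^sup>2)}"

definition fourier_coeff :: "(complex \<Rightarrow> complex) \<Rightarrow> int \<Rightarrow> complex" where
  "fourier_coeff f n = (LINT z|circle_measure. f z * z powi (- n)) / (2 * pi)"

text \<open>
  For \<open>t > 0\<close> and \<open>f\<close> in \<open>L\<^sup>2\<close> the series converges absolutely at every point of the circle, and its
  sum is the continuous representative of \<open>S(t)f\<close>. For \<open>t = 0\<close> the Fourier series of \<open>f\<close>
  converges to \<open>f\<close> in \<open>L\<^sup>2\<close> but need not converge unconditionally at a point, hence the case
  distinction.
\<close>

definition half_heat_semigroup :: "real \<Rightarrow> (complex \<Rightarrow> complex) \<Rightarrow> complex \<Rightarrow> complex" where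
  "half_heat_semigroup t f z =
     (if t = 0 then f z
      else (\<Sum>\<^sub>\<infinity>n\<in>UNIV. fourier_coeff f n * exp (- (of_int \<bar>n\<bar> * of_real t)) * z powi n))"

definition extend_by_zero :: "complex set \<Rightarrow> (complex \<Rightarrow> complex) \<Rightarrow> complex \<Rightarrow> complex" where
  "extend_by_zero \<omega> v z = (if z \<in> \<omega> then v z else 0)"

text \<open>
  Duhamel's formula. The \<open>L\<^sup>2\<close>-valued integral over \<open>s\<close> is represented by the integral of the
  pointwise values: for \<open>u\<close> in \<open>L\<^sup>2([0,t] \<times> \<omega>)\<close> the integrand is integrable in \<open>(s, z)\<close>
  on \<open>[0,t] \<times> T\<close>, so by Fubini the integral below exists for almost every \<open>z\<close> in the
  circle \<open>T\<close>, and it agrees almost everywhere with the Bochner integral.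
\<close>

definition half_heat_solution ::
  "complex set \<Rightarrow> (complex \<Rightarrow> complex) \<Rightarrow> (real \<Rightarrow> complex \<Rightarrow> complex) \<Rightarrow> real \<Rightarrow> complex \<Rightarrow> complex"
where
  "half_heat_solution \<omega> f\<^sub>0 u t z =
     half_heat_semigroup t f\<^sub>0 z +
     (LINT s:{0..t}|lborel. half_heat_semigroup (t - s) (extend_by_zero \<omega> (u s)) z)"

definition NC_L2 :: "complex set \<Rightarrow> real \<Rightarrow> (complex \<Rightarrow> complex) set" where
  "NC_L2 \<omega> T =
     {f\<^sub>0 \<in> L2 circle_measure.
        \<exists>u. (\<lambda>(s, z). u s z) \<in>
              L2 (restrict_space lborel {0..T} \<Otimes>\<^sub>M restrict_space circle_measure \<omega>) \<and>
            (AE z in circle_measure. half_heat_solution \<omega> f\<^sub>0 u T z = 0)}"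

end

theory Submission
  imports Defs "HOL-Complex_Analysis.Complex_Analysis"
begin

text \<open>
  On Fourier coefficients, a control \<open>u\<close> drives \<open>f\<^sub>0\<close> to \<open>0\<close> at time \<open>T\<close> iff its moments
  \<open>\<integral>\<^sub>0\<^sup>T\<integral>\<^sub>\<omega> u(s,z) e\<^sup>|\<^sup>n\<^sup>|\<^sup>s z\<^sup>-\<^sup>n\<close> equal \<open>-2\<pi>\<close> times the Fourier coefficients of \<open>f\<^sub>0\<close>. Hence larger times allow
  more initial data, and one has to move a control on \<open>[0,L]\<close> to a shorter interval \<open>[0,T]\<close> without
  changing its moments. The functions \<open>e\<^sup>|\<^sup>n\<^sup>|\<^sup>s z\<^sup>-\<^sup>n\<close> are harmonic on the cylinder, and the solution \<open>d\<close> of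
  \<open>\<Delta>d = u\<close> for \<open>s > 0\<close> which vanishes for \<open>s > L\<close> is the difference of a potential of \<open>u\<close> and of a
  power series whose coefficients are the moments; as the latter are bounded, \<open>d\<close> makes sense in \<open>L\<^sup>2\<close>
  for \<open>s \<ge> \<epsilon> > 0\<close>, and by unique continuation it vanishes outside the closure of \<open>\<omega>\<close>. If \<open>\<chi>\<close> is a
  cut-off function with \<open>\<chi> = 1\<close> near \<open>0\<close> and \<open>\<chi> = 0\<close> after \<open>T\<close>, then \<open>\<Delta>(\<chi>d) = \<chi>u + 2\<chi>'\<partial>\<^sub>sd + \<chi>''d\<close> is a control
  on \<open>[0,T]\<close> with the same moments, by Green's formula.

  The derivative is \<open>\<partial>\<^sub>sd = -H/2\<close>, where \<open>H\<close> is the sum of the solutions, vanishing for \<open>s > L\<close>, of the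
  two first-order equations \<open>(\<partial>\<^sub>s \<plusminus> D)v = -u\<close>, \<open>D = -i\<partial>\<^sub>x\<close>, which are of Cauchy-Riemann type. The whole
  construction is carried out with \<open>H\<close>, and \<open>d\<close> is half the integral of \<open>H\<close> over \<open>[s,\<infinity>)\<close>.
\<close>

section \<open>Arc length on the circle\<close>

text \<open>The obstacle is regularity: a control is only square integrable, so \<open>d\<close>,
  its derivative and Green's formula would have to be read weakly. No weak derivative is formed
  here. Only integrals of \<open>H\<close> against \<open>G(s) z^-n\<close> are computed; in these,
  a source at time \<sigma> is weighted by the elementary function \<open>exit_profile\<close>, and
  Green's formula becomes, for each \<open>n\<close>, one identity between functions of \<sigma>.
  First-order equations are preferred because in the coordinate \<open>w = e^-s z\<close> their
  kernel is the Cauchy kernel: its Fourier coefficients come from a geometric series, its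
  singularity of order 1/distance is harmless by Schur's test, and unique continuation is the
  identity theorem on a domain star-shaped about \<open>w = 0\<close>, the point that stands for
  infinite time. The moments of an arbitrary control on \<open>{0..L}\<close> may grow like
  \<open>e^(|n| L)\<close>; here they are bounded because they are also multiples of the Fourier
  coefficients of the initial datum, and this extends the power series from radius
  \<open>e^-L\<close> to the unit disc.\<close>

lemma space_circle_measure [simp]: "space circle_measure = sphere 0 1"
  and sets_circle_measure [measurable_cong]: "sets circle_measure = sets (restrict_space borel (sphere 0 1))"
  by (auto simp: circle_measure_def space_restrict_space)

lemma measurable_cis_circle:
  "cis \<in> measurable (restrict_space lborel {0..<2 * pi}) (restrict_space borel (sphere 0 1))"
  by (intro measurable_restrict_space2 measurable_restrict_space1)
     (auto intro!: borel_measurable_continuous_onI continuous_intros)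

lemma measurable_circle_borel [measurable]: "(\<lambda>z. z) \<in> borel_measurable circle_measure"
  by (simp add: measurable_cong_sets[OF sets_circle_measure refl] measurable_restrict_space1)

lemma nn_integral_circle_measure:
  assumes "f \<in> borel_measurable circle_measure"
  shows "(\<integral>\<^sup>+z. f z \<partial>circle_measure) = (\<integral>\<^sup>+x. f (cis x) * indicator {0..<2*pi} x \<partial>lborel)"
proof -
  have "(\<integral>\<^sup>+z. f z \<partial>circle_measure) = (\<integral>\<^sup>+x. f (cis x) \<partial>restrict_space lborel {0..<2 * pi})"
    unfolding circle_measure_def using assms
    by (intro nn_integral_distr measurable_cis_circle) (simp add: measurable_cong_sets[OF sets_circle_measure refl])
  then show ?thesis by (simp add: nn_integral_restrict_space)
qed

lemma finite_measure_circle: "finite_measure circle_measure"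
proof
  show "emeasure circle_measure (space circle_measure) \<noteq> \<infinity>"
    using nn_integral_circle_measure[of "\<lambda>_. 1"] by simp
qed

interpretation circle: finite_measure circle_measure
  by (rule finite_measure_circle)

interpretation cylinder: pair_sigma_finite lborel circle_measure ..

lemma integral_circle_measure:
  fixes f :: "complex \<Rightarrow> complex"
  assumes "f \<in> borel_measurable circle_measure"
  shows "(LINT z|circle_measure. f z) = (LINT x:{0..2*pi}|lborel. f (cis x))"
proof -
  have "(LINT z|circle_measure. f z) = (LINT x|restrict_space lborel {0..<2 * pi}. f (cis x))"
    unfolding circle_measure_def using assms
    by (intro integral_distr measurable_cis_circle) (simp add: measurable_cong_sets[OF sets_circle_measure refl])
  also have "\<dots> = (LINT x:{0..<2*pi}|lborel. f (cis x))"
    by (simp add: integral_restrict_space set_lebesgue_integral_def)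
  also have "\<dots> = (LINT x:{0..2*pi}|lborel. f (cis x))"
  proof -
    have [measurable]: "(\<lambda>x. f (cis x)) \<in> borel_measurable (restrict_space lborel {0..<2 * pi})"
      using measurable_compose[OF measurable_cis_circle, of f borel] assms
      by (simp add: measurable_cong_sets[OF sets_circle_measure refl])
    have 1: "(\<lambda>x. indicator {0..<2*pi} x *\<^sub>R f (cis x)) \<in> borel_measurable lborel"
      using borel_measurable_restrict_space_iff[of "{0..<2 * pi}" lborel "\<lambda>x. f (cis x)"] by auto
    \<comment> \<open>Measurability is known over the half-open interval only; altering a single
      value there reaches the closed one, which suits the fundamental theorem of calculus.\<close>
    have eq: "indicator {0..2*pi} x *\<^sub>R f (cis x) =
      (if x = 2 * pi then f (cis (2*pi)) else indicator {0..<2*pi} x *\<^sub>R f (cis x))" for x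
      by (auto simp: indicator_def)
    show ?thesis
      unfolding set_lebesgue_integral_def
    proof (rule integral_cong_AE)
      show "(\<lambda>x. indicator {0..2*pi} x *\<^sub>R f (cis x)) \<in> borel_measurable lborel"
        unfolding eq using 1 by measurable
      show "AE x in lborel. indicator {0..<2 * pi} x *\<^sub>R f (cis x) = indicator {0..2 * pi} x *\<^sub>R f (cis x)"
        using AE_lborel_singleton[of "2*pi"] by eventually_elim (auto simp: indicator_def)
    qed (rule 1)
  qed
  finally show ?thesis .
qed

lemma borel_measurable_power_int [measurable]:
  fixes f :: "'a \<Rightarrow> complex"
  assumes [measurable]: "f \<in> borel_measurable M"
  shows "(\<lambda>x. f x powi n) \<in> borel_measurable M"
  by (cases "n \<ge> 0") (simp_all add: power_int_def)

lemma norm_powi_sphere: "z \<in> sphere 0 1 \<Longrightarrow> norm ((z::complex) powi n) = 1"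
  by (simp add: norm_power_int)

lemma cnj_sphere: "z \<in> sphere 0 1 \<Longrightarrow> cnj z = inverse z"
  by (simp add: inverse_complex_def complex_eq_iff cmod_def power2_eq_square)

lemma integral_powi_circle:
  "(LINT z|circle_measure. z powi n) = (if n = 0 then 2 * pi else 0)"
proof -
  have "(LINT z|circle_measure. z powi n) = (LINT x:{0..2*pi}|lborel. cis x powi n)"
    by (intro integral_circle_measure) measurable
  also have "\<dots> = (LINT x|lborel. indicator {0..2*pi} x *\<^sub>R cis (n * x))"
    by (simp add: set_lebesgue_integral_def cis_power_int)
  also have "\<dots> = (if n = 0 then 2 * pi else 0)"
  proof (cases "n = 0")
    case False
    have deriv: "((\<lambda>x. cis (of_int n * x) / (\<i> * of_int n)) has_vector_derivative cis (of_int n * x)) (at x within A)"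
      for x A
      unfolding cis_conv_exp
      by (rule has_vector_derivative_real_field derivative_eq_intros refl | simp add: False field_simps)+
    have "(LINT x|lborel. indicator {0..2*pi} x *\<^sub>R cis (n * x)) =
       cis (of_int n * (2 * pi)) / (\<i> * of_int n) - cis (of_int n * 0) / (\<i> * of_int n)"
      by (rule integral_FTC_Icc[where F = "\<lambda>x. cis (of_int n * x) / (\<i> * of_int n)"])
         (auto intro!: continuous_intros deriv)
    also have "cis (n * (2 * pi)) = 1"
      using cis_multiple_2pi[of "of_int n"] by (simp add: mult_ac)
    finally show ?thesis using False by simp
  next
    case True
    then show ?thesis by (simp add: scaleR_conv_of_real)
  qed
  finally show ?thesis .
qed

text \<open>A ratio bounded by \<open>\<rho> < 1\<close> uniformly makes the norms summable both
  pointwise and after integration, which justifies exchanging sum and integral. The Cauchy kernel,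
  the Poisson kernel, the semigroup and the Cauchy transform are all expanded through this
  lemma.\<close>

lemma geometric_integral_sums:
  fixes f \<beta> :: "'a \<Rightarrow> complex"
  assumes f: "integrable M f" and [measurable]: "\<beta> \<in> borel_measurable M"
    and \<beta>: "\<And>x. x \<in> space M \<Longrightarrow> norm (\<beta> x) \<le> \<rho>" and \<rho>: "0 \<le> \<rho>" "\<rho> < 1"
  shows "(\<lambda>k. LINT x|M. f x * \<beta> x ^ k) sums (LINT x|M. f x / (1 - \<beta> x))"
    and "integrable M (\<lambda>x. f x / (1 - \<beta> x))"
    and "integrable M (\<lambda>x. f x * \<beta> x ^ k)"
proof -
  have [measurable]: "f \<in> borel_measurable M" using f by simp
  have bd: "norm (f x * \<beta> x ^ k) \<le> norm (f x) * \<rho> ^ k" if "x \<in> space M" for x k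
    using \<beta>[OF that] by (auto simp: norm_mult norm_power intro!: mult_left_mono power_mono)
  have int: "integrable M (\<lambda>x. f x * \<beta> x ^ k)" for k
    by (rule Bochner_Integration.integrable_bound[of M "\<lambda>x. norm (f x) * \<rho> ^ k"])
       (use f bd \<rho> in \<open>auto intro!: AE_I2\<close>)
  then show "integrable M (\<lambda>x. f x * \<beta> x ^ k)" .
  have sum: "(\<lambda>k. f x * \<beta> x ^ k) sums (f x / (1 - \<beta> x))" if "x \<in> space M" for x
    using sums_mult[OF geometric_sums[of "\<beta> x"], of "f x"] \<beta>[OF that] \<rho> by simp
  have 1: "AE x in M. summable (\<lambda>k. norm (f x * \<beta> x ^ k))"
  proof (rule AE_I2)
    fix x assume x: "x \<in> space M"
    show "summable (\<lambda>k. norm (f x * \<beta> x ^ k))"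
      by (rule summable_comparison_test'[of "\<lambda>k. norm (f x) * \<rho> ^ k" 0])
         (use bd[OF x] \<rho> in \<open>auto intro!: summable_mult summable_geometric\<close>)
  qed
  have 2: "summable (\<lambda>k. LINT x|M. norm (f x * \<beta> x ^ k))"
  proof (rule summable_comparison_test'[of "\<lambda>k. (LINT x|M. norm (f x)) * \<rho> ^ k" 0])
    show "summable (\<lambda>k. (LINT x|M. norm (f x)) * \<rho> ^ k)"
      using \<rho> by (intro summable_mult summable_geometric) auto
    fix k
    have "(LINT x|M. norm (f x * \<beta> x ^ k)) \<le> (LINT x|M. norm (f x) * \<rho> ^ k)"
      using int f by (intro integral_mono bd integrable_norm) auto
    then show "norm (LINT x|M. norm (f x * \<beta> x ^ k)) \<le> (LINT x|M. norm (f x)) * \<rho> ^ k"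
      by simp
  qed
  have eq: "(\<Sum>k. f x * \<beta> x ^ k) = f x / (1 - \<beta> x)" if "x \<in> space M" for x
    using sum[OF that] by (simp add: sums_iff)
  have "(\<lambda>k. LINT x|M. f x * \<beta> x ^ k) sums (LINT x|M. (\<Sum>k. f x * \<beta> x ^ k))"
    by (rule sums_integral[OF int 1 2])
  then show "(\<lambda>k. LINT x|M. f x * \<beta> x ^ k) sums (LINT x|M. f x / (1 - \<beta> x))"
    by (simp add: eq cong: Bochner_Integration.integral_cong)
  show "integrable M (\<lambda>x. f x / (1 - \<beta> x))"
    using integrable_suminf[OF int 1 2] by (simp add: eq cong: Bochner_Integration.integrable_cong)
qed

section \<open>Uniqueness of Fourier coefficients\<close>

lemma integrable_mult_powi_circle:
  assumes "integrable circle_measure g"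
  shows "integrable circle_measure (\<lambda>z. g z * z powi n)"
  by (rule Bochner_Integration.integrable_bound[OF assms])
     (use assms in \<open>auto simp: norm_mult norm_powi_sphere\<close>)

text \<open>On the circle a real linear function is a combination of \<open>z\<close> and
  \<open>1/z\<close>, so multiplying by it only shifts the index \<open>n\<close>. Carrying
  integrability along and keeping \<open>g\<close> arbitrary lets the product case apply both
  induction hypotheses in turn.\<close>

lemma real_polynomial_mult_annihilator:
  assumes "real_polynomial_function \<phi>"
    and "integrable circle_measure g" "\<And>n. (LINT z|circle_measure. g z * z powi n) = 0"
  shows "integrable circle_measure (\<lambda>z. of_real (\<phi> z) * g z) \<and>
         (\<forall>n. (LINT z|circle_measure. of_real (\<phi> z) * g z * z powi n) = 0)"
  using assms
proof (induction \<phi> arbitrary: g rule: real_polynomial_function.induct)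
  case (linear f)
  interpret f: bounded_linear f by fact
  \<comment> \<open>From Re z = (z + 1/z)/2 and Im z = (z - 1/z)/(2i) on the circle.\<close>
  define \<alpha> \<beta> where "\<alpha> = (f 1 - \<i> * f \<i>) / 2" and "\<beta> = (f 1 + \<i> * f \<i>) / 2"
  have f_eq: "of_real (f z) = \<alpha> * z powi 1 + \<beta> * z powi (-1)" if "z \<in> sphere 0 1" for z
  proof -
    have "f z = f (Re z *\<^sub>R 1 + Im z *\<^sub>R \<i>)"
      by (rule arg_cong[of _ _ f]) (simp add: complex_eq_iff)
    also have "\<dots> = Re z * f 1 + Im z * f \<i>"
      by (simp only: f.add f.scaleR real_scaleR_def)
    finally have f_eq1: "f z = Re z * f 1 + Im z * f \<i>" .
    have "z powi (-1) = cnj z" using cnj_sphere[OF that] by (simp add: power_int_minus)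
    show ?thesis unfolding f_eq1 \<alpha>_def \<beta>_def \<open>z powi (-1) = cnj z\<close>
      by (simp add: complex_eq_iff field_simps)
  qed
  have eq: "of_real (f z) * g z * z powi n = \<alpha> * (g z * z powi (n + 1)) + \<beta> * (g z * z powi (n - 1))"
    if "z \<in> sphere 0 1" for z n
  proof -
    have "z \<noteq> 0" using that by auto
    then show ?thesis
      by (simp add: f_eq[OF that] power_int_add power_int_diff field_simps)
  qed
  note int = integrable_mult_powi_circle[OF linear(2)]
  have i: "integrable circle_measure (\<lambda>z. of_real (f z) * g z * z powi n)" for n
    by (rule Bochner_Integration.integrable_cong[THEN iffD2, OF refl eq]) (use int in auto)
  have "(LINT z|circle_measure. of_real (f z) * g z * z powi n) = 0" for n
    by (subst Bochner_Integration.integral_cong[OF refl eq]) (use int linear(3) in auto)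
  with i[of 0] show ?case by simp
next
  case (const c)
  then show ?case by (simp add: mult.assoc)
next
  case (add f1 f2)
  note 1 = add.IH(1)[OF add.prems] and 2 = add.IH(2)[OF add.prems]
  show ?case
    using 1 2 integrable_mult_powi_circle[OF conjunct1[OF 1]] integrable_mult_powi_circle[OF conjunct1[OF 2]]
    by (simp add: ring_distribs)
next
  case (mult f1 f2)
  from mult.IH(1)[of "\<lambda>z. of_real (f2 z) * g z"] mult.IH(2)[OF mult.prems]
  show ?case by (simp add: mult_ac)
qed

text \<open>The function to which this is applied is a superposition of Poisson kernels, known only
  to be integrable, so \<open>h\<close> is not assumed square integrable. Vanishing integrals pass
  from polynomials to continuous functions by Stone-Weierstrass, to closed sets by dominated
  convergence, and to Borel sets by a Dynkin argument.\<close>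

lemma AE_zero_if_fourier_coeffs_zero:
  fixes h :: "complex \<Rightarrow> complex"
  assumes int: "integrable circle_measure h"
    and zero: "\<And>n. (LINT z|circle_measure. h z * z powi n) = 0"
  shows "AE z in circle_measure. h z = 0"
proof -
  have [measurable]: "h \<in> borel_measurable circle_measure" using int by simp
  have continuous: "(LINT z|circle_measure. of_real (\<psi> z) * h z) = 0" if \<psi>: "continuous_on UNIV \<psi>" for \<psi> :: "complex \<Rightarrow> real"
  proof -
    have [measurable]: "\<psi> \<in> borel_measurable borel"
      using \<psi> by (rule borel_measurable_continuous_onI)
    have "norm (LINT z|circle_measure. of_real (\<psi> z) * h z) \<le> e * (LINT z|circle_measure. norm (h z))" if "e > 0" for e
    proof -
      obtain \<phi> where \<phi>: "real_polynomial_function \<phi>" "\<And>z. z \<in> sphere 0 1 \<Longrightarrow> \<bar>\<psi> z - \<phi> z\<bar> < e"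
        using Stone_Weierstrass_real_polynomial_function[OF compact_sphere continuous_on_subset[OF \<psi> subset_UNIV] \<open>e > 0\<close>]
        by metis
      note ann = real_polynomial_mult_annihilator[OF \<phi>(1) int zero]
      have bd: "norm (of_real (\<psi> z) * h z - of_real (\<phi> z) * h z) \<le> e * norm (h z)" if "z \<in> space circle_measure" for z
        using \<phi>(2)[of z] that
        by (auto simp: norm_mult simp flip: left_diff_distrib of_real_diff intro!: mult_right_mono)
      have i: "integrable circle_measure (\<lambda>z. of_real (\<psi> z) * h z - of_real (\<phi> z) * h z)"
        by (rule Bochner_Integration.integrable_bound[of _ "\<lambda>z. e * norm (h z)"])
           (use int bd ann \<open>e > 0\<close> in \<open>auto intro!: AE_I2 simp: abs_mult\<close>)
      then have "integrable circle_measure (\<lambda>z. (of_real (\<psi> z) * h z - of_real (\<phi> z) * h z) + of_real (\<phi> z) * h z)"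
        using ann by (intro Bochner_Integration.integrable_add) auto
      then have "(LINT z|circle_measure. of_real (\<psi> z) * h z) =
          (LINT z|circle_measure. of_real (\<psi> z) * h z - of_real (\<phi> z) * h z)"
        using ann by (subst Bochner_Integration.integral_diff) (auto dest: spec[of _ 0])
      also have "norm \<dots> \<le> (LINT z|circle_measure. e * norm (h z))"
        using int i bd by (intro Bochner_Integration.integral_norm_bound_integral) auto
      finally show ?thesis by simp
    qed
    note bound = this
    have "norm (LINT z|circle_measure. of_real (\<psi> z) * h z) \<le> 0"
    proof (rule field_le_epsilon)
      fix d :: real assume "d > 0"
      define I where "I = (LINT z|circle_measure. norm (h z))"
      have "I \<ge> 0" by (simp add: I_def)
      \<comment> \<open>The summand 1 covers the case \<open>I = 0\<close>.\<close>
      then have "d / (I + 1) > 0" using \<open>d > 0\<close> by simp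
      from bound[OF this]
      have "norm (LINT z|circle_measure. of_real (\<psi> z) * h z) \<le> d / (I + 1) * I" by (simp add: I_def)
      also have "\<dots> \<le> d" using \<open>I \<ge> 0\<close> \<open>d > 0\<close> by (simp add: field_simps)
      finally show "norm (LINT z|circle_measure. of_real (\<psi> z) * h z) \<le> 0 + d" by simp
    qed
    then show ?thesis by simp
  qed
  define P where "P A \<longleftrightarrow> (LINT z:A|circle_measure. h z) = 0" for A
  have closed: "P C" if C: "closed C" for C
  proof (cases "C = {}")
    case False
    \<comment> \<open>Continuous functions tending to the indicator of \<open>C\<close>: closedness
      gives a positive distance to \<open>C\<close> at every point outside it.\<close>
    let ?\<psi> = "\<lambda>k z. max 0 (1 - real k * infdist z C)"
    have "(\<lambda>k. LINT z|circle_measure. of_real (?\<psi> k z) * h z) \<longlonglongrightarrow> (LINT z|circle_measure. indicator C z *\<^sub>R h z)"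
    proof (rule integral_dominated_convergence[where w = "\<lambda>z. norm (h z)"])
      show "(\<lambda>z. indicator C z *\<^sub>R h z) \<in> borel_measurable circle_measure"
        using C by (intro borel_measurable_scaleR) (auto intro!: measurable_compose[OF measurable_circle_borel, of "indicator C"])
      show "(\<lambda>z. of_real (?\<psi> k z) * h z) \<in> borel_measurable circle_measure" for k
      proof (rule borel_measurable_times)
        show "(\<lambda>z. complex_of_real (?\<psi> k z)) \<in> borel_measurable circle_measure"
          by (rule measurable_compose[OF measurable_circle_borel borel_measurable_continuous_onI]) (intro continuous_intros)
      qed measurable
      show "integrable circle_measure (\<lambda>z. norm (h z))" using int by simp
      have "(\<lambda>k. complex_of_real (?\<psi> k z) * h z) \<longlonglongrightarrow> indicator C z *\<^sub>R h z" for z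
      proof (cases "z \<in> C")
        case True
        then show ?thesis by simp
      next
        case notin: False
        then have "infdist z C > 0" using C False by (simp add: infdist_pos_not_in_closed)
        then obtain N where N: "1 < real N * infdist z C" using reals_Archimedean3 by blast
        have "eventually (\<lambda>k. ?\<psi> k z = 0) sequentially"
          using eventually_ge_at_top[of N]
        proof eventually_elim
          case (elim k)
          then have "real N * infdist z C \<le> real k * infdist z C"
            using \<open>infdist z C > 0\<close> by (intro mult_right_mono) auto
          with N show ?case by simp
        qed
        then have "eventually (\<lambda>k. of_real (?\<psi> k z) * h z = 0) sequentially"
          by eventually_elim simp
        then show ?thesis using notin by (simp add: tendsto_eventually)
      qed
      then show "AE z in circle_measure. (\<lambda>k. complex_of_real (?\<psi> k z) * h z) \<longlonglongrightarrow> indicator C z *\<^sub>R h z"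
        by simp
      have "norm (complex_of_real (?\<psi> k z) * h z) \<le> norm (h z)" for k z
        unfolding norm_mult norm_of_real by (rule mult_left_le_one_le) (auto simp: infdist_nonneg)
      then show "AE z in circle_measure. norm (complex_of_real (?\<psi> k z) * h z) \<le> norm (h z)" for k
        by simp
    qed
    moreover have "(LINT z|circle_measure. of_real (?\<psi> k z) * h z) = 0" for k
      by (rule continuous) (intro continuous_intros)
    ultimately show ?thesis
      unfolding P_def set_lebesgue_integral_def
      by (simp only: LIMSEQ_const_iff)
  qed (simp add: P_def set_lebesgue_integral_def)
  have set_int: "set_integrable circle_measure A h" if "A \<in> sets borel" for A
    unfolding set_integrable_def using that int
    by (intro Bochner_Integration.integrable_bound[OF int]) (auto simp: indicator_def)
  have all: "P A" if "A \<in> sets borel" for A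
  proof -
    have "Int_stable {C :: complex set. closed C}" by (auto simp: Int_stable_def)
    moreover have "{C :: complex set. closed C} \<subseteq> Pow UNIV" by simp
    moreover have "A \<in> sigma_sets UNIV {C. closed C}"
      using that by (simp add: borel_eq_closed)
    ultimately show ?thesis
    proof (induction rule: sigma_sets_induct_disjoint)
      case (compl A)
      then have A: "A \<in> sets borel" by (simp add: borel_eq_closed)
      have "(LINT z:UNIV|circle_measure. h z) = (LINT z:A|circle_measure. h z) + (LINT z:(UNIV - A)|circle_measure. h z)"
        using set_integral_Un[OF _ set_int set_int, of A "UNIV - A"] A by (simp add: Un_Diff_cancel)
      with compl(2) closed[of UNIV] show ?case by (simp add: P_def)
    next
      case (union A)
      then have A: "A i \<in> sets borel" for i by (auto simp: borel_eq_closed)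
      \<comment> \<open>The induction runs over Borel sets of the plane, while measurable sets of
        \<open>circle_measure\<close> lie in the sphere; intersecting with the sphere does not
        change the integral.\<close>
      have eq: "(LINT z:B|circle_measure. h z) = (LINT z:(B \<inter> sphere 0 1)|circle_measure. h z)" for B
        unfolding set_lebesgue_integral_def by (intro Bochner_Integration.integral_cong) (auto simp: indicator_def)
      have "(LINT z:(\<Union>i. A i \<inter> sphere 0 1)|circle_measure. h z) = (\<Sum>i. (LINT z:(A i \<inter> sphere 0 1)|circle_measure. h z))"
      proof (rule lebesgue_integral_countable_add)
        show "set_integrable circle_measure (\<Union>i. A i \<inter> sphere 0 1) h"
          using A by (intro set_int) auto
        show "A i \<inter> sphere 0 1 \<in> sets circle_measure" for i
          using A[of i] by (auto simp: sets_circle_measure sets_restrict_space)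
        show "(A i \<inter> sphere 0 1) \<inter> (A j \<inter> sphere 0 1) = {}" if "i \<noteq> j" for i j
          using union(1) that by (auto simp: disjoint_family_on_def)
      qed
      also have "(\<Union>i. A i \<inter> sphere 0 1) = (\<Union>i. A i) \<inter> sphere 0 1" by auto
      finally show ?case using union(3) unfolding P_def by (simp flip: eq)
    next
      case (basic A)
      then show ?case using closed[of A] by simp
    next
      case empty
      show ?case by (simp add: P_def set_lebesgue_integral_def)
    qed
  qed
  \<comment> \<open>Testing on the set where \<open>g\<close> is positive; below, \<open>g\<close>
    is the real or imaginary part of \<open>h\<close> or its negative.\<close>
  have nonpos: "AE z in circle_measure. g z \<le> 0"
    if g: "integrable circle_measure g" "\<And>A. A \<in> sets borel \<Longrightarrow> (LINT z:A|circle_measure. g z) = 0"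
    for g :: "complex \<Rightarrow> real"
  proof -
    have [measurable]: "g \<in> borel_measurable circle_measure" using g by simp
    have "{z \<in> space circle_measure. g z > 0} \<in> sets circle_measure" by measurable
    then obtain A where A: "A \<in> sets borel" "{z \<in> sphere 0 1. g z > 0} = sphere 0 1 \<inter> A"
      by (auto simp: sets_circle_measure sets_restrict_space)
    have mem: "z \<in> A \<longleftrightarrow> g z > 0" if "z \<in> sphere 0 1" for z
      using A(2) that by blast
    have "(LINT z|circle_measure. max 0 (g z)) = (LINT z:A|circle_measure. g z)"
      unfolding set_lebesgue_integral_def
      by (intro Bochner_Integration.integral_cong refl) (auto simp: indicator_def max_def mem)
    then have "(LINT z|circle_measure. max 0 (g z)) = 0" using g(2)[OF A(1)] by simp
    then have "AE z in circle_measure. max 0 (g z) = 0"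
      using g(1) by (subst (asm) integral_nonneg_eq_0_iff_AE) auto
    then show ?thesis by eventually_elim (simp add: max_def split: if_splits)
  qed
  have int_Re: "(LINT z:A|circle_measure. Re (h z)) = 0" and int_Im: "(LINT z:A|circle_measure. Im (h z)) = 0"
    if "A \<in> sets borel" for A
  proof -
    have "integrable circle_measure (\<lambda>z. indicator A z *\<^sub>R h z)"
      using set_int[OF that] by (simp add: set_integrable_def)
    from integral_Re[OF this] integral_Im[OF this] all[OF that, unfolded P_def set_lebesgue_integral_def]
    show "(LINT z:A|circle_measure. Re (h z)) = 0" "(LINT z:A|circle_measure. Im (h z)) = 0"
      unfolding set_lebesgue_integral_def by simp_all
  qed
  have "AE z in circle_measure. Re (h z) \<le> 0"
    by (rule nonpos) (use int int_Re in simp_all)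
  moreover have "AE z in circle_measure. Im (h z) \<le> 0"
    by (rule nonpos) (use int int_Im in simp_all)
  moreover have "AE z in circle_measure. - Re (h z) \<le> 0"
    by (rule nonpos) (use int int_Re in \<open>simp_all add: set_lebesgue_integral_def\<close>)
  moreover have "AE z in circle_measure. - Im (h z) \<le> 0"
    by (rule nonpos) (use int int_Im in \<open>simp_all add: set_lebesgue_integral_def\<close>)
  ultimately show ?thesis
    by eventually_elim (simp add: complex_eq_iff)
qed

section \<open>Cauchy and Poisson kernels\<close>

lemma sphere_nonzero: "norm z = 1 \<Longrightarrow> z \<noteq> (0::complex)"
  by auto

lemma integral_powi_geometric_circle:
  fixes \<alpha> :: complex
  assumes "norm \<alpha> < 1"
  shows "(LINT z|circle_measure. z powi (- n) / (1 - \<alpha> * z)) = (if n \<ge> 0 then 2 * pi * \<alpha> ^ nat n else 0)"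
    and "(LINT z|circle_measure. z powi (- n) / (1 - \<alpha> / z)) = (if n \<le> 0 then 2 * pi * \<alpha> ^ nat (- n) else 0)"
proof -
  have powi: "integrable circle_measure (\<lambda>z. z powi k)" for k
    by (rule circle.integrable_const_bound[of _ 1]) (auto simp: norm_powi_sphere)
  have "(\<lambda>k. LINT z|circle_measure. z powi (- n) * (\<alpha> * z) ^ k) sums (LINT z|circle_measure. z powi (- n) / (1 - \<alpha> * z))"
    by (rule geometric_integral_sums[OF powi, where \<rho> = "norm \<alpha>"]) (use assms in \<open>auto simp: norm_mult\<close>)
  \<comment> \<open>Orthogonality leaves one index. For \<open>n < 0\<close> there is none:
    \<open>nat n\<close> is then 0, and the value attached to it is 0 as well.\<close>
  moreover have "(LINT z|circle_measure. z powi (- n) * (\<alpha> * z) ^ k) = (if k = nat n then (if n \<ge> 0 then 2 * pi * \<alpha> ^ nat n else 0) else 0)" for k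
  proof -
    have "(LINT z|circle_measure. z powi (- n) * (\<alpha> * z) ^ k) = (LINT z|circle_measure. \<alpha> ^ k * z powi (int k - n))"
      by (intro Bochner_Integration.integral_cong) (auto simp: power_mult_distrib power_int_diff power_int_minus field_simps dest: sphere_nonzero)
    then show ?thesis by (auto simp: integral_powi_circle)
  qed
  ultimately show "(LINT z|circle_measure. z powi (- n) / (1 - \<alpha> * z)) = (if n \<ge> 0 then 2 * pi * \<alpha> ^ nat n else 0)"
    using sums_unique2[OF _ sums_single[of "nat n" "\<lambda>_. if n \<ge> 0 then 2 * pi * \<alpha> ^ nat n else 0"]] by simp
  have "(\<lambda>k. LINT z|circle_measure. z powi (- n) * (\<alpha> / z) ^ k) sums (LINT z|circle_measure. z powi (- n) / (1 - \<alpha> / z))"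
    by (rule geometric_integral_sums[OF powi, where \<rho> = "norm \<alpha>"]) (use assms in \<open>auto simp: norm_divide\<close>)
  moreover have "(LINT z|circle_measure. z powi (- n) * (\<alpha> / z) ^ k) = (if k = nat (- n) then (if n \<le> 0 then 2 * pi * \<alpha> ^ nat (- n) else 0) else 0)" for k
  proof -
    have "(LINT z|circle_measure. z powi (- n) * (\<alpha> / z) ^ k) = (LINT z|circle_measure. \<alpha> ^ k * z powi (- int k - n))"
      by (intro Bochner_Integration.integral_cong) (auto simp: power_divide power_int_diff power_int_minus field_simps dest: sphere_nonzero)
    then show ?thesis by (auto simp: integral_powi_circle)
  qed
  ultimately show "(LINT z|circle_measure. z powi (- n) / (1 - \<alpha> / z)) = (if n \<le> 0 then 2 * pi * \<alpha> ^ nat (- n) else 0)"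
    using sums_unique2[OF _ sums_single[of "nat (- n)" "\<lambda>_. if n \<le> 0 then 2 * pi * \<alpha> ^ nat (- n) else 0"]] by simp
qed

lemma integrable_powi_geometric_circle:
  fixes \<alpha> :: complex
  assumes "norm \<alpha> < 1"
  shows "integrable circle_measure (\<lambda>z. z powi n / (1 - \<alpha> * z))"
    and "integrable circle_measure (\<lambda>z. z powi n / (1 - \<alpha> / z))"
proof -
  have powi: "integrable circle_measure (\<lambda>z. z powi k)" for k
    by (rule circle.integrable_const_bound[of _ 1]) (auto simp: norm_powi_sphere)
  show "integrable circle_measure (\<lambda>z. z powi n / (1 - \<alpha> * z))"
    by (rule geometric_integral_sums(2)[OF powi, where \<rho> = "norm \<alpha>"]) (use assms in \<open>auto simp: norm_mult\<close>)
  show "integrable circle_measure (\<lambda>z. z powi n / (1 - \<alpha> / z))"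
    by (rule geometric_integral_sums(2)[OF powi, where \<rho> = "norm \<alpha>"]) (use assms in \<open>auto simp: norm_divide\<close>)
qed

text \<open>With \<open>w = e^-s z\<close> and \<open>\<xi> = e^-\<sigma> \<eta>\<close>, the value
  at \<open>r = e^(s - \<sigma>)\<close> is \<open>w / (\<xi> - w)\<close>, the Cauchy kernel times
  \<open>w\<close>. Depending on time only through \<open>s - \<sigma>\<close>, it is a convolution
  kernel on the cylinder.\<close>

definition cauchy_kernel :: "real \<Rightarrow> complex \<Rightarrow> complex \<Rightarrow> complex" where
  "cauchy_kernel r \<eta> z = z / (of_real r * \<eta> - z)"

text \<open>Expansion in \<open>z / (r \<eta>)\<close> for \<open>r > 1\<close> and in
  \<open>r \<eta> / z\<close> for \<open>r < 1\<close>; the constant term occurs only in the second,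
  whence \<open>n \<ge> 1\<close> against \<open>n \<le> 0\<close>. Across \<open>r = 1\<close>
  every coefficient jumps by \<open>2 pi \<eta>^-n\<close>, so the kernel divided by
  \<open>2 pi\<close> is a fundamental solution of \<open>d/ds + D\<close>.\<close>

lemma integral_cauchy_kernel_circle:
  fixes \<eta> :: complex
  assumes r: "r > 0" "r \<noteq> 1" and \<eta>: "\<eta> \<in> sphere 0 1"
  shows "(LINT z|circle_measure. cauchy_kernel r \<eta> z * z powi (- n)) =
    2 * pi * (of_bool (r > 1 \<and> n \<ge> 1) - of_bool (r < 1 \<and> n \<le> 0)) * of_real r powi (- n) * \<eta> powi (- n)"
proof (cases "r > 1")
  case True
  have \<eta>0: "\<eta> \<noteq> 0" using \<eta> by auto
  define \<alpha> where "\<alpha> = inverse (of_real r * \<eta>)"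
  have \<alpha>: "norm \<alpha> < 1"
    using True \<eta> by (simp add: \<alpha>_def norm_inverse norm_mult inverse_less_1_iff)
  have eq: "cauchy_kernel r \<eta> z * z powi (- n) = z powi (- n) / (1 - \<alpha> * z) - z powi (- n)" if "z \<in> sphere 0 1" for z
  proof -
    have "norm (\<alpha> * z) < 1" using that \<alpha> by (simp add: norm_mult)
    then have "1 - \<alpha> * z \<noteq> 0" by auto
    moreover have \<alpha>z: "1 - \<alpha> * z = (of_real r * \<eta> - z) / (of_real r * \<eta>)"
      using r \<eta>0 by (simp add: \<alpha>_def field_simps)
    ultimately have "of_real r * \<eta> - z \<noteq> 0" by auto
    then have "cauchy_kernel r \<eta> z = 1 / (1 - \<alpha> * z) - 1"
      unfolding \<alpha>z using r \<eta>0 by (simp add: cauchy_kernel_def divide_simps)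
    then show ?thesis by (simp add: left_diff_distrib)
  qed
  have "(LINT z|circle_measure. cauchy_kernel r \<eta> z * z powi (- n)) =
    (LINT z|circle_measure. z powi (- n) / (1 - \<alpha> * z)) - (LINT z|circle_measure. z powi (- n))"
    using integrable_powi_geometric_circle(1)[OF \<alpha>, of "-n"] integrable_powi_geometric_circle(1)[of 0 "-n"]
    by (subst Bochner_Integration.integral_diff[symmetric]) (auto simp: eq simp del: Bochner_Integration.integral_diff intro!: Bochner_Integration.integral_cong)
  also have "\<dots> = 2 * pi * of_bool (n \<ge> 1) * \<alpha> powi n"
    unfolding integral_powi_geometric_circle(1)[OF \<alpha>] integral_powi_circle by (auto simp: power_int_def)
  finally show ?thesis
    using True by (simp add: \<alpha>_def power_int_minus power_int_inverse power_int_mult_distrib)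
next
  case False
  have \<eta>0: "\<eta> \<noteq> 0" using \<eta> by auto
  define \<alpha> where "\<alpha> = of_real r * \<eta>"
  have \<alpha>: "norm \<alpha> < 1"
    using r False \<eta> by (simp add: \<alpha>_def norm_mult)
  have eq: "cauchy_kernel r \<eta> z * z powi (- n) = - (z powi (- n) / (1 - \<alpha> / z))" if "z \<in> sphere 0 1" for z
  proof -
    have z0: "z \<noteq> 0" using that by auto
    have "norm (\<alpha> / z) < 1" using that \<alpha> by (simp add: norm_divide)
    then have "1 - \<alpha> / z \<noteq> 0" by auto
    moreover have "1 - \<alpha> / z = - (of_real r * \<eta> - z) / z"
      using z0 by (simp add: \<alpha>_def field_simps)
    ultimately show ?thesis
      using z0 by (simp add: cauchy_kernel_def field_simps)
  qed
  have "(LINT z|circle_measure. cauchy_kernel r \<eta> z * z powi (- n)) =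
    - (LINT z|circle_measure. z powi (- n) / (1 - \<alpha> / z))"
    by (subst Bochner_Integration.integral_minus[symmetric]) (auto simp: eq simp del: Bochner_Integration.integral_minus intro!: Bochner_Integration.integral_cong)
  also have "\<dots> = - (2 * pi * of_bool (n \<le> 0) * \<alpha> powi (- n))"
    by (subst integral_powi_geometric_circle(2)[OF \<alpha>]) (auto simp: power_int_def)
  finally show ?thesis
    using False r by (simp add: \<alpha>_def power_int_mult_distrib)
qed

section \<open>The Poisson kernel and the half-heat semigroup\<close>

definition poisson_kernel :: "real \<Rightarrow> complex \<Rightarrow> real" where
  "poisson_kernel r w = (1 - r\<^sup>2) / (norm (1 - of_real r * w))\<^sup>2"

lemma poisson_kernel_nonneg: "0 \<le> r \<Longrightarrow> r \<le> 1 \<Longrightarrow> poisson_kernel r w \<ge> 0"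
  by (simp add: poisson_kernel_def power_le_one)

text \<open>The two fractions are the geometric series over \<open>n \<ge> 0\<close> and
  \<open>n \<le> 0\<close>; the final 1 removes the constant term counted twice.\<close>

lemma poisson_kernel_eq:
  fixes z \<eta> :: complex
  assumes "0 \<le> r" "r < 1" "z \<in> sphere 0 1" "\<eta> \<in> sphere 0 1"
  shows "of_real (poisson_kernel r (z / \<eta>)) = 1 / (1 - of_real r / \<eta> * z) + 1 / (1 - of_real r * \<eta> / z) - (1 :: complex)"
proof -
  define w where "w = z / \<eta>"
  have w: "norm w = 1" using assms by (simp add: w_def norm_divide)
  have 0: "z \<noteq> 0" "\<eta> \<noteq> 0" using assms by auto
  have "norm (of_real r * w) < 1" "norm (of_real r * cnj w) < 1" using w assms by (simp_all add: norm_mult)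
  then have nz: "1 - of_real r * w \<noteq> 0" "1 - of_real r * cnj w \<noteq> 0" by auto
  have "w * cnj w = 1" using w by (simp add: complex_norm_square[symmetric])
  have "of_real (poisson_kernel r w) = (1 - of_real r ^ 2) / ((1 - of_real r * w) * (1 - of_real r * cnj w))"
    using complex_norm_square[of "1 - of_real r * w"] by (simp add: poisson_kernel_def)
  also have "\<dots> = 1 / (1 - of_real r * w) + 1 / (1 - of_real r * cnj w) - 1"
  proof -
    have "1 - of_real r ^ 2 = (1 - of_real r * w) + (1 - of_real r * cnj w) - (1 - of_real r * w) * (1 - of_real r * cnj w)"
      using \<open>w * cnj w = 1\<close> by algebra
    moreover have "(a + b - a * b) / (a * b) = 1 / a + 1 / b - 1" if "a \<noteq> 0" "b \<noteq> 0" for a b :: complex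
      using that by (simp add: divide_simps)
    ultimately show ?thesis using nz by metis
  qed
  also have "of_real r * cnj w = of_real r * \<eta> / z"
    using \<open>w * cnj w = 1\<close> 0 by (simp add: w_def field_simps)
  finally show ?thesis by (simp add: w_def)
qed

lemma integral_poisson_kernel_circle:
  fixes \<eta> :: complex
  assumes r: "0 \<le> r" "r < 1" and \<eta>: "\<eta> \<in> sphere 0 1"
  shows "(LINT z|circle_measure. of_real (poisson_kernel r (z / \<eta>)) * z powi (- n)) =
         2 * pi * of_real r ^ nat \<bar>n\<bar> * \<eta> powi (- n)"
proof -
  have \<alpha>: "norm (of_real r / \<eta>) < 1" "norm (of_real r * \<eta>) < 1"
    using r \<eta> by (simp_all add: norm_divide norm_mult)
  have "(LINT z|circle_measure. of_real (poisson_kernel r (z / \<eta>)) * z powi (- n)) =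
     (LINT z|circle_measure. z powi (- n) / (1 - of_real r / \<eta> * z) + z powi (- n) / (1 - of_real r * \<eta> / z) - z powi (- n))"
    using r \<eta> by (intro Bochner_Integration.integral_cong refl) (simp add: poisson_kernel_eq algebra_simps)
  also have "\<dots> = (LINT z|circle_measure. z powi (- n) / (1 - of_real r / \<eta> * z)) +
     (LINT z|circle_measure. z powi (- n) / (1 - of_real r * \<eta> / z)) - (LINT z|circle_measure. z powi (- n))"
    using integrable_powi_geometric_circle(1)[OF \<alpha>(1), of "-n"] integrable_powi_geometric_circle(2)[OF \<alpha>(2), of "-n"]
      integrable_powi_geometric_circle(1)[of 0 "-n"]
    by (subst Bochner_Integration.integral_diff Bochner_Integration.integral_add;
        (intro Bochner_Integration.integrable_add)?; simp)+
  also have "\<dots> = 2 * pi * of_real r ^ nat \<bar>n\<bar> * \<eta> powi (- n)"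
    unfolding integral_powi_geometric_circle(1)[OF \<alpha>(1)] integral_powi_geometric_circle(2)[OF \<alpha>(2)] integral_powi_circle
    by (auto simp: power_int_def power_divide power_mult_distrib power_inverse field_simps)
  finally show ?thesis .
qed

text \<open>Both halves contain the index 0, hence the subtraction of \<open>a 0\<close>.\<close>

lemma has_sum_int:
  fixes a :: "int \<Rightarrow> complex"
  assumes "summable (\<lambda>k. norm (a (int k)))" "(\<lambda>k. a (int k)) sums A"
    and "summable (\<lambda>k. norm (a (- int k)))" "(\<lambda>k. a (- int k)) sums B"
  shows "(a has_sum (A + B - a 0)) UNIV"
proof -
  have "((\<lambda>k. a (int k)) has_sum A) UNIV"
    by (rule norm_summable_imp_has_sum) fact+
  then have 1: "(a has_sum A) (range int)"
    by (subst has_sum_reindex) (auto simp: o_def)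
  have "((\<lambda>k. a (- int (Suc k))) has_sum (B - a 0)) UNIV"
    using assms(3,4) sums_Suc_iff[of "\<lambda>k. a (- int k)" "B - a 0"]
    by (intro norm_summable_imp_has_sum) (simp_all only: summable_Suc_iff[of "\<lambda>k. norm (a (- int k))"], simp)
  then have 2: "(a has_sum (B - a 0)) (range (\<lambda>k. - int (Suc k)))"
    by (subst has_sum_reindex) (auto simp: o_def inj_on_def)
  have 3: "range int \<union> range (\<lambda>k. - int (Suc k)) = UNIV"
  proof (intro equalityI subsetI UNIV_I)
    fix n :: int
    show "n \<in> range int \<union> range (\<lambda>k. - int (Suc k))"
      by (cases n rule: int_cases) auto
  qed
  have "(a has_sum (A + (B - a 0))) (range int \<union> range (\<lambda>k. - int (Suc k)))"
    by (intro has_sum_Un_disjoint 1 2) auto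
  then show ?thesis unfolding 3 by (simp add: add_diff_eq)
qed

lemma norm_fourier_coeff_le:
  assumes "integrable circle_measure f"
  shows "norm (fourier_coeff f n) \<le> (LINT z|circle_measure. norm (f z)) / (2 * pi)"
proof -
  have "norm (LINT z|circle_measure. f z * z powi (- n)) \<le> (LINT z|circle_measure. norm (f z * z powi (- n)))"
    by (rule integral_norm_bound)
  also have "\<dots> = (LINT z|circle_measure. norm (f z))"
    by (intro Bochner_Integration.integral_cong refl) (simp add: norm_mult norm_powi_sphere)
  finally show ?thesis
    by (simp add: fourier_coeff_def norm_divide divide_right_mono)
qed

text \<open>An integral kernel in place of the unordered sum turns Duhamel's formula into one
  integral over the cylinder, open to Fubini. Integrability of \<open>f\<close> is the right
  hypothesis because it holds for almost every time slice of a control.\<close>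

lemma half_heat_semigroup_poisson:
  assumes f: "integrable circle_measure f" and t: "t > 0" and z: "z \<in> sphere 0 1"
  shows "half_heat_semigroup t f z =
    (LINT \<eta>|circle_measure. f \<eta> * of_real (poisson_kernel (exp (- t)) (z / \<eta>))) / (2 * pi)"
proof -
  define r where "r = exp (- t)"
  have r: "0 < r" "r < 1" using t by (auto simp: r_def)
  define a where "a n = fourier_coeff f n * exp (- (of_int \<bar>n\<bar> * of_real t)) * z powi n" for n
  have exp_eq: "exp (- (of_int \<bar>n\<bar> * of_real t)) = (of_real r :: complex) ^ nat \<bar>n\<bar>" for n :: int
  proof -
    have "exp (- (of_int \<bar>n\<bar> * of_real t)) = (of_real (exp (of_nat (nat \<bar>n\<bar>) * (- t))) :: complex)"
    proof -
      have "(of_int \<bar>n\<bar> :: complex) = of_real \<bar>of_int n\<bar>"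
        by (metis of_int_abs of_real_of_int_eq)
      then show ?thesis by (simp add: exp_of_real[symmetric])
    qed
    also have "exp (of_nat (nat \<bar>n\<bar>) * (- t)) = r ^ nat \<bar>n\<bar>" unfolding r_def by (rule exp_of_nat_mult)
    finally show ?thesis by simp
  qed
  define C where "C = (LINT z|circle_measure. norm (f z)) / (2 * pi)"
  have bound: "norm (a n) \<le> C * r ^ nat \<bar>n\<bar>" for n
    using norm_fourier_coeff_le[OF f, of n, folded C_def] r z
    by (auto simp: a_def exp_eq norm_mult norm_power norm_powi_sphere intro!: mult_right_mono)
  have sum: "summable (\<lambda>k. norm (a (int k)))" "summable (\<lambda>k. norm (a (- int k)))"
    by (rule summable_comparison_test'[of "\<lambda>k. C * r ^ k" 0]; use bound[of "int _"] bound[of "- int _"] r in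
        \<open>auto intro!: summable_mult summable_geometric\<close>)+
  have "(\<lambda>k. LINT \<eta>|circle_measure. f \<eta> * (of_real r * z / \<eta>) ^ k) sums
      (LINT \<eta>|circle_measure. f \<eta> / (1 - of_real r * z / \<eta>))"
    and i1: "integrable circle_measure (\<lambda>\<eta>. f \<eta> / (1 - of_real r * z / \<eta>))"
    by (rule geometric_integral_sums[OF f, where \<rho> = r]; use r z in \<open>simp add: norm_mult norm_divide\<close>)+
  moreover have "(LINT \<eta>|circle_measure. f \<eta> * (of_real r * z / \<eta>) ^ k) = 2 * pi * a (int k)" for k
  proof -
    have "(LINT \<eta>|circle_measure. f \<eta> * (of_real r * z / \<eta>) ^ k) = (LINT \<eta>|circle_measure. (of_real r * z) ^ k * (f \<eta> * \<eta> powi (- int k)))"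
      by (intro Bochner_Integration.integral_cong) (auto simp: power_divide power_int_minus field_simps)
    then show ?thesis unfolding a_def exp_eq
      by (simp add: fourier_coeff_def power_mult_distrib)
  qed
  ultimately have s1: "(\<lambda>k. a (int k)) sums ((LINT \<eta>|circle_measure. f \<eta> / (1 - of_real r * z / \<eta>)) / (2 * pi))"
    using sums_divide[of "\<lambda>k. 2 * pi * a (int k)" _ "2 * pi"] by simp
  have "(\<lambda>k. LINT \<eta>|circle_measure. f \<eta> * (of_real r / z * \<eta>) ^ k) sums
      (LINT \<eta>|circle_measure. f \<eta> / (1 - of_real r / z * \<eta>))"
    and i2: "integrable circle_measure (\<lambda>\<eta>. f \<eta> / (1 - of_real r / z * \<eta>))"
    by (rule geometric_integral_sums[OF f, where \<rho> = r]; use r z in \<open>simp add: norm_mult norm_divide\<close>)+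
  moreover have "(LINT \<eta>|circle_measure. f \<eta> * (of_real r / z * \<eta>) ^ k) = 2 * pi * a (- int k)" for k
  proof -
    have "(LINT \<eta>|circle_measure. f \<eta> * (of_real r / z * \<eta>) ^ k) = (LINT \<eta>|circle_measure. (of_real r / z) ^ k * (f \<eta> * \<eta> powi (- (- int k))))"
      by (intro Bochner_Integration.integral_cong) (auto simp: power_mult_distrib power_divide)
    also have "\<dots> = (of_real r / z) ^ k * (LINT \<eta>|circle_measure. f \<eta> * \<eta> powi (- (- int k)))"
      by (rule Bochner_Integration.integral_mult_right_zero)
    also have "\<dots> = (of_real r / z) ^ k * (2 * pi * fourier_coeff f (- int k))"
      by (simp add: fourier_coeff_def)
    finally show ?thesis unfolding a_def exp_eq
      by (simp add: power_divide power_int_minus field_simps)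
  qed
  ultimately have s2: "(\<lambda>k. a (- int k)) sums ((LINT \<eta>|circle_measure. f \<eta> / (1 - of_real r / z * \<eta>)) / (2 * pi))"
    using sums_divide[of "\<lambda>k. 2 * pi * a (- int k)" _ "2 * pi"] by simp
  have "half_heat_semigroup t f z = infsum a UNIV"
    using t unfolding half_heat_semigroup_def a_def by simp
  also have "\<dots> = (LINT \<eta>|circle_measure. f \<eta> / (1 - of_real r * z / \<eta>)) / (2 * pi) +
      (LINT \<eta>|circle_measure. f \<eta> / (1 - of_real r / z * \<eta>)) / (2 * pi) - a 0"
    by (rule infsumI[OF has_sum_int[OF sum(1) s1 sum(2) s2]])
  also have "\<dots> = ((LINT \<eta>|circle_measure. f \<eta> / (1 - of_real r * z / \<eta>)) +
      (LINT \<eta>|circle_measure. f \<eta> / (1 - of_real r / z * \<eta>)) - (LINT \<eta>|circle_measure. f \<eta>)) / (2 * pi)"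
    by (simp add: a_def fourier_coeff_def add_divide_distrib diff_divide_distrib)
  also have "\<dots> = (LINT \<eta>|circle_measure. f \<eta> / (1 - of_real r * z / \<eta>) + f \<eta> / (1 - of_real r / z * \<eta>) - f \<eta>) / (2 * pi)"
    using i1 i2 f by simp
  also have "(LINT \<eta>|circle_measure. f \<eta> / (1 - of_real r * z / \<eta>) + f \<eta> / (1 - of_real r / z * \<eta>) - f \<eta>) =
      (LINT \<eta>|circle_measure. f \<eta> * of_real (poisson_kernel (exp (- t)) (z / \<eta>)))"
    using r z unfolding r_def[symmetric]
    by (intro Bochner_Integration.integral_cong refl) (simp add: poisson_kernel_eq algebra_simps)
  finally show ?thesis .
qed

section \<open>Null controls as a moment problem\<close>

lemma borel_measurable_circle_valued [measurable (raw)]: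
  "f \<in> measurable M circle_measure \<Longrightarrow> f \<in> borel_measurable M"
  using measurable_compose[OF _ measurable_circle_borel] by blast

text \<open>For \<open>r < 1\<close> the Poisson kernel is nonnegative with total mass
  \<open>2 pi\<close>, so integrability of \<open>g\<close> alone justifies Fubini. At
  \<open>r = 1\<close> the formula for the kernel yields 0 instead of a point mass, which the factor
  \<open>of_bool\<close> records. The lemma serves for the free evolution with \<open>M\<close> the
  circle and for the Duhamel term with \<open>M\<close> the cylinder.\<close>

lemma poisson_superposition:
  fixes g :: "'a \<Rightarrow> complex" and r :: "'a \<Rightarrow> real" and y :: "'a \<Rightarrow> complex"
  assumes "sigma_finite_measure M"
    and g: "integrable M g"
    and r [measurable]: "r \<in> borel_measurable M" and r01: "\<And>p. p \<in> space M \<Longrightarrow> 0 \<le> r p \<and> (r p = 1 \<or> g p = 0 \<or> r p < 1)"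
    and y [measurable]: "y \<in> measurable M circle_measure"
  defines "F \<equiv> \<lambda>z p. g p * of_real (poisson_kernel (r p) (z / y p))"
  shows "AE z in circle_measure. integrable M (F z)"
    and "integrable circle_measure (\<lambda>z. LINT p|M. F z p)"
    and "(LINT z|circle_measure. (LINT p|M. F z p) * z powi (- n)) =
         2 * pi * (LINT p|M. g p * of_real (of_bool (r p < 1) * r p ^ nat \<bar>n\<bar>) * y p powi (- n))"
proof -
  interpret M: sigma_finite_measure M by fact
  interpret P: pair_sigma_finite M circle_measure ..
  have [measurable]: "g \<in> borel_measurable M" using g by simp
  have y_sphere: "y p \<in> sphere 0 1" if "p \<in> space M" for p
    using measurable_space[OF y that] by simp
  have coeff: "(LINT z|circle_measure. F z p * z powi (- n)) =
      2 * pi * (g p * of_real (of_bool (r p < 1) * r p ^ nat \<bar>n\<bar>) * y p powi (- n))" if p: "p \<in> space M" for p n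
  proof (cases "r p < 1")
    case True
    have "(LINT z|circle_measure. F z p * z powi (- n)) =
      g p * (LINT z|circle_measure. of_real (poisson_kernel (r p) (z / y p)) * z powi (- n))"
      by (simp add: F_def mult.assoc)
    then show ?thesis
      using True r01[OF p] by (subst (asm) integral_poisson_kernel_circle[OF _ _ y_sphere[OF p]]) auto
  next
    case False
    then show ?thesis using r01[OF p] by (auto simp: F_def poisson_kernel_def)
  qed
  have norm_F: "(LINT z|circle_measure. norm (F z p)) = 2 * pi * of_bool (r p < 1) * norm (g p)"
    and int_F: "integrable circle_measure (\<lambda>z. F z p)" if p: "p \<in> space M" for p
  proof -
    let ?K = "\<lambda>z. poisson_kernel (r p) (z / y p)"
    consider "r p < 1" | "r p \<ge> 1" by linarith
    then have "(LINT z|circle_measure. ?K z * norm (g p)) = 2 * pi * of_bool (r p < 1) * norm (g p) \<and>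
         integrable circle_measure (\<lambda>z. F z p) \<and> (\<forall>z. norm (F z p) = ?K z * norm (g p))"
    proof cases
      case 1
      then have r: "0 \<le> r p" "r p < 1" using r01[OF p] by auto
      have "of_real (LINT z|circle_measure. ?K z) = (LINT z|circle_measure. of_real (?K z) * z powi (- 0))"
        by (simp flip: integral_complex_of_real)
      also have "\<dots> = of_real (2 * pi)"
        by (subst integral_poisson_kernel_circle[OF r y_sphere[OF p]]) simp
      finally have "(LINT z|circle_measure. ?K z) = 2 * pi" by (simp only: of_real_eq_iff)
      \<comment> \<open>A non-integrable function has integral 0 by convention, so the value
        \<open>2 pi\<close> itself proves integrability.\<close>
      moreover from this have "integrable circle_measure ?K"
        using not_integrable_integral_eq[of circle_measure ?K] pi_gt_zero by (cases "integrable circle_measure ?K") auto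
      ultimately show ?thesis
        using 1 r poisson_kernel_nonneg[of "r p"] by (auto simp: F_def norm_mult intro: integrable_of_real)
    next
      case 2
      then show ?thesis using r01[OF p] by (auto simp: F_def poisson_kernel_def)
    qed
    then show "(LINT z|circle_measure. norm (F z p)) = 2 * pi * of_bool (r p < 1) * norm (g p)"
      and "integrable circle_measure (\<lambda>z. F z p)" by auto
  qed
  have meas_F [measurable]: "(\<lambda>(p, z). F z p) \<in> borel_measurable (M \<Otimes>\<^sub>M circle_measure)"
    unfolding F_def poisson_kernel_def by measurable
  have int: "integrable (M \<Otimes>\<^sub>M circle_measure) (\<lambda>(p, z). F z p)"
  proof (rule P.Fubini_integrable)
    have "integrable M (\<lambda>p. 2 * pi * of_bool (r p < 1) * norm (g p))"
      by (rule Bochner_Integration.integrable_bound[of _ "\<lambda>p. 2 * pi * norm (g p)"]) (use g in auto)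
    then show "integrable M (\<lambda>p. LINT z|circle_measure. norm (case (p, z) of (p, z) \<Rightarrow> F z p))"
      by (subst Bochner_Integration.integrable_cong[OF refl]) (auto simp: norm_F)
    show "AE p in M. integrable circle_measure (\<lambda>z. case (p, z) of (p, z) \<Rightarrow> F z p)"
      using int_F by (auto intro!: AE_I2)
  qed simp
  show "AE z in circle_measure. integrable M (F z)"
    using P.AE_integrable_snd[OF int] .
  show "integrable circle_measure (\<lambda>z. LINT p|M. F z p)"
    using P.integrable_snd[OF int] .
  have int_n: "integrable (M \<Otimes>\<^sub>M circle_measure) (\<lambda>(p, z). F z p * z powi (- n))"
    by (rule Bochner_Integration.integrable_bound[OF int])
       (auto simp: norm_mult norm_powi_sphere space_pair_measure split_beta intro!: AE_I2)
  have "(LINT z|circle_measure. (LINT p|M. F z p) * z powi (- n)) = (LINT z|circle_measure. (LINT p|M. F z p * z powi (- n)))"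
    by (intro Bochner_Integration.integral_cong refl) simp
  also have "\<dots> = (LINT p|M. (LINT z|circle_measure. F z p * z powi (- n)))"
    by (rule P.Fubini_integral[OF int_n])
  also have "\<dots> = (LINT p|M. 2 * pi * (g p * of_real (of_bool (r p < 1) * r p ^ nat \<bar>n\<bar>) * y p powi (- n)))"
    by (intro Bochner_Integration.integral_cong refl coeff)
  finally show "(LINT z|circle_measure. (LINT p|M. F z p) * z powi (- n)) =
         2 * pi * (LINT p|M. g p * of_real (of_bool (r p < 1) * r p ^ nat \<bar>n\<bar>) * y p powi (- n))"
    by simp
qed

section \<open>Square-integrable controls extended by zero\<close>

lemma restrict_space_pair_measure:
  assumes "sigma_finite_measure M" "sigma_finite_measure N" and A: "A \<in> sets M" and B: "B \<in> sets N"
  shows "restrict_space M A \<Otimes>\<^sub>M restrict_space N B = restrict_space (M \<Otimes>\<^sub>M N) (A \<times> B)"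
proof -
  interpret M: sigma_finite_measure M by fact
  interpret N: sigma_finite_measure N by fact
  have AB: "A \<times> B \<in> sets (M \<Otimes>\<^sub>M N)" using A B by simp
  have AsM: "A \<subseteq> space M" "B \<subseteq> space N" using A B by (auto dest: sets.sets_into_space)
  have space: "space (restrict_space M A \<Otimes>\<^sub>M restrict_space N B) = A \<times> B"
    using A B by (simp add: space_pair_measure)
  have 1: "(\<lambda>x. x) \<in> measurable (restrict_space M A \<Otimes>\<^sub>M restrict_space N B) (M \<Otimes>\<^sub>M N)"
    by (rule measurable_pair)
       (auto simp: o_def intro!: measurable_compose[OF measurable_fst] measurable_compose[OF measurable_snd] measurable_restrict_space1)
  have 2: "(\<lambda>x. x) \<in> measurable (restrict_space (M \<Otimes>\<^sub>M N) (A \<times> B)) (restrict_space M A \<Otimes>\<^sub>M restrict_space N B)"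
  proof (rule measurable_pair; rule measurable_restrict_space2)
    show "fst \<circ> (\<lambda>x. x) \<in> measurable (restrict_space (M \<Otimes>\<^sub>M N) (A \<times> B)) M"
      and "snd \<circ> (\<lambda>x. x) \<in> measurable (restrict_space (M \<Otimes>\<^sub>M N) (A \<times> B)) N"
      by (auto simp: o_def intro!: measurable_restrict_space1)
  qed (auto simp: space_restrict_space)
  show ?thesis
  proof (rule pair_measure_eqI)
    show "sigma_finite_measure (restrict_space M A)" "sigma_finite_measure (restrict_space N B)"
      using A B M.sigma_finite_measure_axioms N.sigma_finite_measure_axioms
      by (auto intro!: sigma_finite_measure_restrict_space)
    show "sets (restrict_space M A \<Otimes>\<^sub>M restrict_space N B) = sets (restrict_space (M \<Otimes>\<^sub>M N) (A \<times> B))"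
    proof (intro equalityI subsetI)
      fix X assume X: "X \<in> sets (restrict_space M A \<Otimes>\<^sub>M restrict_space N B)"
      from measurable_sets[OF 2 X] sets.sets_into_space[OF X] AsM
      show "X \<in> sets (restrict_space (M \<Otimes>\<^sub>M N) (A \<times> B))"
        by (simp add: space space_restrict_space space_pair_measure Int_absorb2 Int_absorb1 Sigma_mono)
    next
      fix X assume "X \<in> sets (restrict_space (M \<Otimes>\<^sub>M N) (A \<times> B))"
      then obtain Y where Y: "Y \<in> sets (M \<Otimes>\<^sub>M N)" "X = A \<times> B \<inter> Y"
        by (auto simp: sets_restrict_space)
      from measurable_sets[OF 1 Y(1)] show "X \<in> sets (restrict_space M A \<Otimes>\<^sub>M restrict_space N B)"
        by (simp add: space Y(2) Int_commute)
    qed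
    fix X Y assume XY: "X \<in> sets (restrict_space M A)" "Y \<in> sets (restrict_space N B)"
    then have XY': "X \<in> sets M" "Y \<in> sets N" "X \<subseteq> A" "Y \<subseteq> B"
      using A B by (auto simp: sets_restrict_space_iff)
    then have "emeasure (restrict_space (M \<Otimes>\<^sub>M N) (A \<times> B)) (X \<times> Y) = emeasure (M \<Otimes>\<^sub>M N) (X \<times> Y)"
      using AB by (intro emeasure_restrict_space) auto
    also have "\<dots> = emeasure M X * emeasure N Y"
      using XY' by (intro N.emeasure_pair_measure_Times)
    finally show "emeasure (restrict_space M A) X * emeasure (restrict_space N B) Y =
        emeasure (restrict_space (M \<Otimes>\<^sub>M N) (A \<times> B)) (X \<times> Y)"
      using XY' A B by (simp add: emeasure_restrict_space)
  qed
qed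

lemma L2_add:
  assumes "f \<in> L2 M" "g \<in> L2 M"
  shows "(\<lambda>x. f x + g x) \<in> L2 M"
proof -
  have m: "f \<in> borel_measurable M" "g \<in> borel_measurable M" and
    i: "integrable M (\<lambda>x. (norm (f x))\<^sup>2)" "integrable M (\<lambda>x. (norm (g x))\<^sup>2)"
    using assms by (auto simp: L2_def)
  have le: "(norm (f x + g x))\<^sup>2 \<le> 2 * (norm (f x))\<^sup>2 + 2 * (norm (g x))\<^sup>2" for x
  proof -
    have "(norm (f x + g x))\<^sup>2 \<le> (norm (f x) + norm (g x))\<^sup>2"
      by (intro power_mono norm_triangle_ineq) simp
    also have "\<dots> \<le> 2 * (norm (f x))\<^sup>2 + 2 * (norm (g x))\<^sup>2"
      using sum_squares_bound[of "norm (f x)" "norm (g x)"] by (simp add: power2_sum)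
    finally show ?thesis .
  qed
  have "integrable M (\<lambda>x. (norm (f x + g x))\<^sup>2)"
  proof (rule Bochner_Integration.integrable_bound)
    show "integrable M (\<lambda>x. 2 * (norm (f x))\<^sup>2 + 2 * (norm (g x))\<^sup>2)"
      by (intro Bochner_Integration.integrable_add integrable_mult_right i)
    show "(\<lambda>x. (norm (f x + g x))\<^sup>2) \<in> borel_measurable M"
      using m by measurable
    show "AE x in M. norm ((norm (f x + g x))\<^sup>2) \<le> norm (2 * (norm (f x))\<^sup>2 + 2 * (norm (g x))\<^sup>2)"
      using le by simp
  qed
  then show ?thesis using m by (simp add: L2_def)
qed

lemma L2_mult_bounded:
  assumes f: "f \<in> L2 M" and w: "w \<in> borel_measurable M" "\<And>x. x \<in> space M \<Longrightarrow> norm (w x) \<le> B"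
  shows "(\<lambda>x. w x * f x) \<in> L2 M"
proof -
  have m: "f \<in> borel_measurable M" and i: "integrable M (\<lambda>x. (norm (f x))\<^sup>2)"
    using f by (auto simp: L2_def)
  have "integrable M (\<lambda>x. (norm (w x * f x))\<^sup>2)"
  proof (rule Bochner_Integration.integrable_bound)
    show "integrable M (\<lambda>x. B\<^sup>2 * (norm (f x))\<^sup>2)" using i by (rule integrable_mult_right)
    show "(\<lambda>x. (norm (w x * f x))\<^sup>2) \<in> borel_measurable M"
      using m w(1) by measurable
    have "(norm (w x * f x))\<^sup>2 \<le> B\<^sup>2 * (norm (f x))\<^sup>2" if "x \<in> space M" for x
      unfolding norm_mult power_mult_distrib using w(2)[OF that] by (intro mult_right_mono power_mono) auto
    then show "AE x in M. norm ((norm (w x * f x))\<^sup>2) \<le> norm (B\<^sup>2 * (norm (f x))\<^sup>2)"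
      by (auto intro!: AE_I2)
  qed
  then show ?thesis using m w(1) by (simp add: L2_def)
qed

lemma borel_measurable_cnj [measurable (raw)]:
  "f \<in> borel_measurable M \<Longrightarrow> (\<lambda>x. cnj (f x)) \<in> borel_measurable M"
  by (rule borel_measurable_continuous_on[OF continuous_on_cnj[OF continuous_on_id]])

lemma L2_cnj: "f \<in> L2 M \<Longrightarrow> (\<lambda>x. cnj (f x)) \<in> L2 M"
  by (simp add: L2_def borel_measurable_cnj)

abbreviation cylinder_measure :: "(real \<times> complex) measure" where
  "cylinder_measure \<equiv> lborel \<Otimes>\<^sub>M circle_measure"

text \<open>All time horizons share one measure space, so that enlarging \<open>T\<close> is an
  inclusion of sets. Vanishing is demanded everywhere rather than almost everywhere, which makes it
  available in pointwise estimates.\<close>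

definition controls :: "real \<Rightarrow> complex set \<Rightarrow> (real \<times> complex \<Rightarrow> complex) set" where
  "controls T \<omega> = {U \<in> L2 cylinder_measure. \<forall>p. p \<notin> {0..T} \<times> \<omega> \<longrightarrow> U p = 0}"

definition moment :: "(real \<times> complex \<Rightarrow> complex) \<Rightarrow> int \<Rightarrow> complex" where
  "moment U n = (LINT (s, z)|cylinder_measure. U (s, z) * of_real (exp (of_int \<bar>n\<bar> * s)) * z powi (- n))"

lemma controls_L2D:
  assumes "U \<in> controls T \<omega>"
  shows "U \<in> borel_measurable cylinder_measure" "integrable cylinder_measure (\<lambda>p. (norm (U p))\<^sup>2)"
  using assms by (auto simp: controls_def L2_def)

lemma controls_zero: "U \<in> controls T \<omega> \<Longrightarrow> s \<notin> {0..T} \<or> z \<notin> \<omega> \<Longrightarrow> U (s, z) = 0"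
  by (auto simp: controls_def)

lemma integrable_strip: "integrable cylinder_measure (\<lambda>(s, z). indicator {a..b} s * c :: real)"
proof -
  have "integrable cylinder_measure (\<lambda>p. indicator ({a..b} \<times> sphere 0 1) p * c)"
  proof (intro integrable_mult_left integrable_real_indicator)
    have "sphere 0 1 \<in> sets circle_measure" by (metis sets.top space_circle_measure)
    then show "{a..b} \<times> sphere 0 1 \<in> sets cylinder_measure" by simp
    show "emeasure cylinder_measure ({a..b} \<times> sphere 0 1) < \<infinity>"
      using \<open>sphere 0 1 \<in> sets circle_measure\<close> circle.emeasure_finite
      by (subst circle.emeasure_pair_measure_Times)
         (auto simp: emeasure_lborel_Icc_eq less_top[symmetric] ennreal_mult_eq_top_iff)
  qed
  then show ?thesis
    by (rule Bochner_Integration.integrable_cong[THEN iffD1, rotated 2])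
       (auto simp: space_pair_measure indicator_def)
qed

text \<open>\<open>|U w|\<close> is at most \<open>|U|^2 + C^2\<close> on a strip of finite measure
  and 0 off the strip.\<close>

lemma integrable_weighted_control:
  fixes U w :: "real \<times> complex \<Rightarrow> complex"
  assumes U: "U \<in> borel_measurable cylinder_measure" "integrable cylinder_measure (\<lambda>p. (norm (U p))\<^sup>2)"
    and zero: "\<And>s z. s \<notin> {a..b} \<Longrightarrow> U (s, z) = 0"
    and [measurable]: "w \<in> borel_measurable cylinder_measure"
    and w: "\<And>s z. s \<in> {a..b} \<Longrightarrow> z \<in> sphere 0 1 \<Longrightarrow> norm (w (s, z)) \<le> C"
  shows "integrable cylinder_measure (\<lambda>p. U p * w p)"
proof (rule Bochner_Integration.integrable_bound)
  show "integrable cylinder_measure (\<lambda>p. (norm (U p))\<^sup>2 + (case p of (s, z) \<Rightarrow> indicator {a..b} s * C\<^sup>2))"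
    by (rule Bochner_Integration.integrable_add[OF U(2) integrable_strip])
  show "(\<lambda>p. U p * w p) \<in> borel_measurable cylinder_measure"
    by (intro borel_measurable_times U(1) assms(4))
  have "norm (U (s, z) * w (s, z)) \<le> (norm (U (s, z)))\<^sup>2 + indicator {a..b} s * C\<^sup>2"
    if "z \<in> sphere 0 1" for s z
  proof (cases "s \<in> {a..b}")
    case True
    have "norm (U (s, z)) * norm (w (s, z)) \<le> norm (U (s, z)) * C"
      using w[OF True that] by (intro mult_left_mono) auto
    also have "\<dots> \<le> (norm (U (s, z)))\<^sup>2 + C\<^sup>2"
      using sum_squares_bound[of "norm (U (s, z))" C] zero_le_power2[of "norm (U (s, z))"] zero_le_power2[of C]
      by linarith
    finally show ?thesis using True by (simp add: norm_mult)
  qed (simp add: zero)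
  note bound = this
  show "AE p in cylinder_measure. norm (U p * w p) \<le> norm ((norm (U p))\<^sup>2 + (case p of (s, z) \<Rightarrow> indicator {a..b} s * C\<^sup>2))"
  proof (rule AE_I2)
    fix p assume "p \<in> space cylinder_measure"
    then obtain s z where p: "p = (s, z)" "z \<in> sphere 0 1" by (auto simp: space_pair_measure)
    from bound[OF p(2), of s] show "norm (U p * w p) \<le> norm ((norm (U p))\<^sup>2 + (case p of (s, z) \<Rightarrow> indicator {a..b} s * C\<^sup>2))"
      unfolding p(1) prod.case real_norm_def by linarith
  qed
qed

text \<open>The product of the restricted measures is a restriction of
  \<open>cylinder_measure\<close>, so multiplying by an indicator passes from \<open>u\<close> to
  \<open>U\<close>; the solution sees \<open>u\<close> only on
  \<open>{0..T} \<times> \<omega>\<close> and does not change.\<close>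

lemma NC_L2_iff_controls:
  assumes \<omega>: "\<omega> \<in> sets circle_measure"
  shows "f\<^sub>0 \<in> NC_L2 \<omega> T \<longleftrightarrow> f\<^sub>0 \<in> L2 circle_measure \<and>
    (\<exists>U \<in> controls T \<omega>. AE z in circle_measure. half_heat_solution \<omega> f\<^sub>0 (curry U) T z = 0)"
proof -
  let ?M = "restrict_space lborel {0..T} \<Otimes>\<^sub>M restrict_space circle_measure \<omega>"
  have M: "?M = restrict_space cylinder_measure ({0..T} \<times> \<omega>)"
    by (intro restrict_space_pair_measure \<omega>)
       (auto simp: lborel.sigma_finite_measure_axioms circle.sigma_finite_measure_axioms)
  have A: "{0..T} \<times> \<omega> \<in> sets cylinder_measure" using \<omega> by simp
  have L2: "f \<in> L2 ?M \<longleftrightarrow> (\<lambda>p. indicator ({0..T} \<times> \<omega>) p *\<^sub>R f p) \<in> L2 cylinder_measure" for f :: "real \<times> complex \<Rightarrow> complex"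
  proof -
    have "(norm (indicator B p *\<^sub>R f p))\<^sup>2 = indicator B p *\<^sub>R (norm (f p))\<^sup>2" for B p
      by (simp add: indicator_def)
    then show ?thesis
      unfolding L2_def M using A
      by (simp add: borel_measurable_restrict_space_iff integrable_restrict_space)
  qed
  show ?thesis
  proof safe
    assume "f\<^sub>0 \<in> NC_L2 \<omega> T"
    then obtain u where f\<^sub>0: "f\<^sub>0 \<in> L2 circle_measure" and u: "(\<lambda>(s, z). u s z) \<in> L2 ?M"
      and 0: "AE z in circle_measure. half_heat_solution \<omega> f\<^sub>0 u T z = 0"
      by (auto simp: NC_L2_def)
    show "f\<^sub>0 \<in> L2 circle_measure" by fact
    define U where "U = (\<lambda>p. indicator ({0..T} \<times> \<omega>) p *\<^sub>R (case p of (s, z) \<Rightarrow> u s z))"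
    have "U \<in> controls T \<omega>"
      using u unfolding L2 by (auto simp: controls_def U_def)
    moreover have "half_heat_solution \<omega> f\<^sub>0 (curry U) T z = half_heat_solution \<omega> f\<^sub>0 u T z" for z
    proof -
      have "extend_by_zero \<omega> (curry U s) = extend_by_zero \<omega> (u s)" if "s \<in> {0..T}" for s
        using that by (auto simp: extend_by_zero_def U_def fun_eq_iff)
      then show ?thesis
        unfolding half_heat_solution_def set_lebesgue_integral_def
        by (intro arg_cong2[where f = "(+)"] Bochner_Integration.integral_cong refl) (auto simp: indicator_def)
    qed
    ultimately show "\<exists>U \<in> controls T \<omega>. AE z in circle_measure. half_heat_solution \<omega> f\<^sub>0 (curry U) T z = 0"
      using 0 by (intro bexI[of _ U]) simp_all
  next
    fix U assume f\<^sub>0: "f\<^sub>0 \<in> L2 circle_measure" and U: "U \<in> controls T \<omega>"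
      and 0: "AE z in circle_measure. half_heat_solution \<omega> f\<^sub>0 (curry U) T z = 0"
    have "indicator ({0..T} \<times> \<omega>) p *\<^sub>R U p = U p" for p
    proof -
      have "U p = 0" if "p \<notin> {0..T} \<times> \<omega>" using that U unfolding controls_def by blast
      then show ?thesis by (simp add: indicator_def)
    qed
    then have "U \<in> L2 ?M" unfolding L2 using U by (simp add: controls_def)
    with f\<^sub>0 0 show "f\<^sub>0 \<in> NC_L2 \<omega> T"
      unfolding NC_L2_def by (intro CollectI conjI exI[of _ "curry U"]) (simp_all add: split_beta')
  qed
qed

lemma integrable_L2_circle:
  assumes "f \<in> L2 circle_measure"
  shows "integrable circle_measure f"
proof -
  from assms have f: "f \<in> borel_measurable circle_measure" "integrable circle_measure (\<lambda>z. (norm (f z))\<^sup>2)"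
    by (auto simp: L2_def)
  have "integrable circle_measure (\<lambda>z. norm (f z))"
    by (rule circle.square_integrable_imp_integrable) (use f in auto)
  with f(1) show ?thesis by (simp add: integrable_norm_iff)
qed

text \<open>A control may have non-integrable slices at a null set of times. Their coefficients all
  take the default value 0, so the Duhamel integrand has a known value at every time, which its
  measurability requires.\<close>

lemma half_heat_semigroup_not_integrable:
  assumes "\<not> integrable circle_measure f" "t > 0"
  shows "half_heat_semigroup t f z = 0"
proof -
  have "\<not> integrable circle_measure (\<lambda>z. f z * z powi (- n))" for n
  proof
    assume "integrable circle_measure (\<lambda>z. f z * z powi (- n))"
    from integrable_mult_powi_circle[OF this, of n] have "integrable circle_measure f"
      by (rule Bochner_Integration.integrable_cong[THEN iffD1, rotated 2])
         (auto simp: power_int_minus dest: sphere_nonzero)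
    with assms show False by simp
  qed
  then show ?thesis using assms(2)
    by (simp add: half_heat_semigroup_def fourier_coeff_def not_integrable_integral_eq)
qed

text \<open>Up to the factor \<open>2 pi\<close> the final state is a superposition
  \<open>A + B\<close> of Poisson kernels. Its coefficient is \<open>e^(-|n| T)\<close>, which never
  vanishes, times a multiple of the difference of the two sides of the moment equation.\<close>

lemma half_heat_solution_zero_iff_moments:
  assumes T: "T > 0" and f\<^sub>0: "f\<^sub>0 \<in> L2 circle_measure" and U: "U \<in> controls T \<omega>"
  shows "(AE z in circle_measure. half_heat_solution \<omega> f\<^sub>0 (curry U) T z = 0) \<longleftrightarrow>
    (\<forall>n. moment U n = - (2 * pi) * fourier_coeff f\<^sub>0 n)"
proof -
  have f: "integrable circle_measure f\<^sub>0" using f\<^sub>0 by (rule integrable_L2_circle)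
  have intU: "integrable cylinder_measure U"
    using integrable_weighted_control[OF controls_L2D[OF U], where w = "\<lambda>_. 1" and a = 0 and b = T and C = 1] controls_zero[OF U]
    by auto
  have [measurable]: "f\<^sub>0 \<in> borel_measurable circle_measure" "U \<in> borel_measurable cylinder_measure"
    using f intU by simp_all
  \<comment> \<open>On the support of \<open>U\<close> this is \<open>e^(s - T)\<close>; the
    absolute value keeps it at most 1 at later times, where \<open>U\<close> vanishes.\<close>
  define q where "q p = exp (- \<bar>T - fst p\<bar>)" for p :: "real \<times> complex"
  define A where "A z = (LINT \<eta>|circle_measure. f\<^sub>0 \<eta> * of_real (poisson_kernel (exp (- T)) (z / \<eta>)))" for z
  define F where "F z p = U p * of_real (poisson_kernel (q p) (z / snd p))" for z and p :: "real \<times> complex"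
  define B where "B z = (LINT p|cylinder_measure. F z p)" for z
  have [measurable]: "q \<in> borel_measurable cylinder_measure" unfolding q_def by measurable
  have q01: "0 \<le> q p \<and> (q p = 1 \<or> U p = 0 \<or> q p < 1)" for p
    by (auto simp: q_def)
  note supA = poisson_superposition[OF circle.sigma_finite_measure_axioms f, of "\<lambda>_. exp (- T)" "\<lambda>z. z", folded A_def]
  have intA: "integrable circle_measure A"
    and coeffA: "(LINT z|circle_measure. A z * z powi (- n)) =
      2 * pi * (exp (- T) ^ nat \<bar>n\<bar> * (2 * pi * fourier_coeff f\<^sub>0 n))" for n
  proof -
    show "integrable circle_measure A" using supA(2) T by simp
    have "(LINT p|circle_measure. f\<^sub>0 p * of_real c * p powi (- n)) = of_real c * (2 * pi * fourier_coeff f\<^sub>0 n)" for c :: real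
    proof -
      have "(\<lambda>p. f\<^sub>0 p * of_real c * p powi (- n)) = (\<lambda>p. of_real c * (f\<^sub>0 p * p powi (- n)))"
        by (simp add: fun_eq_iff)
      then show ?thesis by (simp add: fourier_coeff_def)
    qed
    with supA(3)[of n] T show "(LINT z|circle_measure. A z * z powi (- n)) =
      2 * pi * (exp (- T) ^ nat \<bar>n\<bar> * (2 * pi * fourier_coeff f\<^sub>0 n))"
      by (simp add: of_real_power[symmetric] del: of_real_power)
  qed
  note supB = poisson_superposition[OF cylinder.sigma_finite_measure_axioms intU, of q snd, folded F_def, folded B_def]
  have AE_F: "AE z in circle_measure. integrable cylinder_measure (F z)"
    and intB: "integrable circle_measure B"
    and coeffB0: "(LINT z|circle_measure. B z * z powi (- n)) =
         2 * pi * (LINT p|cylinder_measure. U p * of_real (of_bool (q p < 1) * q p ^ nat \<bar>n\<bar>) * snd p powi (- n))" for n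
    using supB q01 by auto
  \<comment> \<open>At time \<open>T\<close> the Poisson formula gives 0, whereas the semigroup is
    the identity there.\<close>
  have AE_T: "AE p in cylinder_measure. fst p \<noteq> T"
  proof (rule cylinder.AE_pair_measure)
    show "{p \<in> space cylinder_measure. fst p \<noteq> T} \<in> sets cylinder_measure" by measurable
    show "AE x in lborel. AE y in circle_measure. fst (x, y) \<noteq> T"
      using AE_lborel_singleton[of T] by eventually_elim simp
  qed
  have coeffB: "(LINT z|circle_measure. B z * z powi (- n)) = 2 * pi * (exp (- T) ^ nat \<bar>n\<bar> * moment U n)" for n
  proof -
    have "(LINT p|cylinder_measure. U p * of_real (of_bool (q p < 1) * q p ^ nat \<bar>n\<bar>) * snd p powi (- n)) =
      (LINT p|cylinder_measure. of_real (exp (- T) ^ nat \<bar>n\<bar>) * (U p * of_real (exp (of_int \<bar>n\<bar> * fst p)) * snd p powi (- n)))"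
    proof (rule integral_cong_AE)
      show "AE p in cylinder_measure. U p * of_real (of_bool (q p < 1) * q p ^ nat \<bar>n\<bar>) * snd p powi (- n) =
        of_real (exp (- T) ^ nat \<bar>n\<bar>) * (U p * of_real (exp (of_int \<bar>n\<bar> * fst p)) * snd p powi (- n))"
        using AE_T
      proof eventually_elim
        case (elim p)
        show ?case
        proof (cases "fst p \<in> {0..T}")
          case True
          then have q: "q p = exp (- T) * exp (fst p)" by (simp add: q_def exp_add[symmetric])
          have "exp (of_int \<bar>n\<bar> * fst p) = exp (fst p) ^ nat \<bar>n\<bar>"
            by (simp add: exp_of_nat_mult[symmetric])
          then show ?thesis using True elim
            by (simp add: q power_mult_distrib) (simp add: exp_add[symmetric])
        next
          case False
          then have "U p = 0" using controls_zero[OF U, of "fst p" "snd p"] by simp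
          then show ?thesis by simp
        qed
      qed
    qed measurable
    then show ?thesis
      unfolding coeffB0 moment_def by (simp add: split_beta')
  qed
  have AE_U: "AE s in lborel. integrable circle_measure (\<lambda>z. U (s, z))"
    using cylinder.AE_integrable_fst'[OF intU] .
  have solution: "AE z in circle_measure. half_heat_solution \<omega> f\<^sub>0 (curry U) T z = (A z + B z) / (2 * pi)"
    using AE_F AE_space
  proof eventually_elim
    case (elim z)
    then have z: "z \<in> sphere 0 1" by simp
    have "half_heat_semigroup T f\<^sub>0 z = A z / (2 * pi)"
      unfolding A_def by (rule half_heat_semigroup_poisson[OF f T z])
    moreover have "(LINT s:{0..T}|lborel. half_heat_semigroup (T - s) (extend_by_zero \<omega> (curry U s)) z) = B z / (2 * pi)"
    proof -
      have ext: "extend_by_zero \<omega> (curry U s) = (\<lambda>z. U (s, z))" for s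
        using controls_zero[OF U] by (auto simp: extend_by_zero_def fun_eq_iff)
      define G where "G s = indicator {0..T} s *\<^sub>R half_heat_semigroup (T - s) (extend_by_zero \<omega> (curry U s)) z" for s
      have [measurable]: "(\<lambda>(s, \<eta>). F z (s, \<eta>)) \<in> borel_measurable cylinder_measure"
        using elim(1) by simp
      \<comment> \<open>The case distinction exhibits the Duhamel integrand as measurable: the
        finiteness condition is integrability of the slice, in a form that depends measurably on
        \<open>s\<close>.\<close>
      have G_eq: "G s = (if s = T then U (T, z)
          else if (\<integral>\<^sup>+\<eta>. norm (U (s, \<eta>)) \<partial>circle_measure) < \<infinity> then (LINT \<eta>|circle_measure. F z (s, \<eta>)) / (2 * pi) else 0)" for s
      proof (cases "s \<in> {0..T} \<and> s \<noteq> T")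
        case True
        then have pos: "T - s > 0" by auto
        have G: "G s = half_heat_semigroup (T - s) (\<lambda>\<eta>. U (s, \<eta>)) z"
          using True by (simp add: G_def ext)
        have iff: "(\<integral>\<^sup>+\<eta>. norm (U (s, \<eta>)) \<partial>circle_measure) < \<infinity> \<longleftrightarrow> integrable circle_measure (\<lambda>\<eta>. U (s, \<eta>))"
          by (simp add: integrable_iff_bounded)
        show ?thesis
        proof (cases "integrable circle_measure (\<lambda>\<eta>. U (s, \<eta>))")
          case int: True
          show ?thesis unfolding G iff
            using True int by (subst half_heat_semigroup_poisson[OF int pos z]) (auto simp: F_def q_def)
        next
          case False
          then show ?thesis unfolding G iff
            using True half_heat_semigroup_not_integrable[OF False pos] by simp
        qed
      next
        case False
        then show ?thesis
          using T controls_zero[OF U, of s] by (auto simp: G_def F_def half_heat_semigroup_def ext)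
      qed
      have [measurable]: "G \<in> borel_measurable lborel"
        unfolding G_eq by measurable
      have AE_eq: "AE s in lborel. G s = (LINT \<eta>|circle_measure. F z (s, \<eta>)) / (2 * pi)"
        using AE_U AE_lborel_singleton[of T]
        by eventually_elim (simp add: G_eq integrable_iff_bounded)
      have F_int: "integrable lborel (\<lambda>s. LINT \<eta>|circle_measure. F z (s, \<eta>))"
        by (rule cylinder.integrable_fst'[OF elim(1)])
      have "(LINT s:{0..T}|lborel. half_heat_semigroup (T - s) (extend_by_zero \<omega> (curry U s)) z) =
         (LINT s|lborel. (LINT \<eta>|circle_measure. F z (s, \<eta>)) / (2 * pi))"
        unfolding set_lebesgue_integral_def G_def[symmetric]
        by (rule integral_cong_AE) (use AE_eq F_int in auto)
      also have "\<dots> = B z / (2 * pi)"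
        unfolding B_def using cylinder.integral_fst'[OF elim(1)] by simp
      finally show ?thesis .
    qed
    ultimately show ?case by (simp add: half_heat_solution_def add_divide_distrib)
  qed
  have coeff: "(LINT z|circle_measure. (A z + B z) * z powi (- n)) =
      2 * pi * exp (- T) ^ nat \<bar>n\<bar> * (2 * pi * fourier_coeff f\<^sub>0 n + moment U n)" for n
    using integrable_mult_powi_circle[OF intA, of "-n"] integrable_mult_powi_circle[OF intB, of "-n"]
    by (simp add: ring_distribs coeffA coeffB)
  have "(AE z in circle_measure. half_heat_solution \<omega> f\<^sub>0 (curry U) T z = 0) \<longleftrightarrow>
    (AE z in circle_measure. A z + B z = 0)"
  proof
    assume "AE z in circle_measure. half_heat_solution \<omega> f\<^sub>0 (curry U) T z = 0"
    with solution show "AE z in circle_measure. A z + B z = 0"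
      by eventually_elim simp
  next
    assume "AE z in circle_measure. A z + B z = 0"
    with solution show "AE z in circle_measure. half_heat_solution \<omega> f\<^sub>0 (curry U) T z = 0"
      by eventually_elim simp
  qed
  also have "\<dots> \<longleftrightarrow> (\<forall>n. (LINT z|circle_measure. (A z + B z) * z powi (- n)) = 0)"
  proof
    assume "AE z in circle_measure. A z + B z = 0"
    then show "\<forall>n. (LINT z|circle_measure. (A z + B z) * z powi (- n)) = 0"
      by (auto intro!: integral_eq_zero_AE elim: eventually_mono)
  next
    assume *: "\<forall>n. (LINT z|circle_measure. (A z + B z) * z powi (- n)) = 0"
    then show "AE z in circle_measure. A z + B z = 0"
      using *[rule_format, of "- _"] intA intB by (intro AE_zero_if_fourier_coeffs_zero) auto
  qed
  also have "\<dots> \<longleftrightarrow> (\<forall>n. moment U n = - (2 * pi) * fourier_coeff f\<^sub>0 n)"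
    unfolding coeff by (simp add: add_eq_0_iff)
  finally show ?thesis .
qed

section \<open>Boundedness of the Cauchy potential\<close>

text \<open>Splitting \<open>k\<close> as \<open>sqrt k * sqrt k\<close> in Cauchy-Schwarz uses up
  the row bound; Tonelli then leaves the column bound.\<close>

lemma schur_test:
  fixes k :: "'a \<Rightarrow> 'b \<Rightarrow> real" and f :: "'b \<Rightarrow> real"
  assumes "sigma_finite_measure M" "sigma_finite_measure N"
    and [measurable]: "(\<lambda>(x, y). k x y) \<in> borel_measurable (M \<Otimes>\<^sub>M N)" "f \<in> borel_measurable N"
    and k0: "\<And>x y. k x y \<ge> 0" and f0: "\<And>y. f y \<ge> 0"
    and rows: "\<And>x. x \<in> space M \<Longrightarrow> (\<integral>\<^sup>+y. k x y \<partial>N) \<le> C"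
    and cols: "\<And>y. y \<in> space N \<Longrightarrow> (\<integral>\<^sup>+x. k x y \<partial>M) \<le> D"
  shows "(\<integral>\<^sup>+x. (\<integral>\<^sup>+y. ennreal (k x y * f y) \<partial>N)\<^sup>2 \<partial>M) \<le> C * D * (\<integral>\<^sup>+y. ennreal ((f y)\<^sup>2) \<partial>N)"
proof -
  interpret M: sigma_finite_measure M by fact
  interpret N: sigma_finite_measure N by fact
  interpret P: pair_sigma_finite M N ..
  have "(\<integral>\<^sup>+x. (\<integral>\<^sup>+y. ennreal (k x y * f y) \<partial>N)\<^sup>2 \<partial>M) \<le>
        (\<integral>\<^sup>+x. C * (\<integral>\<^sup>+y. ennreal (k x y * (f y)\<^sup>2) \<partial>N) \<partial>M)"
  proof (rule nn_integral_mono)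
    fix x assume x: "x \<in> space M"
    have [measurable]: "(\<lambda>y. k x y) \<in> borel_measurable N"
      using measurable_compose[OF measurable_Pair1'[OF x] assms(3)] by simp
    have "(\<integral>\<^sup>+y. ennreal (k x y * f y) \<partial>N)\<^sup>2 = (\<integral>\<^sup>+y. ennreal (sqrt (k x y)) * ennreal (sqrt (k x y) * f y) \<partial>N)\<^sup>2"
      by (intro arg_cong[where f = "\<lambda>t. t\<^sup>2"] nn_integral_cong)
         (simp add: k0 f0 ennreal_mult[symmetric] mult.assoc[symmetric])
    also have "\<dots> \<le> (\<integral>\<^sup>+y. ennreal (sqrt (k x y)) ^ 2 \<partial>N) * (\<integral>\<^sup>+y. ennreal (sqrt (k x y) * f y) ^ 2 \<partial>N)"
      by (rule Cauchy_Schwarz_nn_integral) measurable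
    also have "(\<integral>\<^sup>+y. ennreal (sqrt (k x y)) ^ 2 \<partial>N) = (\<integral>\<^sup>+y. k x y \<partial>N)"
      by (intro nn_integral_cong) (simp add: k0 ennreal_power)
    also have "(\<integral>\<^sup>+y. ennreal (sqrt (k x y) * f y) ^ 2 \<partial>N) = (\<integral>\<^sup>+y. ennreal (k x y * (f y)\<^sup>2) \<partial>N)"
      by (intro nn_integral_cong) (simp add: k0 f0 ennreal_power power_mult_distrib)
    also have "(\<integral>\<^sup>+y. k x y \<partial>N) * (\<integral>\<^sup>+y. ennreal (k x y * (f y)\<^sup>2) \<partial>N) \<le> C * (\<integral>\<^sup>+y. ennreal (k x y * (f y)\<^sup>2) \<partial>N)"
      using rows[OF x] by (rule mult_right_mono) simp
    finally show "(\<integral>\<^sup>+y. ennreal (k x y * f y) \<partial>N)\<^sup>2 \<le> C * (\<integral>\<^sup>+y. ennreal (k x y * (f y)\<^sup>2) \<partial>N)" .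
  qed
  also have "\<dots> = C * (\<integral>\<^sup>+x. (\<integral>\<^sup>+y. ennreal (k x y * (f y)\<^sup>2) \<partial>N) \<partial>M)"
    by (rule nn_integral_cmult) measurable
  also have "(\<integral>\<^sup>+x. (\<integral>\<^sup>+y. ennreal (k x y * (f y)\<^sup>2) \<partial>N) \<partial>M) = (\<integral>\<^sup>+y. (\<integral>\<^sup>+x. ennreal (k x y * (f y)\<^sup>2) \<partial>M) \<partial>N)"
    by (rule P.Fubini'[symmetric]) measurable
  also have "\<dots> \<le> (\<integral>\<^sup>+y. D * ennreal ((f y)\<^sup>2) \<partial>N)"
  proof (rule nn_integral_mono)
    fix y assume y: "y \<in> space N"
    have [measurable]: "(\<lambda>x. k x y) \<in> borel_measurable M"
      using measurable_compose[OF measurable_Pair2'[OF y] assms(3)] by simp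
    have "(\<integral>\<^sup>+x. ennreal (k x y * (f y)\<^sup>2) \<partial>M) = (\<integral>\<^sup>+x. k x y \<partial>M) * ennreal ((f y)\<^sup>2)"
      by (subst nn_integral_multc[symmetric]) (auto simp: k0 ennreal_mult intro!: nn_integral_cong)
    also have "\<dots> \<le> D * ennreal ((f y)\<^sup>2)"
      using cols[OF y] by (rule mult_right_mono) simp
    finally show "(\<integral>\<^sup>+x. ennreal (k x y * (f y)\<^sup>2) \<partial>M) \<le> D * ennreal ((f y)\<^sup>2)" .
  qed
  also have "\<dots> = D * (\<integral>\<^sup>+y. ennreal ((f y)\<^sup>2) \<partial>N)"
    by (rule nn_integral_cmult) measurable
  finally show ?thesis by (simp add: mult.assoc mult_left_mono)
qed

section \<open>An integrable majorant for the Cauchy kernel\<close>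

definition inv_sqrt_window :: "real \<Rightarrow> real \<Rightarrow> real" where
  "inv_sqrt_window M x = indicator {-M..M} x / sqrt \<bar>x\<bar>"

lemma measurable_inv_sqrt_window [measurable]: "inv_sqrt_window M \<in> borel_measurable borel"
  unfolding inv_sqrt_window_def by measurable

lemma inv_sqrt_window_nonneg: "inv_sqrt_window M x \<ge> 0"
  by (simp add: inv_sqrt_window_def)

lemma nn_integral_inv_sqrt_window:
  assumes "M \<ge> 0"
  shows "(\<integral>\<^sup>+x. inv_sqrt_window M (x - c) \<partial>lborel) \<le> ennreal (4 * sqrt M)"
proof -
  let ?w = "\<lambda>x. ennreal (inv_sqrt_window M x)"
  let ?h = "\<lambda>x::real. indicator {0..M} x * x powr (-1/2)"
  have "((\<lambda>x. x powr (-1/2)) has_integral (M powr (-1/2 + 1) / (-1/2 + 1))) {0..M}"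
    using assms by (intro has_integral_powr_from_0) auto
  then have "((\<lambda>x. x powr (-1/2)) has_integral (2 * sqrt M)) {0..M}"
    using assms by (simp add: powr_half_sqrt mult.commute)
  then have "(?h has_integral (2 * sqrt M)) UNIV"
    by (subst (asm) has_integral_restrict_UNIV[symmetric]) (simp add: indicator_def of_bool_def if_distrib[where f = "\<lambda>x. x * _"] cong: if_cong)
  then have h: "(\<integral>\<^sup>+x. ?h x \<partial>lborel) = ennreal (2 * sqrt M)"
    by (intro nn_integral_has_integral_lborel) auto
  have h': "(\<integral>\<^sup>+x. ?h (- x) \<partial>lborel) = ennreal (2 * sqrt M)"
    using nn_integral_real_affine[of "\<lambda>x. ennreal (?h x)" "-1" 0] h by simp
  have "(\<integral>\<^sup>+x. ?w (x - c) \<partial>lborel) = (\<integral>\<^sup>+x. ?w x \<partial>lborel)"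
    using nn_integral_real_affine[of ?w 1 "-c"] by simp
  also have "\<dots> \<le> (\<integral>\<^sup>+x. ennreal (?h x) + ennreal (?h (- x)) \<partial>lborel)"
  proof (rule nn_integral_mono)
    fix x
    have "inv_sqrt_window M x \<le> ?h x + ?h (- x)"
      by (cases "x \<ge> 0") (auto simp: inv_sqrt_window_def indicator_def powr_minus powr_half_sqrt field_simps)
    then show "?w x \<le> ennreal (?h x) + ennreal (?h (- x))"
      by (subst ennreal_plus[symmetric]) (auto intro!: ennreal_leI simp del: ennreal_plus)
  qed
  also have "\<dots> = ennreal (2 * sqrt M) + ennreal (2 * sqrt M)"
    by (subst nn_integral_add, measurable, simp only: h h')
  also have "\<dots> = ennreal (4 * sqrt M)"
    using assms by (simp flip: ennreal_plus)
  finally show ?thesis .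
qed

text \<open>Up to \<open>pi / 3\<close> the derivative \<open>cos x - 1/2\<close> of the difference
  is nonnegative; beyond, \<open>sin x\<close> exceeds 0.85 while \<open>x / 2\<close> stays below
  it.\<close>

lemma sin_ge_half:
  fixes x :: real
  assumes "0 \<le> x" "x \<le> pi / 2"
  shows "x / 2 \<le> sin x"
proof (cases "x \<le> pi / 3")
  case True
  have "sin 0 - 0 / 2 \<le> sin x - x / 2"
  proof (rule DERIV_nonneg_imp_nondecreasing[OF assms(1)])
    fix t assume t: "0 \<le> t" "t \<le> x"
    have "cos (pi / 3) \<le> cos t"
      using t True by (intro cos_monotone_0_pi_le) auto
    then have "cos t - 1 / 2 \<ge> 0" by (simp add: cos_60)
    moreover have "((\<lambda>x. sin x - x / 2) has_real_derivative cos t - 1 / 2) (at t)"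
      by (auto intro!: derivative_eq_intros)
    ultimately show "\<exists>y. ((\<lambda>x. sin x - x / 2) has_real_derivative y) (at t) \<and> 0 \<le> y" by blast
  qed
  then show ?thesis by simp
next
  case False
  have "sin (pi / 3) \<le> sin x"
    using False assms by (intro sin_monotone_2pi_le) auto
  moreover have "sqrt 3 \<ge> 1.7" by (rule real_le_rsqrt) (simp add: power2_eq_square)
  moreover have "x / 2 \<le> 0.85" using assms pi_less_4 pi_approx by (simp add: field_simps)
  ultimately show ?thesis by (simp add: sin_60)
qed

lemma norm_cis_diff_ge:
  assumes "\<bar>d\<bar> \<le> pi"
  shows "\<bar>d\<bar> / 2 \<le> norm (cis d - 1)"
proof -
  have "norm (cis d - 1) = 2 * \<bar>sin (d / 2)\<bar>"
  proof -
    have "(norm (cis d - 1))\<^sup>2 = (2 * sin (d / 2))\<^sup>2"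
      using cos_double_sin[of "d / 2"] sin_cos_squared_add[of d]
      by (simp add: cmod_power2 power2_diff power_mult_distrib algebra_simps)
    then have "\<bar>norm (cis d - 1)\<bar> = \<bar>2 * sin (d / 2)\<bar>" by (metis real_sqrt_abs)
    then show ?thesis by (simp add: abs_mult)
  qed
  moreover have "\<bar>d\<bar> / 2 / 2 \<le> sin (\<bar>d\<bar> / 2)"
    using assms by (intro sin_ge_half) auto
  moreover have "sin (\<bar>d\<bar> / 2) \<le> \<bar>sin (d / 2)\<bar>"
    by (cases "d \<ge> 0") (auto simp: abs_if)
  ultimately show ?thesis by linarith
qed

text \<open>The difference of two angles in \<open>[0, 2 pi)\<close> may be a full turn away from
  the representative of least modulus, so three shifted windows are needed. Each contributes
  \<open>4 sqrt pi\<close>, and \<open>sqrt 2\<close> comes from a chord being at least half its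
  arc.\<close>

lemma nn_integral_inv_sqrt_dist_circle:
  assumes "\<eta> \<in> sphere 0 1"
  shows "(\<integral>\<^sup>+z. 1 / sqrt (norm (z - \<eta>)) \<partial>circle_measure) \<le> ennreal (12 * sqrt 2 * sqrt pi)"
proof -
  let ?y = "Arg2pi \<eta>"
  have y: "0 \<le> ?y" "?y < 2 * pi" and \<eta>: "\<eta> = cis ?y"
    using Arg2pi[of \<eta>] assms by (auto simp: cis_conv_exp is_Arg_def)
  let ?w = "\<lambda>k x. sqrt 2 * inv_sqrt_window pi (x - (?y + 2 * pi * k))"
  have bound: "1 / sqrt (norm (cis x - \<eta>)) \<le> ?w (-1) x + ?w 0 x + ?w 1 x" if x: "0 \<le> x" "x < 2 * pi" for x
  proof -
    define d where "d = x - ?y"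
    have "\<bar>d\<bar> < 2 * pi" using x y by (auto simp: d_def)
    then obtain k :: real where k: "k = -1 \<or> k = 0 \<or> k = 1" "\<bar>d - 2 * pi * k\<bar> \<le> pi"
    proof -
      consider "d \<le> - pi" | "\<bar>d\<bar> \<le> pi" | "d \<ge> pi" by linarith
      then show ?thesis
      proof cases
        case 1 then show ?thesis using that[of "-1"] \<open>\<bar>d\<bar> < 2 * pi\<close> by auto
      next
        case 2 then show ?thesis using that[of 0] by auto
      next
        case 3 then show ?thesis using that[of 1] \<open>\<bar>d\<bar> < 2 * pi\<close> by auto
      qed
    qed
    define e where "e = d - 2 * pi * k"
    have "cis (2 * pi * k) = 1" using k(1) by (auto simp: cis_cnj[symmetric])
    then have "cis x = \<eta> * cis e"
    proof -
      have "cis x = cis (x - 2 * pi * k) * cis (2 * pi * k)" by (simp add: cis_mult)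
      also have "\<dots> = cis (?y + e)"
        using \<open>cis (2 * pi * k) = 1\<close> by (simp add: e_def d_def)
      also have "\<dots> = \<eta> * cis e"
        using cis_mult[of ?y e] \<eta> by simp
      finally show ?thesis .
    qed
    then have "norm (cis x - \<eta>) = norm (cis e - 1)"
      using assms by (metis mult.right_neutral mult_1 norm_mult right_diff_distrib mem_sphere_0)
    then have "norm (cis x - \<eta>) \<ge> \<bar>e\<bar> / 2"
      using norm_cis_diff_ge[of e] k(2) by (simp add: e_def)
    then have "1 / sqrt (norm (cis x - \<eta>)) \<le> sqrt 2 / sqrt \<bar>e\<bar>"
    proof (cases "e = 0")
      case True
      then show ?thesis using \<open>norm (cis x - \<eta>) = norm (cis e - 1)\<close> by simp
    next
      case False
      assume "norm (cis x - \<eta>) \<ge> \<bar>e\<bar> / 2"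
      then have "1 / sqrt (norm (cis x - \<eta>)) \<le> 1 / sqrt (\<bar>e\<bar> / 2)"
        using False by (intro frac_le) auto
      then show ?thesis by (simp add: real_sqrt_divide)
    qed
    also have "\<dots> = ?w k x"
      using k(2) by (simp add: inv_sqrt_window_def e_def d_def indicator_def algebra_simps abs_le_iff)
    also have "\<dots> \<le> ?w (-1) x + ?w 0 x + ?w 1 x"
      using k(1) by (auto simp: inv_sqrt_window_nonneg)
    finally show ?thesis .
  qed
  have w: "(\<integral>\<^sup>+x. ?w k x \<partial>lborel) \<le> ennreal (4 * sqrt 2 * sqrt pi)" for k
  proof -
    have "(\<integral>\<^sup>+x. ?w k x \<partial>lborel) = ennreal (sqrt 2) * (\<integral>\<^sup>+x. inv_sqrt_window pi (x - (?y + 2 * pi * k)) \<partial>lborel)"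
      by (subst nn_integral_cmult[symmetric]) (auto simp: ennreal_mult inv_sqrt_window_nonneg)
    also have "\<dots> \<le> ennreal (sqrt 2) * ennreal (4 * sqrt pi)"
      by (intro mult_left_mono nn_integral_inv_sqrt_window) auto
    finally show ?thesis by (simp add: ennreal_mult[symmetric] mult_ac)
  qed
  have "(\<integral>\<^sup>+z. 1 / sqrt (norm (z - \<eta>)) \<partial>circle_measure) =
      (\<integral>\<^sup>+x. ennreal (1 / sqrt (norm (cis x - \<eta>))) * indicator {0..<2*pi} x \<partial>lborel)"
    by (rule nn_integral_circle_measure) measurable
  also have "\<dots> \<le> (\<integral>\<^sup>+x. ennreal (?w (-1) x) + ennreal (?w 0 x) + ennreal (?w 1 x) \<partial>lborel)"
  proof (rule nn_integral_mono)
    fix x :: real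
    show "ennreal (1 / sqrt (norm (cis x - \<eta>))) * indicator {0..<2*pi} x \<le> ennreal (?w (-1) x) + ennreal (?w 0 x) + ennreal (?w 1 x)"
    proof (cases "x \<in> {0..<2*pi}")
      case True
      then have "ennreal (1 / sqrt (norm (cis x - \<eta>))) \<le> ennreal (?w (-1) x + ?w 0 x + ?w 1 x)"
        by (intro ennreal_leI bound) auto
      then show ?thesis using True by (simp add: inv_sqrt_window_nonneg)
    qed simp
  qed
  also have "\<dots> = (\<integral>\<^sup>+x. ?w (-1) x \<partial>lborel) + (\<integral>\<^sup>+x. ?w 0 x \<partial>lborel) + (\<integral>\<^sup>+x. ?w 1 x \<partial>lborel)"
    by (subst nn_integral_add nn_integral_add; measurable)+
  also have "\<dots> \<le> ennreal (4 * sqrt 2 * sqrt pi) + ennreal (4 * sqrt 2 * sqrt pi) + ennreal (4 * sqrt 2 * sqrt pi)"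
    by (intro add_mono w)
  also have "\<dots> = ennreal (12 * sqrt 2 * sqrt pi)"
    by (simp flip: ennreal_plus)
  finally show ?thesis .
qed

lemma AE_circle_neq: "AE z in circle_measure. z \<noteq> \<zeta>"
proof -
  have "(\<integral>\<^sup>+z. indicator {z. z = \<zeta>} z \<partial>circle_measure) = (\<integral>\<^sup>+x. indicator {z. z = \<zeta>} (cis x) * indicator {0..<2*pi} x \<partial>lborel)"
    by (rule nn_integral_circle_measure) measurable
  also have "\<dots> \<le> (\<integral>\<^sup>+x. indicator {Arg2pi \<zeta>} x \<partial>lborel)"
  proof (rule nn_integral_mono)
    fix x :: real
    have "Arg2pi \<zeta> = x" if "cis x = \<zeta>" "0 \<le> x" "x < 2 * pi"
      using that by (intro Arg2pi_unique[of 1]) (auto simp: cis_conv_exp)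
    then show "indicator {z. z = \<zeta>} (cis x) * indicator {0..<2*pi} x \<le> (indicator {Arg2pi \<zeta>} x :: ennreal)"
      by (auto simp: indicator_def)
  qed
  finally have "(\<integral>\<^sup>+z. indicator {z. \<not> z \<noteq> \<zeta>} z \<partial>circle_measure) = 0" by simp
  moreover have "{z \<in> space circle_measure. z \<noteq> \<zeta>} \<in> sets circle_measure" by measurable
  ultimately show ?thesis by (subst AE_iff_nn_integral)
qed

text \<open>The kernel is of order 1/distance. Bounding a sum of two squares below by a product
  replaces the squared distance by \<open>|t|\<close> times the chord, so the majorant is a product
  of two integrable functions of one variable. The constant arises from
  \<open>|e^t - 1| \<ge> |t| e^-L\<close> and \<open>e^(t/2) \<ge> e^(-L/2)\<close>, whose combined
  \<open>e^(-3L/2)\<close> stands under a square root.\<close>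

lemma norm_cauchy_kernel_le:
  fixes z \<eta> :: complex
  assumes "z \<in> sphere 0 1" "\<eta> \<in> sphere 0 1" "\<bar>t\<bar> \<le> L" "t \<noteq> 0" "z \<noteq> \<eta>"
  shows "norm (cauchy_kernel (exp t) \<eta> z) \<le> exp (3 * L / 4) / (sqrt \<bar>t\<bar> * sqrt (norm (z - \<eta>)))"
proof -
  define D where "D = norm (exp t * \<eta> - z)"
  define d where "d = norm (z - \<eta>)"
  have d: "d > 0" using assms by (simp add: d_def)
  have z: "(Re z)\<^sup>2 + (Im z)\<^sup>2 = 1" and \<eta>: "(Re \<eta>)\<^sup>2 + (Im \<eta>)\<^sup>2 = 1"
    using assms by (simp_all add: cmod_power2[symmetric])
  \<comment> \<open>The law of cosines separates the radial from the angular part.\<close>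
  have D2: "D\<^sup>2 = (exp t - 1)\<^sup>2 + exp t * d\<^sup>2"
  proof -
    define x where "x = exp t"
    have "D\<^sup>2 = (x * Re \<eta> - Re z)\<^sup>2 + (x * Im \<eta> - Im z)\<^sup>2"
      by (simp add: D_def x_def cmod_power2)
    also have "\<dots> = (x - 1)\<^sup>2 + x * ((Re z - Re \<eta>)\<^sup>2 + (Im z - Im \<eta>)\<^sup>2)"
      using z \<eta> by algebra
    finally show ?thesis by (simp add: d_def cmod_power2 x_def)
  qed
  have exp_diff: "\<bar>t\<bar> * exp (- L) \<le> \<bar>exp t - 1\<bar>"
  proof (cases "t \<ge> 0")
    case True
    then have "\<bar>t\<bar> * exp (- L) \<le> \<bar>t\<bar> * 1" using assms by (intro mult_left_mono) auto
    also have "\<dots> \<le> exp t - 1" using exp_ge_add_one_self[of t] True by linarith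
    finally show ?thesis by linarith
  next
    case False
    have "\<bar>t\<bar> * exp (- L) \<le> \<bar>t\<bar> * exp t" using assms by (intro mult_left_mono) auto
    also have "\<dots> \<le> 1 - exp t"
    proof -
      have "(1 - t) * exp t \<le> exp (- t) * exp t"
        using exp_ge_add_one_self[of "-t"] by (intro mult_right_mono) auto
      then show ?thesis using False by (simp add: exp_add[symmetric] algebra_simps)
    qed
    finally show ?thesis by linarith
  qed
  have "(sqrt \<bar>t\<bar> * sqrt d / exp (3 * L / 4))\<^sup>2 = \<bar>t\<bar> * exp (- L) * exp (- L / 2) * d"
    using d by (simp add: power_mult_distrib power_divide exp_minus exp_add[symmetric] field_simps power2_eq_square)
  also have "\<dots> \<le> \<bar>exp t - 1\<bar> * exp (t / 2) * d"
    using assms d exp_diff by (intro mult_right_mono mult_mono) auto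
  also have "\<dots> \<le> (\<bar>exp t - 1\<bar>)\<^sup>2 + (exp (t / 2) * d)\<^sup>2"
  proof -
    have "x * y \<le> x\<^sup>2 + y\<^sup>2" for x y :: real
      using sum_squares_bound[of x y] zero_le_power2[of x] zero_le_power2[of y] by linarith
    then show ?thesis by (simp only: mult.assoc)
  qed
  also have "\<dots> = D\<^sup>2"
  proof -
    have "(exp (t / 2))\<^sup>2 = exp t" by (simp add: power2_eq_square exp_add[symmetric])
    then show ?thesis by (simp only: D2 power_mult_distrib power2_abs)
  qed
  finally have "sqrt \<bar>t\<bar> * sqrt d / exp (3 * L / 4) \<le> D"
    by (rule power2_le_imp_le) (simp add: D_def)
  then have "1 / D \<le> 1 / (sqrt \<bar>t\<bar> * sqrt d / exp (3 * L / 4))"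
    using assms d by (intro frac_le) auto
  moreover have "norm (cauchy_kernel (exp t) \<eta> z) = 1 / D"
    using assms by (simp add: cauchy_kernel_def D_def norm_divide)
  ultimately show ?thesis by (simp add: d_def)
qed

definition kernel_bound :: "real \<Rightarrow> real" where
  "kernel_bound L = exp (3 * L / 4) * (4 * sqrt L) * (12 * sqrt 2 * sqrt pi)"

lemma nn_integral_kernel_majorant:
  assumes L: "L \<ge> 0" and \<zeta>: "\<zeta> \<in> sphere 0 1"
    and le: "\<And>s z. s \<noteq> c \<Longrightarrow> z \<noteq> \<zeta> \<Longrightarrow> z \<in> sphere 0 1 \<Longrightarrow>
      k (s, z) \<le> ennreal (exp (3 * L / 4) * inv_sqrt_window L (s - c) / sqrt (norm (z - \<zeta>)))"
  shows "(\<integral>\<^sup>+p. k p \<partial>cylinder_measure) \<le> kernel_bound L"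
proof -
  \<comment> \<open>At \<open>s = c\<close> or \<open>z = \<zeta>\<close> the majorant is 0 by the
    convention for division by zero, so both sets are discarded as null sets.\<close>
  have "AE p in cylinder_measure. fst p \<noteq> c \<and> snd p \<noteq> \<zeta>"
  proof (rule cylinder.AE_pair_measure)
    show "{p \<in> space cylinder_measure. fst p \<noteq> c \<and> snd p \<noteq> \<zeta>} \<in> sets cylinder_measure" by measurable
    show "AE x in lborel. AE y in circle_measure. fst (x, y) \<noteq> c \<and> snd (x, y) \<noteq> \<zeta>"
      using AE_lborel_singleton[of c]
    proof eventually_elim
      case (elim x)
      show ?case using AE_circle_neq[of \<zeta>] by eventually_elim (simp add: elim)
    qed
  qed
  then have "(\<integral>\<^sup>+p. k p \<partial>cylinder_measure) \<le>
     (\<integral>\<^sup>+p. ennreal (exp (3 * L / 4) * inv_sqrt_window L (fst p - c) / sqrt (norm (snd p - \<zeta>))) \<partial>cylinder_measure)"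
    using AE_space
    by (intro nn_integral_mono_AE, eventually_elim)
       (use le in \<open>auto simp: space_pair_measure\<close>)
  also have "\<dots> = (\<integral>\<^sup>+s. (\<integral>\<^sup>+z. ennreal (exp (3 * L / 4) * inv_sqrt_window L (s - c) / sqrt (norm (z - \<zeta>))) \<partial>circle_measure) \<partial>lborel)"
    using \<zeta> by (subst circle.nn_integral_fst[symmetric]) simp_all
  also have "\<dots> = (\<integral>\<^sup>+s. ennreal (exp (3 * L / 4)) * ennreal (inv_sqrt_window L (s - c)) * (\<integral>\<^sup>+z. 1 / sqrt (norm (z - \<zeta>)) \<partial>circle_measure) \<partial>lborel)"
  proof (intro nn_integral_cong)
    fix s :: real
    have "(\<integral>\<^sup>+z. ennreal (exp (3 * L / 4) * inv_sqrt_window L (s - c) / sqrt (norm (z - \<zeta>))) \<partial>circle_measure) =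
      (\<integral>\<^sup>+z. ennreal (exp (3 * L / 4)) * ennreal (inv_sqrt_window L (s - c)) * ennreal (1 / sqrt (norm (z - \<zeta>))) \<partial>circle_measure)"
      by (intro nn_integral_cong) (simp add: ennreal_mult[symmetric] inv_sqrt_window_nonneg)
    also have "\<dots> = ennreal (exp (3 * L / 4)) * ennreal (inv_sqrt_window L (s - c)) * (\<integral>\<^sup>+z. 1 / sqrt (norm (z - \<zeta>)) \<partial>circle_measure)"
      by (rule nn_integral_cmult) measurable
    finally show "(\<integral>\<^sup>+z. ennreal (exp (3 * L / 4) * inv_sqrt_window L (s - c) / sqrt (norm (z - \<zeta>))) \<partial>circle_measure) =
      ennreal (exp (3 * L / 4)) * ennreal (inv_sqrt_window L (s - c)) * (\<integral>\<^sup>+z. 1 / sqrt (norm (z - \<zeta>)) \<partial>circle_measure)" .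
  qed
  also have "\<dots> = ennreal (exp (3 * L / 4)) * (\<integral>\<^sup>+s. inv_sqrt_window L (s - c) \<partial>lborel) * (\<integral>\<^sup>+z. 1 / sqrt (norm (z - \<zeta>)) \<partial>circle_measure)"
    by (simp add: nn_integral_multc nn_integral_cmult)
  also have "\<dots> \<le> ennreal (exp (3 * L / 4)) * ennreal (4 * sqrt L) * ennreal (12 * sqrt 2 * sqrt pi)"
    using L \<zeta> by (intro mult_mono nn_integral_inv_sqrt_window nn_integral_inv_sqrt_dist_circle) auto
  also have "\<dots> = ennreal (kernel_bound L)"
    using L by (simp add: kernel_bound_def ennreal_mult[symmetric])
  finally show ?thesis .
qed

text \<open>The kernel has modulus close to 1 where \<open>s\<close> is far below \<sigma>, so its
  integrals over the whole cylinder diverge; Schur's test needs both times confined.\<close>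

definition windowed_kernel :: "real \<Rightarrow> real \<times> complex \<Rightarrow> real \<times> complex \<Rightarrow> real" where
  "windowed_kernel L p q = indicator {0..L} (fst p) * indicator {0..L} (fst q) *
     norm (cauchy_kernel (exp (fst p - fst q)) (snd q) (snd p))"

lemma windowed_kernel_nonneg: "windowed_kernel L p q \<ge> 0"
  by (simp add: windowed_kernel_def)

lemma measurable_cauchy_kernel [measurable (raw)]:
  assumes [measurable]: "r \<in> borel_measurable M" "\<eta> \<in> borel_measurable M" "z \<in> borel_measurable M"
  shows "(\<lambda>x. cauchy_kernel (r x) (\<eta> x) (z x)) \<in> borel_measurable M"
  unfolding cauchy_kernel_def by measurable

lemma nn_integral_windowed_kernel:
  assumes L: "L \<ge> 0"
  shows "p \<in> space cylinder_measure \<Longrightarrow> (\<integral>\<^sup>+q. windowed_kernel L p q \<partial>cylinder_measure) \<le> kernel_bound L"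
    and "q \<in> space cylinder_measure \<Longrightarrow> (\<integral>\<^sup>+p. windowed_kernel L p q \<partial>cylinder_measure) \<le> kernel_bound L"
proof -
  have le: "windowed_kernel L (s, z) (\<sigma>, \<eta>) \<le> exp (3 * L / 4) * inv_sqrt_window L (\<sigma> - s) / sqrt (norm (\<eta> - z))"
    and le': "windowed_kernel L (s, z) (\<sigma>, \<eta>) \<le> exp (3 * L / 4) * inv_sqrt_window L (s - \<sigma>) / sqrt (norm (z - \<eta>))"
    if "s \<noteq> \<sigma>" "z \<noteq> \<eta>" "z \<in> sphere 0 1" "\<eta> \<in> sphere 0 1" for s \<sigma> z \<eta>
  proof -
    show "windowed_kernel L (s, z) (\<sigma>, \<eta>) \<le> exp (3 * L / 4) * inv_sqrt_window L (\<sigma> - s) / sqrt (norm (\<eta> - z))"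
    proof (cases "s \<in> {0..L} \<and> \<sigma> \<in> {0..L}")
      case True
      then have "\<bar>s - \<sigma>\<bar> \<le> L" by auto
      with norm_cauchy_kernel_le[OF that(3,4) this] that show ?thesis
        using True by (simp add: windowed_kernel_def inv_sqrt_window_def indicator_def abs_minus_commute norm_minus_commute abs_le_iff)
    qed (auto simp: windowed_kernel_def inv_sqrt_window_nonneg)
    then show "windowed_kernel L (s, z) (\<sigma>, \<eta>) \<le> exp (3 * L / 4) * inv_sqrt_window L (s - \<sigma>) / sqrt (norm (z - \<eta>))"
    proof -
      have "inv_sqrt_window L (\<sigma> - s) = inv_sqrt_window L (s - \<sigma>)"
        by (auto simp: inv_sqrt_window_def indicator_def abs_minus_commute)
      with that show ?thesis
        using \<open>windowed_kernel L (s, z) (\<sigma>, \<eta>) \<le> exp (3 * L / 4) * inv_sqrt_window L (\<sigma> - s) / sqrt (norm (\<eta> - z))\<close>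
        by (simp only: norm_minus_commute[of z \<eta>])
    qed
  qed
  show "p \<in> space cylinder_measure \<Longrightarrow> (\<integral>\<^sup>+q. windowed_kernel L p q \<partial>cylinder_measure) \<le> kernel_bound L"
    using le[of "fst p" _ "snd p"]
    by (intro nn_integral_kernel_majorant[OF L, of "snd p" "fst p"]) (auto simp: space_pair_measure intro!: ennreal_leI)
  show "q \<in> space cylinder_measure \<Longrightarrow> (\<integral>\<^sup>+p. windowed_kernel L p q \<partial>cylinder_measure) \<le> kernel_bound L"
    using le'[of _ "fst q" _ "snd q"]
    by (intro nn_integral_kernel_majorant[OF L, of "snd q" "fst q"]) (auto simp: space_pair_measure intro!: ennreal_leI)
qed

text \<open>A particular solution of \<open>(d/ds + D) v = U\<close>, read on Fourier coefficients;
  for \<open>s > L\<close> it is in general not 0.\<close>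

definition cauchy_potential :: "(real \<times> complex \<Rightarrow> complex) \<Rightarrow> real \<times> complex \<Rightarrow> complex" where
  "cauchy_potential U p =
     (LINT q|cylinder_measure. U q * cauchy_kernel (exp (fst p - fst q)) (snd q) (snd p)) / (2 * pi)"

lemma measurable_cauchy_potential [measurable]:
  assumes [measurable]: "U \<in> borel_measurable cylinder_measure"
  shows "cauchy_potential U \<in> borel_measurable cylinder_measure"
  unfolding cauchy_potential_def by measurable

lemma measurable_windowed_kernel [measurable]:
  "(\<lambda>(p, q). windowed_kernel L p q) \<in> borel_measurable (cylinder_measure \<Otimes>\<^sub>M cylinder_measure)"
  unfolding windowed_kernel_def by measurable

lemma cauchy_potential_square_integrable:
  assumes L: "L \<ge> 0" and U: "U \<in> controls L \<omega>"
  shows "integrable cylinder_measure (\<lambda>p. (norm (indicator {0..L} (fst p) * cauchy_potential U p))\<^sup>2)"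
proof -
  note U' [measurable] = controls_L2D(1)[OF U]
  have "(\<integral>\<^sup>+p. ennreal ((norm (indicator {0..L} (fst p) * cauchy_potential U p))\<^sup>2) \<partial>cylinder_measure) \<le>
      (\<integral>\<^sup>+p. (\<integral>\<^sup>+q. ennreal (windowed_kernel L p q * norm (U q)) \<partial>cylinder_measure)\<^sup>2 \<partial>cylinder_measure)"
  proof (rule nn_integral_mono)
    fix p
    let ?g = "\<lambda>q. U q * cauchy_kernel (exp (fst p - fst q)) (snd q) (snd p)"
    have "ennreal (norm (indicator {0..L} (fst p) * cauchy_potential U p)) \<le>
        (\<integral>\<^sup>+q. ennreal (windowed_kernel L p q * norm (U q)) \<partial>cylinder_measure)"
    proof (cases "fst p \<in> {0..L} \<and> integrable cylinder_measure ?g")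
      case True
      have "norm (cauchy_potential U p) \<le> norm (LINT q|cylinder_measure. ?g q)"
      proof -
        have "norm (cauchy_potential U p) = norm (LINT q|cylinder_measure. ?g q) / (2 * pi)"
          by (simp add: cauchy_potential_def norm_divide)
        also have "\<dots> \<le> norm (LINT q|cylinder_measure. ?g q) / 1"
          using pi_gt3 by (intro divide_left_mono) auto
        finally show ?thesis by simp
      qed
      then have "ennreal (norm (indicator {0..L} (fst p) * cauchy_potential U p)) \<le> ennreal (norm (LINT q|cylinder_measure. ?g q))"
        using True by (intro ennreal_leI) (simp add: norm_mult)
      also have "\<dots> \<le> (\<integral>\<^sup>+q. norm (?g q) \<partial>cylinder_measure)"
        using True by (intro integral_norm_bound_ennreal) simp
      also have "\<dots> = (\<integral>\<^sup>+q. ennreal (windowed_kernel L p q * norm (U q)) \<partial>cylinder_measure)"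
      proof (rule nn_integral_cong)
        fix q :: "real \<times> complex"
        show "ennreal (norm (?g q)) = ennreal (windowed_kernel L p q * norm (U q))"
        proof (cases "fst q \<in> {0..L}")
          case False
          then have "U q = 0" using controls_zero[OF U, of "fst q" "snd q"] by simp
          then show ?thesis by simp
        qed (use True in \<open>simp add: windowed_kernel_def norm_mult mult.commute\<close>)
      qed
      finally show ?thesis .
    next
      \<comment> \<open>A divergent integral is 0 by convention, so the bound holds without knowing
        where the potential converges.\<close>
      case False
      then have "indicator {0..L} (fst p) * cauchy_potential U p = 0"
        by (auto simp: cauchy_potential_def not_integrable_integral_eq indicator_def)
      then show ?thesis by (simp only: norm_zero ennreal_0 zero_le)
    qed
    then show "ennreal ((norm (indicator {0..L} (fst p) * cauchy_potential U p))\<^sup>2) \<le>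
        (\<integral>\<^sup>+q. ennreal (windowed_kernel L p q * norm (U q)) \<partial>cylinder_measure)\<^sup>2"
      by (subst ennreal_power[symmetric]) (auto intro!: power_mono)
  qed
  also have "\<dots> \<le> ennreal (kernel_bound L) * ennreal (kernel_bound L) * (\<integral>\<^sup>+q. ennreal ((norm (U q))\<^sup>2) \<partial>cylinder_measure)"
    by (rule schur_test[OF cylinder.sigma_finite_measure_axioms cylinder.sigma_finite_measure_axioms])
       (use nn_integral_windowed_kernel[OF L] in \<open>auto simp: windowed_kernel_nonneg\<close>)
  also have "\<dots> < \<infinity>"
    using controls_L2D(2)[OF U]
    by (auto simp: integrable_iff_bounded ennreal_mult_less_top)
  finally show ?thesis
    by (intro integrableI_bounded) auto
qed

section \<open>Analytic continuation of the Cauchy potential\<close>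

lemma controls_integrable_weighted:
  assumes U: "U \<in> controls L \<omega>" and "w \<in> borel_measurable cylinder_measure"
    and "\<And>s z. s \<in> {0..L} \<Longrightarrow> z \<in> sphere 0 1 \<Longrightarrow> norm (w (s, z)) \<le> C"
  shows "integrable cylinder_measure (\<lambda>p. U p * w p)"
  by (rule integrable_weighted_control[OF controls_L2D[OF U] _ assms(2,3)]) (use controls_zero[OF U] in auto)

lemma controls_integrable:
  assumes "U \<in> controls L \<omega>"
  shows "integrable cylinder_measure U"
  using controls_integrable_weighted[OF assms, of "\<lambda>_. 1" 1] by simp

text \<open>At \<open>w = e^-s z\<close> this solves the homogeneous equation
  \<open>(d/ds + D) v = 0\<close> and has the Fourier coefficients of the potential for
  \<open>s > L\<close>. It starts at exponent 1 because the Cauchy kernel for \<open>r > 1\<close>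
  has no coefficient with \<open>n \<le> 0\<close>.\<close>

definition power_part :: "(real \<times> complex \<Rightarrow> complex) \<Rightarrow> complex \<Rightarrow> complex" where
  "power_part U w = (\<Sum>k. moment U (int (Suc k)) / (2 * pi) * w ^ Suc k)"

text \<open>Bounded moments give radius of convergence at least 1, hence convergence at every time
  \<open>s > 0\<close>. The bound degenerates as \<open>norm w\<close> tends to 1, which is why
  later statements stay at \<open>s \<ge> \<epsilon>\<close>.\<close>

lemma power_part_sums:
  assumes "\<And>n. norm (moment U n) \<le> C" "norm w < 1"
  shows "(\<lambda>k. moment U (int (Suc k)) / (2 * pi) * w ^ Suc k) sums power_part U w"
    and "norm (power_part U w) \<le> C / (1 - norm w)"
proof -
  have le: "norm (moment U (int (Suc k)) / (2 * pi) * w ^ Suc k) \<le> C * norm w ^ k" for k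
  proof -
    have "norm (moment U (int (Suc k)) / (2 * pi)) \<le> C / 1"
      unfolding norm_divide using assms(1)[of "int (Suc k)"] pi_gt3 order_trans[OF norm_ge_zero assms(1)[of 0]]
      by (intro frac_le) (auto simp: norm_mult)
    moreover have "norm (w ^ Suc k) \<le> norm w ^ k"
      using assms(2) by (simp add: norm_mult norm_power mult_left_le_one_le)
    ultimately show ?thesis unfolding norm_mult[of "moment U (int (Suc k)) / (2 * pi)"]
      using order_trans[OF norm_ge_zero assms(1)[of 0]] by (intro mult_mono) auto
  qed
  have s: "(\<lambda>k. C * norm w ^ k) sums (C * (1 / (1 - norm w)))"
    using assms(2) by (intro sums_mult geometric_sums) auto
  have "summable (\<lambda>k. norm (moment U (int (Suc k)) / (2 * pi) * w ^ Suc k))"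
    by (rule summable_comparison_test'[OF sums_summable[OF s], of 0]) (use le in simp)
  note sn = this
  show "(\<lambda>k. moment U (int (Suc k)) / (2 * pi) * w ^ Suc k) sums power_part U w"
    unfolding power_part_def by (rule summable_sums[OF summable_norm_cancel[OF sn]])
  have "norm (power_part U w) \<le> (\<Sum>k. norm (moment U (int (Suc k)) / (2 * pi) * w ^ Suc k))"
    unfolding power_part_def by (rule summable_norm[OF sn])
  also have "\<dots> \<le> (\<Sum>k. C * norm w ^ k)"
    by (rule suminf_le[OF le sn sums_summable[OF s]])
  also have "\<dots> = C / (1 - norm w)" using s by (simp add: sums_iff)
  finally show "norm (power_part U w) \<le> C / (1 - norm w)" .
qed

lemma power_part_holomorphic:
  assumes "\<And>n. norm (moment U n) \<le> C"
  shows "power_part U holomorphic_on ball 0 1"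
proof (rule power_series_holomorphic)
  fix w :: complex assume "w \<in> ball 0 1"
  then have "norm w < 1" by simp
  define a where "a n = (if n = 0 then 0 else moment U (int n) / (2 * pi))" for n
  have "(\<lambda>k. a (Suc k) * (w - 0) ^ Suc k) sums power_part U w"
    using power_part_sums(1)[OF assms \<open>norm w < 1\<close>] by (simp only: a_def diff_0_right nat.distinct if_False)
  then have "(\<lambda>n. a n * (w - 0) ^ n) sums (power_part U w + a 0 * (w - 0) ^ 0)"
    by (rule sums_Suc)
  then show "(\<lambda>n. (if n = 0 then 0 else moment U (int n) / (2 * pi)) * (w - 0) ^ n) sums power_part U w"
    by (simp only: a_def refl if_True mult_zero_left add_0_right)
qed

section \<open>The Cauchy transform in the disc coordinate\<close>

definition cauchy_transform :: "(real \<times> complex \<Rightarrow> complex) \<Rightarrow> complex \<Rightarrow> complex" where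
  "cauchy_transform U w = (LINT q|cylinder_measure. U q / (of_real (exp (- fst q)) * snd q - w))"

text \<open>In the coordinate \<open>w = e^-s z\<close> the potential is \<open>w / (2 pi)\<close>
  times a function holomorphic off the closure of the image of the support of \<open>U\<close>, so
  complex analysis applies.\<close>

lemma cauchy_potential_eq_transform:
  "cauchy_potential U (s, z) = of_real (exp (- s)) * z * cauchy_transform U (of_real (exp (- s)) * z) / (2 * pi)"
proof -
  have eq: "cauchy_kernel (exp (s - \<sigma>)) \<eta> z = of_real (exp (- s)) * z / (of_real (exp (- \<sigma>)) * \<eta> - of_real (exp (- s)) * z)" for \<sigma> \<eta>
  proof -
    have "of_real (exp (- \<sigma>)) * \<eta> - of_real (exp (- s)) * z = of_real (exp (- s)) * (of_real (exp (s - \<sigma>)) * \<eta> - z)"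
      by (simp add: right_diff_distrib exp_diff exp_minus field_simps)
    then show ?thesis by (simp add: cauchy_kernel_def)
  qed
  have "(LINT q|cylinder_measure. U q * cauchy_kernel (exp (s - fst q)) (snd q) z) =
    (LINT q|cylinder_measure. of_real (exp (- s)) * z * (U q / (of_real (exp (- fst q)) * snd q - of_real (exp (- s)) * z)))"
    unfolding eq by (intro Bochner_Integration.integral_cong refl) simp
  also have "\<dots> = of_real (exp (- s)) * z * cauchy_transform U (of_real (exp (- s)) * z)"
    unfolding cauchy_transform_def by (rule Bochner_Integration.integral_mult_right_zero)
  finally show ?thesis by (simp add: cauchy_potential_def)
qed

lemma cauchy_transform_sums:
  assumes U: "U \<in> controls L \<omega>"
    and d: "\<And>s z. s \<in> {0..L} \<Longrightarrow> z \<in> \<omega> \<Longrightarrow> d \<le> norm (of_real (exp (- s)) * z - w\<^sub>0)" and w: "norm (w - w\<^sub>0) < d"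
  shows "(\<lambda>k. (LINT q|cylinder_measure. U q / (of_real (exp (- fst q)) * snd q - w\<^sub>0) ^ Suc k) * (w - w\<^sub>0) ^ k) sums cauchy_transform U w"
proof -
  let ?\<xi> = "\<lambda>q :: real \<times> complex. of_real (exp (- fst q)) * snd q"
  have d0: "d > 0" using w order_le_less_trans[OF norm_ge_zero w] by simp
  note [measurable] = controls_L2D(1)[OF U]
  have far: "d \<le> norm (?\<xi> q - w\<^sub>0)" if "U q \<noteq> 0" for q
    using d[of "fst q" "snd q"] controls_zero[OF U, of "fst q" "snd q"] that by (cases q) auto
  \<comment> \<open>The distance \<open>d\<close> is guaranteed only on the support of
    \<open>U\<close>; elsewhere the quotient may be large and is replaced by 0.\<close>
  define \<beta> where "\<beta> q = (if U q = 0 then 0 else (w - w\<^sub>0) / (?\<xi> q - w\<^sub>0))" for q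
  have [measurable]: "\<beta> \<in> borel_measurable cylinder_measure" unfolding \<beta>_def by measurable
  have \<beta>: "norm (\<beta> q) \<le> norm (w - w\<^sub>0) / d" for q
    using far[of q] d0 by (auto simp: \<beta>_def norm_divide intro!: frac_le)
  have int: "integrable cylinder_measure (\<lambda>q. U q / (?\<xi> q - w\<^sub>0))"
  proof (rule Bochner_Integration.integrable_bound)
    show "integrable cylinder_measure (\<lambda>q. norm (U q) / d)" using controls_integrable[OF U] by simp
    show "(\<lambda>q. U q / (?\<xi> q - w\<^sub>0)) \<in> borel_measurable cylinder_measure" by measurable
    have "norm (U q / (?\<xi> q - w\<^sub>0)) \<le> norm (U q) / d" for q
      using far[of q] d0 by (cases "U q = 0") (auto simp: norm_divide intro!: frac_le)
    then show "AE q in cylinder_measure. norm (U q / (?\<xi> q - w\<^sub>0)) \<le> norm (norm (U q) / d)"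
      using d0 by simp
  qed
  have "(\<lambda>k. LINT q|cylinder_measure. U q / (?\<xi> q - w\<^sub>0) * \<beta> q ^ k) sums
        (LINT q|cylinder_measure. U q / (?\<xi> q - w\<^sub>0) / (1 - \<beta> q))"
    by (rule geometric_integral_sums[OF int _ \<beta>]) (use w d0 in \<open>auto simp: divide_less_eq\<close>)
  moreover have eq1: "U q / (?\<xi> q - w\<^sub>0) / (1 - \<beta> q) = U q / (?\<xi> q - w)" for q
  proof (cases "U q = 0")
    case False
    then have "?\<xi> q - w\<^sub>0 \<noteq> 0" using far[OF False] d0 by auto
    then have "(?\<xi> q - w\<^sub>0) * (1 - \<beta> q) = ?\<xi> q - w" using False by (simp add: \<beta>_def field_simps)
    then show ?thesis by (simp add: divide_divide_eq_left)
  qed simp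
  moreover have eq2: "U q / (?\<xi> q - w\<^sub>0) * \<beta> q ^ k = U q / (?\<xi> q - w\<^sub>0) ^ Suc k * (w - w\<^sub>0) ^ k" for q k
    by (cases "U q = 0") (auto simp: \<beta>_def power_divide)
  ultimately show ?thesis
    by (simp only: cauchy_transform_def eq1 eq2 Bochner_Integration.integral_mult_left_zero)
qed

text \<open>The Taylor coefficients of the transform at 0 are the integrals of
  \<open>U / \<xi>^(k + 1)\<close> with \<open>\<xi> = e^-\<sigma> \<eta>\<close>, which are the
  moments with positive index. The disc of radius \<open>e^-L\<close> stands for the times after
  \<open>L\<close>.\<close>

lemma power_part_eq_transform_near_0:
  assumes U: "U \<in> controls L \<omega>" and \<omega>: "\<omega> \<subseteq> sphere 0 1"
    and C: "\<And>n. norm (moment U n) \<le> C" and L: "L \<ge> 0" and w: "norm w < exp (- L)"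
  shows "power_part U w = w * cauchy_transform U w / (2 * pi)"
proof -
  have d: "exp (- L) \<le> norm (of_real (exp (- s)) * z - 0)" if "s \<in> {0..L}" "z \<in> \<omega>" for s z
    using that \<omega> by (auto simp: norm_mult subset_iff)
  have "(\<lambda>k. (LINT q|cylinder_measure. U q / (of_real (exp (- fst q)) * snd q - 0) ^ Suc k) * (w - 0) ^ k) sums cauchy_transform U w"
    by (rule cauchy_transform_sums[OF U d]) (use w in auto)
  moreover have "(LINT q|cylinder_measure. U q / (of_real (exp (- fst q)) * snd q - 0) ^ Suc k) = moment U (int (Suc k))" for k
    unfolding moment_def
  proof (intro Bochner_Integration.integral_cong refl, clarify)
    fix s :: real and z :: complex
    have "exp (of_int \<bar>int (Suc k)\<bar> * s) = 1 / exp (- s) ^ Suc k"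
      by (simp add: exp_of_nat_mult[symmetric] exp_minus field_simps del: of_nat_Suc power_Suc)
    then show "U (s, z) / (of_real (exp (- fst (s, z))) * snd (s, z) - 0) ^ Suc k =
       U (s, z) * of_real (exp (of_int \<bar>int (Suc k)\<bar> * s)) * z powi (- int (Suc k))"
      by (simp add: power_int_minus power_mult_distrib divide_inverse del: of_nat_Suc power_Suc)
  qed
  ultimately have "(\<lambda>k. moment U (int (Suc k)) * w ^ k) sums cauchy_transform U w" by simp
  then have "(\<lambda>k. w / (2 * pi) * (moment U (int (Suc k)) * w ^ k)) sums (w / (2 * pi) * cauchy_transform U w)"
    by (rule sums_mult)
  then have "(\<lambda>k. moment U (int (Suc k)) / (2 * pi) * w ^ Suc k) sums (w * cauchy_transform U w / (2 * pi))"
    by (simp add: mult_ac)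
  moreover have "norm w < 1" using w L by (meson exp_le_one_iff neg_le_0_iff_le order_less_le_trans)
  ultimately show ?thesis
    using sums_unique2 power_part_sums(1)[OF C] by blast
qed

text \<open>Unique continuation by the identity theorem. The set \<open>X\<close> of points of
  modulus at least \<open>e^-L\<close> in the directions of \<open>K\<close> contains the image of
  the support of \<open>U\<close>; what remains of the unit disc is star-shaped about 0, and near 0
  both sides agree.\<close>

lemma cauchy_potential_eq_power_part:
  assumes U: "U \<in> controls L \<omega>" and \<omega>: "\<omega> \<subseteq> K" "K \<subseteq> sphere 0 1" "closed K"
    and C: "\<And>n. norm (moment U n) \<le> C" and L: "L \<ge> 0"
    and s: "s > 0" and z: "z \<in> sphere 0 1" "z \<notin> K"
  shows "cauchy_potential U (s, z) = power_part U (of_real (exp (- s)) * z)"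
proof -
  define X where "X = {w. norm w \<ge> exp (- L)} \<inter> sgn -` K"
  have "closed X" unfolding X_def
  proof (rule continuous_closed_preimage[OF _ _ \<open>closed K\<close>])
    \<comment> \<open>The lower bound on the modulus keeps away from 0, where \<open>sgn\<close> is
      discontinuous.\<close>
    have "w \<noteq> 0" if "norm w \<ge> exp (- L)" for w :: complex using that exp_gt_zero[of "-L"] by auto
    then show "continuous_on {w :: complex. norm w \<ge> exp (- L)} sgn"
      by (intro continuous_on_sgn continuous_on_id) auto
    show "closed {w :: complex. norm w \<ge> exp (- L)}" by (intro closed_Collect_le continuous_intros)
  qed
  define \<Omega> where "\<Omega> = ball 0 1 - X"
  have "open \<Omega>" unfolding \<Omega>_def using \<open>closed X\<close> by auto
  have "connected \<Omega>"
  proof (rule starlike_imp_connected, unfold starlike_def, intro bexI ballI)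
    show "0 \<in> \<Omega>" by (auto simp: \<Omega>_def X_def)
    fix w assume w: "w \<in> \<Omega>"
    show "closed_segment 0 w \<subseteq> \<Omega>"
    proof
      fix v assume "v \<in> closed_segment 0 w"
      then obtain t where t: "0 \<le> t" "t \<le> 1" "v = t *\<^sub>R w" by (auto simp: closed_segment_def)
      have le: "norm v \<le> norm w" using t by (simp add: mult_left_le_one_le)
      have "v \<notin> X"
      proof
        assume v: "v \<in> X"
        then have "v \<noteq> 0" using exp_gt_zero[of "-L"] by (auto simp: X_def)
        then have "sgn v = sgn w" using t by (auto simp: sgn_scaleR)
        then have "w \<in> X" using v le by (auto simp: X_def)
        with w show False by (simp add: \<Omega>_def)
      qed
      then show "v \<in> \<Omega>" using w le by (simp add: \<Omega>_def)
    qed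
  qed
  have "cauchy_transform U holomorphic_on \<Omega>"
  proof (rule holomorphic_on_subset)
    show "cauchy_transform U holomorphic_on (- X)"
    proof (subst holomorphic_on_open)
      show "open (- X)" using \<open>closed X\<close> by auto
      show "\<forall>x\<in>- X. \<exists>f'. (cauchy_transform U has_field_derivative f') (at x)"
      proof
        fix w\<^sub>0 assume "w\<^sub>0 \<in> - X"
        with \<open>closed X\<close> obtain d where d: "d > 0" "ball w\<^sub>0 d \<subseteq> - X"
          by (meson open_Compl open_contains_ball)
        have far: "d \<le> norm (of_real (exp (- s)) * z - w\<^sub>0)" if "s \<in> {0..L}" "z \<in> \<omega>" for s z
        proof (rule ccontr)
          assume "\<not> d \<le> norm (of_real (exp (- s)) * z - w\<^sub>0)"
          then have "of_real (exp (- s)) * z \<in> ball w\<^sub>0 d" by (simp add: dist_norm norm_minus_commute)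
          moreover have "z \<in> sphere 0 1" "z \<in> K" using that \<omega> by auto
          then have "of_real (exp (- s)) * z \<in> X"
          proof -
            have "sgn (of_real (exp (- s)) * z) = z"
              using \<open>z \<in> sphere 0 1\<close> by (simp add: sgn_div_norm norm_mult scaleR_conv_of_real flip: of_real_mult)
            then show ?thesis using that \<open>z \<in> K\<close> \<open>z \<in> sphere 0 1\<close> by (auto simp: X_def norm_mult)
          qed
          ultimately show False using d by auto
        qed
        have "cauchy_transform U holomorphic_on ball w\<^sub>0 d"
          by (rule power_series_holomorphic, rule cauchy_transform_sums[OF U far]) (simp_all add: dist_norm norm_minus_commute)
        then show "\<exists>f'. (cauchy_transform U has_field_derivative f') (at w\<^sub>0)"
          using d by (auto simp: holomorphic_on_open)
      qed
    qed
  qed (auto simp: \<Omega>_def)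
  then have 1: "(\<lambda>w. w * cauchy_transform U w / (2 * pi)) holomorphic_on \<Omega>"
    by (intro holomorphic_intros) auto
  have 2: "power_part U holomorphic_on \<Omega>"
    using power_part_holomorphic[OF C] by (rule holomorphic_on_subset) (auto simp: \<Omega>_def)
  have sub: "ball 0 (exp (- L)) \<subseteq> \<Omega>"
  proof
    fix w :: complex assume "w \<in> ball 0 (exp (- L))"
    moreover have "exp (- L) \<le> 1" using L by simp
    ultimately show "w \<in> \<Omega>" by (auto simp: \<Omega>_def X_def simp del: exp_le_one_iff)
  qed
  have "power_part U (of_real (exp (- s)) * z) =
      of_real (exp (- s)) * z * cauchy_transform U (of_real (exp (- s)) * z) / (2 * pi)"
  proof (rule analytic_continuation_open[where s = "ball 0 (exp (- L))" and s' = \<Omega> and f = "power_part U"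
        and g = "\<lambda>w. w * cauchy_transform U w / (2 * pi)" and z = "of_real (exp (- s)) * z"])
    show "\<And>w. w \<in> ball 0 (exp (- L)) \<Longrightarrow> power_part U w = w * cauchy_transform U w / (2 * pi)"
      using power_part_eq_transform_near_0[OF U _ C L] \<omega> by auto
    show "of_real (exp (- s)) * z \<in> \<Omega>"
    proof -
      have "sgn (of_real (exp (- s)) * z) = z"
        using z by (simp add: sgn_div_norm norm_mult scaleR_conv_of_real flip: of_real_mult)
      then show ?thesis using s z by (simp add: \<Omega>_def X_def norm_mult)
    qed
  qed (use 1 2 sub \<open>open \<Omega>\<close> \<open>connected \<Omega>\<close> in auto)
  then show ?thesis by (simp add: cauchy_potential_eq_transform)
qed

section \<open>Moments of the jump of the potential\<close>

interpretation cylinder2: pair_sigma_finite cylinder_measure cylinder_measure ..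

text \<open>Smoothness is not asked for: \<open>bump_deriv\<close> jumps at the ends of its support,
  and boundedness on a compact time interval is enough for Fubini.\<close>

definition test_function :: "real \<Rightarrow> real \<Rightarrow> (real \<Rightarrow> real) \<Rightarrow> bool" where
  "test_function a b G \<longleftrightarrow> G \<in> borel_measurable borel \<and> (\<exists>C. \<forall>s. \<bar>G s\<bar> \<le> C) \<and> (\<forall>s. s \<notin> {a..b} \<longrightarrow> G s = 0)"

lemma test_function_zero: "test_function a b G \<Longrightarrow> s \<notin> {a..b} \<Longrightarrow> G s = 0"
  unfolding test_function_def by blast

lemma test_function_bound:
  assumes "test_function a b G"
  obtains C where "C \<ge> 0" "\<And>s. \<bar>G s\<bar> \<le> C"
proof -
  obtain C where C: "\<And>s. \<bar>G s\<bar> \<le> C" using assms by (auto simp: test_function_def)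
  then have "C \<ge> 0" using order_trans[OF abs_ge_zero C] by blast
  with C that show ?thesis by blast
qed

lemma test_function_integrable:
  fixes h :: "real \<Rightarrow> real"
  assumes G: "test_function a b G" and h: "h \<in> borel_measurable borel" "\<And>s. s \<in> {a..b} \<Longrightarrow> \<bar>h s\<bar> \<le> B"
  shows "integrable lborel (\<lambda>s. G s * h s)"
proof -
  obtain C where C: "C \<ge> 0" "\<And>s. \<bar>G s\<bar> \<le> C" by (rule test_function_bound[OF G]) blast
  have [measurable]: "G \<in> borel_measurable borel" using G by (simp add: test_function_def)
  show ?thesis
  proof (rule Bochner_Integration.integrable_bound)
    show "integrable lborel (\<lambda>s. indicator {a..b} s * (C * B))"
      by (cases "a \<le> b") (auto intro!: integrable_mult_left integrable_real_indicator)
    show "(\<lambda>s. G s * h s) \<in> borel_measurable lborel" using h(1) by simp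
    show "AE s in lborel. norm (G s * h s) \<le> norm (indicator {a..b} s * (C * B))"
    proof (rule AE_I2)
      fix s
      show "norm (G s * h s) \<le> norm (indicator {a..b} s * (C * B))"
      proof (cases "s \<in> {a..b}")
        case True
        have "\<bar>G s\<bar> * \<bar>h s\<bar> \<le> C * B" using C h(2)[OF True] by (intro mult_mono) auto
        also have "\<dots> \<le> \<bar>C * B\<bar>" by (rule abs_ge_self)
        finally show ?thesis using True by (simp add: abs_mult[of "G s" "h s"])
      qed (simp add: test_function_zero[OF G])
    qed
  qed
qed

lemma exp_linear_bound:
  assumes "(s :: real) \<in> {a..b}"
  shows "exp (c * s) \<le> exp (\<bar>c\<bar> * (\<bar>a\<bar> + \<bar>b\<bar>))"
proof -
  have "c * s \<le> \<bar>c\<bar> * \<bar>s\<bar>" by (metis abs_ge_self abs_mult)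
  also have "\<dots> \<le> \<bar>c\<bar> * (\<bar>a\<bar> + \<bar>b\<bar>)" using assms by (intro mult_left_mono) auto
  finally show ?thesis by simp
qed

lemma power_part_moment:
  assumes C: "\<And>n. norm (moment U n) \<le> C" and \<epsilon>: "\<epsilon> > 0" and G: "test_function \<epsilon> L G"
  defines "F \<equiv> \<lambda>n p. power_part U (of_real (exp (- fst p)) * snd p) * of_real (G (fst p)) * snd p powi (- n)"
  shows "integrable cylinder_measure (F n)"
    and "(LINT p|cylinder_measure. F n p) = of_bool (n \<ge> 1) * moment U n * of_real (LINT s|lborel. G s * exp (- (of_int n * s)))"
proof -
  obtain B where B: "B \<ge> 0" "\<And>s. \<bar>G s\<bar> \<le> B" by (rule test_function_bound[OF G]) blast
  have C0: "C \<ge> 0" using order_trans[OF norm_ge_zero C] by blast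
  have G_meas [measurable]: "G \<in> borel_measurable borel" using G by (simp add: test_function_def)
  define c where "c k = moment U (int (Suc k)) / (2 * pi)" for k
  have c: "norm (c k) \<le> C" for k
  proof -
    have "norm (c k) \<le> C / 1" unfolding c_def norm_divide
      using C[of "int (Suc k)"] C0 pi_gt3 by (intro frac_le) (auto simp: norm_mult)
    then show ?thesis by simp
  qed
  \<comment> \<open>On the support of \<open>G\<close> the modulus of \<open>w\<close> is at most
    this number, uniformly below 1.\<close>
  define \<rho> where "\<rho> = exp (- \<epsilon>)"
  have \<rho>: "0 < \<rho>" "\<rho> < 1" using \<epsilon> by (auto simp: \<rho>_def)
  define f where "f k p = c k * (of_real (exp (- fst p)) * snd p) ^ Suc k * of_real (G (fst p)) * snd p powi (- n)" for k and p :: "real \<times> complex"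
  have [measurable]: "f k \<in> borel_measurable cylinder_measure" for k
    unfolding f_def by measurable
  have bound: "norm (f k (s, z)) \<le> (indicator {\<epsilon>..L} s * (C * B)) * \<rho> ^ k" if z: "z \<in> sphere 0 1" for k s z
  proof (cases "s \<in> {\<epsilon>..L}")
    case True
    then have "exp (- s) \<le> \<rho>" by (simp add: \<rho>_def)
    have "norm (f k (s, z)) = norm (c k) * exp (- s) ^ Suc k * \<bar>G s\<bar>"
      using z norm_powi_sphere[OF z] by (simp add: f_def norm_mult norm_power)
    also have "\<dots> \<le> C * \<rho> ^ k * B"
    proof (intro mult_mono)
      have "exp (- s) ^ Suc k \<le> \<rho> ^ Suc k" using \<open>exp (- s) \<le> \<rho>\<close> by (rule power_mono) simp
      also have "\<dots> \<le> \<rho> ^ k" using \<rho> by (simp add: mult_left_le_one_le)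
      finally show "exp (- s) ^ Suc k \<le> \<rho> ^ k" .
    qed (use c B C0 \<rho> in auto)
    finally show ?thesis using True by (simp add: mult_ac)
  qed (simp add: f_def test_function_zero[OF G])
  have strip: "integrable cylinder_measure (\<lambda>(s, z). indicator {\<epsilon>..L} s * (C * B))"
    by (rule integrable_strip)
  have int: "integrable cylinder_measure (f k)" for k
  proof (rule Bochner_Integration.integrable_bound)
    show "integrable cylinder_measure (\<lambda>p. (case p of (s, z) \<Rightarrow> indicator {\<epsilon>..L} s * (C * B)) * \<rho> ^ k)"
      using strip by (rule integrable_mult_left)
    show "AE p in cylinder_measure. norm (f k p) \<le> norm ((case p of (s, z) \<Rightarrow> indicator {\<epsilon>..L} s * (C * B)) * \<rho> ^ k)"
    proof (rule AE_I2)
      fix p assume "p \<in> space cylinder_measure"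
      then obtain s z where p: "p = (s, z)" "z \<in> sphere 0 1" by (auto simp: space_pair_measure)
      from bound[OF p(2), of k s] show "norm (f k p) \<le> norm ((case p of (s, z) \<Rightarrow> indicator {\<epsilon>..L} s * (C * B)) * \<rho> ^ k)"
        unfolding p(1) prod.case real_norm_def by linarith
    qed
  qed measurable
  have sumn: "AE p in cylinder_measure. summable (\<lambda>k. norm (f k p))"
  proof (rule AE_I2)
    fix p assume "p \<in> space cylinder_measure"
    then obtain s z where p: "p = (s, z)" "z \<in> sphere 0 1" by (auto simp: space_pair_measure)
    have "summable (\<lambda>k. (indicator {\<epsilon>..L} s * (C * B)) * \<rho> ^ k)"
      using \<rho> by (intro summable_mult summable_geometric) auto
    then show "summable (\<lambda>k. norm (f k p))"
      by (rule summable_comparison_test'[where N = 0]) (use bound[OF p(2)] p(1) in simp)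
  qed
  have sumi: "summable (\<lambda>k. LINT p|cylinder_measure. norm (f k p))"
  proof (rule summable_comparison_test'[where N = 0])
    show "summable (\<lambda>k. (LINT p|cylinder_measure. (case p of (s, z) \<Rightarrow> indicator {\<epsilon>..L} s * (C * B))) * \<rho> ^ k)"
      using \<rho> by (intro summable_mult summable_geometric) auto
    fix k
    have "(LINT p|cylinder_measure. norm (f k p)) \<le> (LINT p|cylinder_measure. (case p of (s, z) \<Rightarrow> indicator {\<epsilon>..L} s * (C * B)) * \<rho> ^ k)"
    proof (rule integral_mono)
      show "integrable cylinder_measure (\<lambda>p. norm (f k p))" using int by simp
      show "integrable cylinder_measure (\<lambda>p. (case p of (s, z) \<Rightarrow> indicator {\<epsilon>..L} s * (C * B)) * \<rho> ^ k)"
        using strip by (rule integrable_mult_left)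
      fix p assume "p \<in> space cylinder_measure"
      then obtain s z where p: "p = (s, z)" "z \<in> sphere 0 1" by (auto simp: space_pair_measure)
      from bound[OF p(2)] show "norm (f k p) \<le> (case p of (s, z) \<Rightarrow> indicator {\<epsilon>..L} s * (C * B)) * \<rho> ^ k"
        unfolding p(1) prod.case .
    qed
    then show "norm (LINT p|cylinder_measure. norm (f k p)) \<le> (LINT p|cylinder_measure. (case p of (s, z) \<Rightarrow> indicator {\<epsilon>..L} s * (C * B))) * \<rho> ^ k"
      by simp
  qed
  have F_eq: "(\<Sum>k. f k p) = F n p" if "p \<in> space cylinder_measure" for p
  proof (cases "fst p \<in> {\<epsilon>..L}")
    case True
    have "norm (of_real (exp (- fst p)) * snd p) < 1"
      using that True \<epsilon> by (auto simp: norm_mult space_pair_measure)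
    from sums_mult2[OF power_part_sums(1)[OF C this], of "of_real (G (fst p)) * snd p powi (- n)"]
    show ?thesis by (simp add: F_def f_def c_def sums_iff mult.assoc)
  next
    case False
    then show ?thesis by (simp add: F_def f_def test_function_zero[OF G])
  qed
  have "integrable cylinder_measure (\<lambda>p. \<Sum>k. f k p)" by (rule integrable_suminf[OF int sumn sumi])
  then show "integrable cylinder_measure (F n)"
    by (rule Bochner_Integration.integrable_cong[THEN iffD1, OF refl, rotated]) (rule F_eq)
  have sums: "(\<lambda>k. LINT p|cylinder_measure. f k p) sums (LINT p|cylinder_measure. F n p)"
    using sums_integral[OF int sumn sumi] F_eq by (simp cong: Bochner_Integration.integral_cong)
  \<comment> \<open>The series starts at exponent 1, so frequency \<open>n\<close> sits at index
    \<open>n - 1\<close>. For \<open>n \<le> 0\<close> no index matches and the value attached to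
    \<open>nat (n - 1) = 0\<close> is 0.\<close>
  have coeff: "(LINT p|cylinder_measure. f k p) =
      (if k = nat (n - 1) then of_bool (n \<ge> 1) * moment U n * of_real (LINT s|lborel. G s * exp (- (of_int n * s))) else 0)" for k
  proof -
    have "(LINT p|cylinder_measure. f k p) = (LINT s|lborel. (LINT z|circle_measure. f k (s, z)))"
      by (rule cylinder.integral_fst'[symmetric, OF int])
    also have "\<dots> = (LINT s|lborel. c k * of_real (G s * exp (- (of_int (int (Suc k)) * s))) * (of_bool (n = int (Suc k)) * (2 * pi)))"
    proof (rule Bochner_Integration.integral_cong[OF refl])
      fix s :: real
      have "(LINT z|circle_measure. f k (s, z)) =
          (LINT z|circle_measure. c k * of_real (G s * exp (- (of_int (int (Suc k)) * s))) * z powi (int (Suc k) - n))"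
      proof (rule Bochner_Integration.integral_cong[OF refl])
        fix z assume "z \<in> space circle_measure"
        then have "z \<noteq> 0" by auto
        have "exp (- (of_int (int (Suc k)) * s)) = exp (- s) ^ Suc k"
          using exp_of_nat_mult[of "Suc k" "- s"] by (simp only: of_int_of_nat_eq mult_minus_right)
        then show "f k (s, z) = c k * of_real (G s * exp (- (of_int (int (Suc k)) * s))) * z powi (int (Suc k) - n)"
          using \<open>z \<noteq> 0\<close>
          by (simp add: f_def power_int_diff power_int_minus power_mult_distrib divide_inverse del: of_nat_Suc power_Suc)
      qed
      also have "\<dots> = c k * of_real (G s * exp (- (of_int (int (Suc k)) * s))) * (LINT z|circle_measure. z powi (int (Suc k) - n))"
        by (rule Bochner_Integration.integral_mult_right_zero)
      also have "(LINT z|circle_measure. z powi (int (Suc k) - n)) = of_bool (n = int (Suc k)) * (2 * pi)"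
        by (auto simp: integral_powi_circle simp del: of_nat_Suc)
      finally show "(LINT z|circle_measure. f k (s, z)) =
        c k * of_real (G s * exp (- (of_int (int (Suc k)) * s))) * (of_bool (n = int (Suc k)) * (2 * pi))" .
    qed
    also have "\<dots> = c k * of_real (LINT s|lborel. G s * exp (- (of_int (int (Suc k)) * s))) * (of_bool (n = int (Suc k)) * (2 * pi))"
      by (simp only: Bochner_Integration.integral_mult_left_zero Bochner_Integration.integral_mult_right_zero integral_complex_of_real)
    also have "\<dots> = (if k = nat (n - 1) then of_bool (n \<ge> 1) * moment U n * of_real (LINT s|lborel. G s * exp (- (of_int n * s))) else 0)"
    proof (cases "n = int (Suc k)")
      case True
      then have "k = nat (n - 1)" "n \<ge> 1" by auto
      then show ?thesis using True by (simp add: c_def)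
    next
      case False
      then have "k \<noteq> nat (n - 1) \<or> \<not> n \<ge> 1" by auto
      then show ?thesis using False by auto
    qed
    finally show ?thesis .
  qed
  show "(LINT p|cylinder_measure. F n p) = of_bool (n \<ge> 1) * moment U n * of_real (LINT s|lborel. G s * exp (- (of_int n * s)))"
    using sums unfolding coeff by (rule sums_unique2[OF _ sums_single])
qed

text \<open>The fundamental solution of \<open>y' + n y\<close>, supported in \<open>t > 0\<close>
  for \<open>n \<ge> 1\<close> and in \<open>t < 0\<close> for \<open>n \<le> 0\<close>, as the two
  expansions of the Cauchy kernel dictate.\<close>

definition cauchy_symbol :: "int \<Rightarrow> real \<Rightarrow> real" where
  "cauchy_symbol n t = (of_bool (t > 0 \<and> n \<ge> 1) - of_bool (t < 0 \<and> n \<le> 0)) * exp (- (of_int n * t))"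

lemma measurable_cauchy_symbol [measurable]: "cauchy_symbol n \<in> borel_measurable borel"
  unfolding cauchy_symbol_def by measurable

text \<open>Fubini on the product of two cylinders, with domination by the column bound of
  \<open>windowed_kernel\<close>: the time convolution is moved from \<open>U\<close> to
  \<open>G\<close>.\<close>

lemma cauchy_potential_moment:
  assumes L: "L \<ge> 0" and U: "U \<in> controls L \<omega>" and G: "test_function 0 L G"
  shows "integrable cylinder_measure (\<lambda>p. cauchy_potential U p * of_real (G (fst p)) * snd p powi (- n))" (is ?A)
    and "integrable cylinder_measure (\<lambda>q. U q * snd q powi (- n) * of_real (LINT s|lborel. G s * cauchy_symbol n (s - fst q)))" (is ?B)
    and "(LINT p|cylinder_measure. cauchy_potential U p * of_real (G (fst p)) * snd p powi (- n)) =
      (LINT q|cylinder_measure. U q * snd q powi (- n) * of_real (LINT s|lborel. G s * cauchy_symbol n (s - fst q)))" (is ?C)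
proof -
  obtain B where B: "B \<ge> 0" "\<And>s. \<bar>G s\<bar> \<le> B" by (rule test_function_bound[OF G]) blast
  have G_meas [measurable]: "G \<in> borel_measurable borel" using G by (simp add: test_function_def)
  note U_meas [measurable] = controls_L2D(1)[OF U]
  define J where "J p q = U q * cauchy_kernel (exp (fst p - fst q)) (snd q) (snd p) * (of_real (G (fst p)) * snd p powi (- n))"
    for p q :: "real \<times> complex"
  have J_meas [measurable]: "(\<lambda>(p, q). J p q) \<in> borel_measurable (cylinder_measure \<Otimes>\<^sub>M cylinder_measure)"
    unfolding J_def by measurable
  have J_bound: "norm (J p q) \<le> B * norm (U q) * windowed_kernel L p q" if "p \<in> space cylinder_measure" for p q
  proof (cases "fst p \<in> {0..L} \<and> fst q \<in> {0..L}")
    case True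
    have "norm (snd p powi (- n)) = 1" using that by (intro norm_powi_sphere) (auto simp: space_pair_measure)
    then have "norm (J p q) = norm (U q) * norm (cauchy_kernel (exp (fst p - fst q)) (snd q) (snd p)) * \<bar>G (fst p)\<bar>"
      by (simp add: J_def norm_mult)
    also have "\<dots> \<le> norm (U q) * norm (cauchy_kernel (exp (fst p - fst q)) (snd q) (snd p)) * B"
      using B by (intro mult_left_mono) auto
    finally show ?thesis using True by (simp add: windowed_kernel_def mult_ac)
  next
    case False
    then have "J p q = 0"
      using test_function_zero[OF G, of "fst p"] controls_zero[OF U, of "fst q" "snd q"] by (auto simp: J_def)
    then show ?thesis using B by (simp add: windowed_kernel_nonneg)
  qed
  have int_J: "integrable (cylinder_measure \<Otimes>\<^sub>M cylinder_measure) (\<lambda>(p, q). J p q)"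
  proof (rule integrableI_bounded)
    have "(\<integral>\<^sup>+x. ennreal (norm (case x of (p, q) \<Rightarrow> J p q)) \<partial>(cylinder_measure \<Otimes>\<^sub>M cylinder_measure)) =
      (\<integral>\<^sup>+q. (\<integral>\<^sup>+p. ennreal (norm (J p q)) \<partial>cylinder_measure) \<partial>cylinder_measure)"
      by (subst cylinder2.nn_integral_snd[symmetric]) simp_all
    also have "\<dots> \<le> (\<integral>\<^sup>+q. ennreal (B * norm (U q)) * kernel_bound L \<partial>cylinder_measure)"
    proof (rule nn_integral_mono)
      fix q assume q: "q \<in> space cylinder_measure"
      have "(\<integral>\<^sup>+p. ennreal (norm (J p q)) \<partial>cylinder_measure) \<le>
         (\<integral>\<^sup>+p. ennreal (B * norm (U q)) * ennreal (windowed_kernel L p q) \<partial>cylinder_measure)"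
        using B by (intro nn_integral_mono) (simp add: ennreal_mult[symmetric] windowed_kernel_nonneg J_bound)
      also have "\<dots> = ennreal (B * norm (U q)) * (\<integral>\<^sup>+p. ennreal (windowed_kernel L p q) \<partial>cylinder_measure)"
      proof (rule nn_integral_cmult)
        show "(\<lambda>p. ennreal (windowed_kernel L p q)) \<in> borel_measurable cylinder_measure"
          unfolding windowed_kernel_def by measurable
      qed
      also have "\<dots> \<le> ennreal (B * norm (U q)) * kernel_bound L"
        using nn_integral_windowed_kernel(2)[OF L q] by (rule mult_left_mono) simp
      finally show "(\<integral>\<^sup>+p. ennreal (norm (J p q)) \<partial>cylinder_measure) \<le> ennreal (B * norm (U q)) * kernel_bound L" .
    qed
    also have "\<dots> = (\<integral>\<^sup>+q. ennreal (B * norm (U q)) \<partial>cylinder_measure) * kernel_bound L"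
      by (rule nn_integral_multc) measurable
    also have "\<dots> < \<infinity>"
    proof -
      have "integrable cylinder_measure (\<lambda>q. B * norm (U q))"
        using controls_integrable[OF U] by simp
      then have "(\<integral>\<^sup>+q. ennreal (norm (B * norm (U q))) \<partial>cylinder_measure) < \<infinity>"
        unfolding integrable_iff_bounded by blast
      then have "(\<integral>\<^sup>+q. ennreal (B * norm (U q)) \<partial>cylinder_measure) < \<infinity>"
        using B(1) by simp
      then show ?thesis by (simp add: ennreal_mult_less_top)
    qed
    finally show "(\<integral>\<^sup>+x. ennreal (norm (case x of (p, q) \<Rightarrow> J p q)) \<partial>(cylinder_measure \<Otimes>\<^sub>M cylinder_measure)) < \<infinity>" .
  qed measurable
  have left: "(LINT q|cylinder_measure. J p q) = 2 * pi * (cauchy_potential U p * of_real (G (fst p)) * snd p powi (- n))" for p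
  proof -
    have "(LINT q|cylinder_measure. J p q) =
      (LINT q|cylinder_measure. U q * cauchy_kernel (exp (fst p - fst q)) (snd q) (snd p)) * (of_real (G (fst p)) * snd p powi (- n))"
      unfolding J_def by (rule Bochner_Integration.integral_mult_left_zero)
    then show ?thesis by (simp add: cauchy_potential_def)
  qed
  have right: "(LINT p|cylinder_measure. J p q) = 2 * pi * (U q * snd q powi (- n) * of_real (LINT s|lborel. G s * cauchy_symbol n (s - fst q)))"
    if J: "integrable cylinder_measure (\<lambda>p. J p q)" and q: "q \<in> space cylinder_measure" for q
  proof -
    have \<eta>: "snd q \<in> sphere 0 1" using q by (auto simp: space_pair_measure)
    have "(LINT p|cylinder_measure. J p q) = (LINT s|lborel. (LINT z|circle_measure. J (s, z) q))"
      by (rule cylinder.integral_fst'[symmetric, OF J])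
    also have "\<dots> = (LINT s|lborel. 2 * pi * (U q * snd q powi (- n)) * of_real (G s * cauchy_symbol n (s - fst q)))"
    proof (rule integral_cong_AE)
      show "AE s in lborel. (LINT z|circle_measure. J (s, z) q) = 2 * pi * (U q * snd q powi (- n)) * of_real (G s * cauchy_symbol n (s - fst q))"
        using AE_lborel_singleton[of "fst q"]
      proof eventually_elim
        case (elim s)
        define r where "r = exp (s - fst q)"
        have r: "r > 0" "r \<noteq> 1" "r > 1 \<longleftrightarrow> s - fst q > 0" "r < 1 \<longleftrightarrow> s - fst q < 0" using elim by (auto simp: r_def)
        have "(LINT z|circle_measure. J (s, z) q) =
          (LINT z|circle_measure. U q * of_real (G s) * (cauchy_kernel r (snd q) z * z powi (- n)))"
          by (simp add: J_def r_def mult_ac)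
        also have "\<dots> = U q * of_real (G s) * (LINT z|circle_measure. cauchy_kernel r (snd q) z * z powi (- n))"
          by (rule Bochner_Integration.integral_mult_right_zero)
        also have "(LINT z|circle_measure. cauchy_kernel r (snd q) z * z powi (- n)) =
          2 * pi * (of_bool (s - fst q > 0 \<and> n \<ge> 1) - of_bool (s - fst q < 0 \<and> n \<le> 0)) * r powi (- n) * snd q powi (- n)"
          unfolding integral_cauchy_kernel_circle[OF r(1,2) \<eta>] r(3,4) by simp
        also have "r powi (- n) = exp (- (of_int n * (s - fst q)))"
          using exp_power_int[of "s - fst q" "- n"] by (simp add: r_def)
        finally show ?case by (simp add: cauchy_symbol_def mult_ac)
      qed
      show "(\<lambda>s. LINT z|circle_measure. J (s, z) q) \<in> borel_measurable lborel"
        using cylinder.integrable_fst'[OF J] by simp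
    qed measurable
    also have "\<dots> = 2 * pi * (U q * snd q powi (- n)) * (LINT s|lborel. of_real (G s * cauchy_symbol n (s - fst q)))"
      by (rule Bochner_Integration.integral_mult_right_zero)
    finally show ?thesis by (simp only: integral_complex_of_real mult.assoc)
  qed
  have drop: "integrable cylinder_measure f" if "integrable cylinder_measure (\<lambda>p. complex_of_real (2 * pi) * f p)" for f :: "real \<times> complex \<Rightarrow> complex"
    using integrable_mult_right[OF that, of "1 / (2 * pi)"] by simp
  have iA: "integrable cylinder_measure (\<lambda>p. 2 * pi * (cauchy_potential U p * of_real (G (fst p)) * snd p powi (- n)))"
    using cylinder2.integrable_fst[OF int_J] unfolding left .
  then show ?A by (rule drop)
  have AE_right: "AE q in cylinder_measure. (LINT p|cylinder_measure. J p q) =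
      2 * pi * (U q * snd q powi (- n) * of_real (LINT s|lborel. G s * cauchy_symbol n (s - fst q)))"
    using cylinder2.AE_integrable_snd[OF int_J] AE_space by eventually_elim (rule right)
  have meas_B: "(\<lambda>q. 2 * pi * (U q * snd q powi (- n) * of_real (LINT s|lborel. G s * cauchy_symbol n (s - fst q)))) \<in> borel_measurable cylinder_measure"
    by measurable
  have iB: "integrable cylinder_measure (\<lambda>q. 2 * pi * (U q * snd q powi (- n) * of_real (LINT s|lborel. G s * cauchy_symbol n (s - fst q))))"
    by (rule integrable_cong_AE_imp[OF cylinder2.integrable_snd[OF int_J] meas_B]) (use AE_right in \<open>eventually_elim; simp\<close>)
  then show ?B by (rule drop)
  have "(LINT p|cylinder_measure. 2 * pi * (cauchy_potential U p * of_real (G (fst p)) * snd p powi (- n))) =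
     (LINT q|cylinder_measure. (LINT p|cylinder_measure. J p q))"
    unfolding left[symmetric] by (rule cylinder2.Fubini_integral[OF int_J, symmetric])
  also have "\<dots> = (LINT q|cylinder_measure. 2 * pi * (U q * snd q powi (- n) * of_real (LINT s|lborel. G s * cauchy_symbol n (s - fst q))))"
    by (rule integral_cong_AE) (use cylinder2.integrable_snd[OF int_J] meas_B AE_right in auto)
  finally show ?C by (simp only: Bochner_Integration.integral_mult_right_zero) simp
qed

text \<open>The weight with which a source at time \<sigma> enters the pairing of \<open>G\<close>
  with the solution of \<open>(d/ds + D) v = -U\<close> that vanishes after \<open>L\<close>. At
  time \<open>s\<close> that solution sees only the sources with \<sigma> > s, with factor
  \<open>e^(n (\<sigma> - s))\<close>.\<close>

definition exit_profile :: "int \<Rightarrow> (real \<Rightarrow> real) \<Rightarrow> real \<Rightarrow> real" where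
  "exit_profile n G \<sigma> = (LINT s|lborel. G s * (of_bool (s < \<sigma>) * exp (of_int n * (\<sigma> - s))))"

text \<open>The difference solves \<open>(d/ds + D) v = -U\<close> and vanishes for
  \<open>s > L\<close>, so truncating at \<open>L\<close> loses nothing; truncating at
  \<open>\<epsilon>\<close> keeps the power series bounded.\<close>

definition potential_jump :: "real \<Rightarrow> real \<Rightarrow> (real \<times> complex \<Rightarrow> complex) \<Rightarrow> real \<times> complex \<Rightarrow> complex" where
  "potential_jump \<epsilon> L U p = of_real (indicator {\<epsilon>..L} (fst p)) *
     (power_part U (of_real (exp (- fst p)) * snd p) - cauchy_potential U p)"

text \<open>For \<open>n \<ge> 1\<close> the power series contributes
  \<open>e^(n (\<sigma> - s))\<close> at all times and the potential removes it for
  \<open>s > \<sigma>\<close>; for \<open>n \<le> 0\<close> the potential alone contributes, for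
  \<open>s < \<sigma>\<close>. Both signs leave the same expression.\<close>

lemma potential_jump_moment:
  assumes L: "L \<ge> 0" and U: "U \<in> controls L \<omega>" and C: "\<And>n. norm (moment U n) \<le> C"
    and \<epsilon>: "\<epsilon> > 0" and G: "test_function \<epsilon> L G"
  shows "integrable cylinder_measure (\<lambda>p. potential_jump \<epsilon> L U p * of_real (G (fst p)) * snd p powi (- n))"
    and "integrable cylinder_measure (\<lambda>q. U q * snd q powi (- n) * of_real (exit_profile n G (fst q)))"
    and "(LINT p|cylinder_measure. potential_jump \<epsilon> L U p * of_real (G (fst p)) * snd p powi (- n)) =
      (LINT q|cylinder_measure. U q * snd q powi (- n) * of_real (exit_profile n G (fst q)))"
proof -
  have G0: "test_function 0 L G" using G \<epsilon> by (auto simp: test_function_def)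
  have G_meas [measurable]: "G \<in> borel_measurable borel" using G by (simp add: test_function_def)
  note U_meas [measurable] = controls_L2D(1)[OF U]
  define I where "I = (LINT s|lborel. G s * exp (- (of_int n * s)))"
  define F where "F p = power_part U (of_real (exp (- fst p)) * snd p) * of_real (G (fst p)) * snd p powi (- n)" for p
  define Q where "Q p = cauchy_potential U p * of_real (G (fst p)) * snd p powi (- n)" for p
  \<comment> \<open>The moment of the power series, written as an integral over \<open>U\<close> so
    that it can be compared with the potential pointwise in \<open>q\<close>.\<close>
  define P where "P q = of_bool (n \<ge> 1) * (U q * (of_real (exp (of_int \<bar>n\<bar> * fst q)) * snd q powi (- n))) * of_real I" for q
  define R where "R q = U q * snd q powi (- n) * of_real (LINT s|lborel. G s * cauchy_symbol n (s - fst q))" for q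
  note pF = power_part_moment[OF C \<epsilon> G, of n, folded F_def I_def]
  note pQ = cauchy_potential_moment[OF L U G0, of n, folded Q_def R_def]
  have eq: "potential_jump \<epsilon> L U p * of_real (G (fst p)) * snd p powi (- n) = F p - Q p" for p
    using test_function_zero[OF G, of "fst p"]
    by (cases "fst p \<in> {\<epsilon>..L}") (auto simp: potential_jump_def F_def Q_def left_diff_distrib)
  show "integrable cylinder_measure (\<lambda>p. potential_jump \<epsilon> L U p * of_real (G (fst p)) * snd p powi (- n))"
    unfolding eq using pF(1) pQ(1) by (rule Bochner_Integration.integrable_diff)
  have int_w: "integrable cylinder_measure (\<lambda>q. U q * (of_real (exp (of_int \<bar>n\<bar> * fst q)) * snd q powi (- n)))"
  proof (rule controls_integrable_weighted[OF U])
    fix s z assume "s \<in> {0..L}" "z \<in> sphere (0 :: complex) 1"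
    then show "norm (complex_of_real (exp (of_int \<bar>n\<bar> * fst (s, z))) * snd (s, z) powi (- n)) \<le> exp (\<bar>of_int \<bar>n\<bar>\<bar> * (\<bar>0\<bar> + \<bar>L\<bar>))"
      using exp_linear_bound[of s 0 L "of_int \<bar>n\<bar>"] norm_powi_sphere[of z "-n"] by (simp add: norm_mult)
  qed measurable
  have P_int: "integrable cylinder_measure P"
    unfolding P_def by (intro integrable_mult_left integrable_mult_right int_w)
  have "(LINT q|cylinder_measure. P q) = of_bool (n \<ge> 1) * moment U n * of_real I"
    unfolding P_def moment_def
    by (simp only: Bochner_Integration.integral_mult_left_zero Bochner_Integration.integral_mult_right_zero)
       (simp add: split_beta' mult.assoc)
  then have P_F: "(LINT q|cylinder_measure. P q) = (LINT p|cylinder_measure. F p)" using pF(2) by simp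
  have PR: "P q - R q = U q * snd q powi (- n) * of_real (exit_profile n G (fst q))" for q
  proof -
    let ?\<sigma> = "fst q"
    have ii: "integrable lborel (\<lambda>s. G s * h s)" if "h \<in> borel_measurable borel" "\<And>s. s \<in> {\<epsilon>..L} \<Longrightarrow> \<bar>h s\<bar> \<le> exp (\<bar>of_int n\<bar> * \<bar>?\<sigma>\<bar>) * exp (\<bar>of_int n\<bar> * (\<bar>\<epsilon>\<bar> + \<bar>L\<bar>))" for h
      using test_function_integrable[OF G that] .
    have e: "exp (of_int n * ?\<sigma>) * exp (- (of_int n * s)) \<le> exp (\<bar>of_int n\<bar> * \<bar>?\<sigma>\<bar>) * exp (\<bar>of_int n\<bar> * (\<bar>\<epsilon>\<bar> + \<bar>L\<bar>))" if "s \<in> {\<epsilon>..L}" for s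
    proof (rule mult_mono)
      show "exp (of_int n * ?\<sigma>) \<le> exp (\<bar>of_int n\<bar> * \<bar>?\<sigma>\<bar>)" by (metis abs_ge_self abs_mult exp_le_cancel_iff)
      show "exp (- (of_int n * s)) \<le> exp (\<bar>of_int n\<bar> * (\<bar>\<epsilon>\<bar> + \<bar>L\<bar>))"
        using exp_linear_bound[OF that, of "- of_int n"] by simp
    qed auto
    have sym: "cauchy_symbol n (s - ?\<sigma>) = (of_bool (s > ?\<sigma> \<and> n \<ge> 1) - of_bool (s < ?\<sigma> \<and> n \<le> 0)) * (exp (of_int n * ?\<sigma>) * exp (- (of_int n * s)))" for s
      by (simp add: cauchy_symbol_def exp_add[symmetric] algebra_simps)
    have ex: "exp (of_int n * (?\<sigma> - s)) = exp (of_int n * ?\<sigma>) * exp (- (of_int n * s))" for s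
      by (simp add: exp_add[symmetric] algebra_simps)
    have "of_bool (n \<ge> 1) * exp (of_int n * ?\<sigma>) * I - (LINT s|lborel. G s * cauchy_symbol n (s - ?\<sigma>)) =
       (LINT s|lborel. G s * (of_bool (n \<ge> 1) * (exp (of_int n * ?\<sigma>) * exp (- (of_int n * s))))) - (LINT s|lborel. G s * cauchy_symbol n (s - ?\<sigma>))"
    proof -
      have "(\<lambda>s. G s * (of_bool (n \<ge> 1) * (exp (of_int n * ?\<sigma>) * exp (- (of_int n * s))))) =
        (\<lambda>s. of_bool (n \<ge> 1) * exp (of_int n * ?\<sigma>) * (G s * exp (- (of_int n * s))))"
        by (simp add: fun_eq_iff mult_ac)
      then show ?thesis by (simp add: I_def)
    qed
    also have "\<dots> = (LINT s|lborel. G s * (of_bool (n \<ge> 1) * (exp (of_int n * ?\<sigma>) * exp (- (of_int n * s)))) - G s * cauchy_symbol n (s - ?\<sigma>))"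
      by (rule Bochner_Integration.integral_diff[symmetric]; rule ii)
         (use e in \<open>auto simp: sym abs_mult\<close>)
    also have "\<dots> = exit_profile n G ?\<sigma>"
      unfolding exit_profile_def
    proof (rule integral_cong_AE)
      show "AE s in lborel. G s * (of_bool (n \<ge> 1) * (exp (of_int n * ?\<sigma>) * exp (- (of_int n * s)))) - G s * cauchy_symbol n (s - ?\<sigma>) =
        G s * (of_bool (s < ?\<sigma>) * exp (of_int n * (?\<sigma> - s)))"
        using AE_lborel_singleton[of ?\<sigma>]
        by eventually_elim (auto simp: sym ex of_bool_def)
    qed measurable
    finally have main: "of_bool (n \<ge> 1) * exp (of_int n * ?\<sigma>) * I - (LINT s|lborel. G s * cauchy_symbol n (s - ?\<sigma>)) = exit_profile n G ?\<sigma>" .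
    have "of_bool (n \<ge> 1) * exp (of_int \<bar>n\<bar> * ?\<sigma>) = of_bool (n \<ge> 1) * exp (of_int n * ?\<sigma>)" by (cases "n \<ge> 1") auto
    then have "P q = U q * snd q powi (- n) * of_real (of_bool (n \<ge> 1) * exp (of_int n * ?\<sigma>) * I)"
      unfolding P_def by (cases "n \<ge> 1") auto
    then show ?thesis
      unfolding R_def main[symmetric] of_real_diff right_diff_distrib by simp
  qed
  show "integrable cylinder_measure (\<lambda>q. U q * snd q powi (- n) * of_real (exit_profile n G (fst q)))"
    using Bochner_Integration.integrable_diff[OF P_int pQ(2)] unfolding PR .
  have "(LINT p|cylinder_measure. F p - Q p) = (LINT q|cylinder_measure. P q - R q)"
    using Bochner_Integration.integral_diff[OF pF(1) pQ(1)] Bochner_Integration.integral_diff[OF P_int pQ(2)] pQ(3) P_F by simp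
  then show "(LINT p|cylinder_measure. potential_jump \<epsilon> L U p * of_real (G (fst p)) * snd p powi (- n)) =
      (LINT q|cylinder_measure. U q * snd q powi (- n) * of_real (exit_profile n G (fst q)))"
    unfolding eq PR .
qed

lemma measurable_potential_jump [measurable]:
  assumes [measurable]: "U \<in> borel_measurable cylinder_measure"
  shows "potential_jump \<epsilon> L U \<in> borel_measurable cylinder_measure"
  unfolding potential_jump_def power_part_def by measurable

lemma potential_jump_L2:
  assumes L: "L \<ge> 0" and U: "U \<in> controls L \<omega>" and C: "\<And>n. norm (moment U n) \<le> C" and \<epsilon>: "\<epsilon> > 0"
  shows "potential_jump \<epsilon> L U \<in> L2 cylinder_measure"
proof -
  note U_meas [measurable] = controls_L2D(1)[OF U]
  have C0: "C \<ge> 0" using order_trans[OF norm_ge_zero C] by blast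
  define A where "A = C / (1 - exp (- \<epsilon>))"
  define P where "P p = indicator {\<epsilon>..L} (fst p) * power_part U (of_real (exp (- fst p)) * snd p)" for p
  have [measurable]: "P \<in> borel_measurable cylinder_measure" unfolding P_def power_part_def by measurable
  have P: "(norm (P (s, z)))\<^sup>2 \<le> indicator {\<epsilon>..L} s * A\<^sup>2" if z: "z \<in> sphere 0 1" for s z
  proof (cases "s \<in> {\<epsilon>..L}")
    case True
    have le: "exp (- s) \<le> exp (- \<epsilon>)" and lt: "exp (- \<epsilon>) < 1" using True \<epsilon> by auto
    have nw: "norm (of_real (exp (- s)) * z) = exp (- s)" using z by (simp add: norm_mult)
    have "norm (power_part U (of_real (exp (- s)) * z)) \<le> C / (1 - exp (- s))"
      using power_part_sums(2)[OF C, of "of_real (exp (- s)) * z"] le lt unfolding nw by linarith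
    also have "\<dots> \<le> A" unfolding A_def using le lt C0 by (intro divide_left_mono) auto
    finally show ?thesis using True by (simp add: P_def power_mono)
  qed (simp add: P_def)
  have "integrable cylinder_measure (\<lambda>p. (norm (P p))\<^sup>2)"
  proof (rule Bochner_Integration.integrable_bound[OF integrable_strip])
    show "AE p in cylinder_measure. norm ((norm (P p))\<^sup>2) \<le> norm (case p of (s, z) \<Rightarrow> indicator {\<epsilon>..L} s * A\<^sup>2)"
    proof (rule AE_I2)
      fix p assume "p \<in> space cylinder_measure"
      then obtain s z where p: "p = (s, z)" "z \<in> sphere 0 1" by (auto simp: space_pair_measure)
      from P[OF p(2), of s] show "norm ((norm (P p))\<^sup>2) \<le> norm (case p of (s, z) \<Rightarrow> indicator {\<epsilon>..L} s * A\<^sup>2)"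
        by (simp add: p(1))
    qed
  qed measurable
  then have P_L2: "P \<in> L2 cylinder_measure" by (simp add: L2_def)
  have B_L2: "(\<lambda>p. indicator {0..L} (fst p) * cauchy_potential U p) \<in> L2 cylinder_measure"
    using cauchy_potential_square_integrable[OF L U] by (simp add: L2_def)
  have "(\<lambda>p. P p + - indicator {\<epsilon>..L} (fst p) * (indicator {0..L} (fst p) * cauchy_potential U p)) \<in> L2 cylinder_measure"
    by (intro L2_add P_L2 L2_mult_bounded[OF B_L2, where B = 1]) (auto simp: indicator_def)
  moreover have "(\<lambda>p. P p + - indicator {\<epsilon>..L} (fst p) * (indicator {0..L} (fst p) * cauchy_potential U p)) = potential_jump \<epsilon> L U"
    using \<epsilon> by (auto simp: fun_eq_iff P_def potential_jump_def indicator_def)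
  ultimately show ?thesis by simp
qed

lemma potential_jump_outside:
  assumes U: "U \<in> controls L \<omega>" and \<omega>: "\<omega> \<subseteq> K" "K \<subseteq> sphere 0 1" "closed K"
    and C: "\<And>n. norm (moment U n) \<le> C" and L: "L \<ge> 0" and \<epsilon>: "\<epsilon> > 0"
    and p: "p \<in> space cylinder_measure" "snd p \<notin> K"
  shows "potential_jump \<epsilon> L U p = 0"
proof (cases "fst p \<in> {\<epsilon>..L}")
  case True
  then have "cauchy_potential U (fst p, snd p) = power_part U (of_real (exp (- fst p)) * snd p)"
    using p \<epsilon> by (intro cauchy_potential_eq_power_part[OF U \<omega> C L]) (auto simp: space_pair_measure)
  then show ?thesis by (simp add: potential_jump_def)
qed (simp add: potential_jump_def)

section \<open>Cut-off functions\<close>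

text \<open>A truncated parabola, normalised by the integral \<open>(b - a)^3 / 6\<close> of
  \<open>(s - a) (b - s)\<close>. The cut-off is thus continuously differentiable with bounded
  piecewise second derivative, which is enough for a control in L2.\<close>

definition bump :: "real \<Rightarrow> real \<Rightarrow> real \<Rightarrow> real" where
  "bump a b s = 6 / (b - a) ^ 3 * max 0 ((s - a) * (b - s))"

definition bump_deriv :: "real \<Rightarrow> real \<Rightarrow> real \<Rightarrow> real" where
  "bump_deriv a b s = indicator {a..b} s * (6 / (b - a) ^ 3 * (a + b - 2 * s))"

definition cutoff :: "real \<Rightarrow> real \<Rightarrow> real \<Rightarrow> real" where
  "cutoff a b s = 1 - integral {a..s} (bump a b)"

text \<open>The weight against which \<open>H\<close> is integrated in the moments of \<open>2\<chi>'\<partial>\<^sub>sd + \<chi>''d\<close>, after exchanging the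
  integral in \<open>d\<close> with that over \<open>s\<close>; here \<open>bump = -\<chi>'\<close> and \<open>m = |n|\<close>.\<close>

definition correction_weight :: "real \<Rightarrow> real \<Rightarrow> real \<Rightarrow> real \<Rightarrow> real \<Rightarrow> real" where
  "correction_weight a b L m s = indicator {a..L} s *
     (bump a b s * exp (m * s) - (LINT r|lborel. bump_deriv a b r * (of_bool (r < s) * exp (m * r))) / 2)"

context
  fixes a b :: real
  assumes ab: "a < b"
begin

lemma bump_nonneg: "bump a b s \<ge> 0"
  using ab by (simp add: bump_def)

lemma bump_eq: "s \<in> {a..b} \<Longrightarrow> bump a b s = 6 / (b - a) ^ 3 * ((s - a) * (b - s))"
  by (simp add: bump_def max_def)

lemma bump_zero: "s \<notin> {a<..<b} \<Longrightarrow> bump a b s = 0"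
proof -
  assume "s \<notin> {a<..<b}"
  then consider "s \<le> a" | "b \<le> s" by fastforce
  then have "(s - a) * (b - s) \<le> 0"
  proof cases
    case 1
    then show ?thesis using ab by (intro mult_nonpos_nonneg) auto
  next
    case 2
    then show ?thesis using ab by (intro mult_nonneg_nonpos) auto
  qed
  then show "bump a b s = 0" by (simp add: bump_def)
qed

lemma continuous_bump: "continuous_on S (bump a b)"
  unfolding bump_def by (intro continuous_intros)

lemma bump_test_function: "test_function a b (bump a b)"
  unfolding test_function_def
proof (intro conjI allI impI)
  show "bump a b \<in> borel_measurable borel" by (intro borel_measurable_continuous_onI continuous_bump)
  have "bounded (bump a b ` {a..b})"
    by (intro compact_imp_bounded compact_continuous_image continuous_bump) auto
  then obtain C where "\<forall>y\<in>bump a b ` {a..b}. norm y \<le> C" unfolding bounded_iff by blast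
  then have C: "\<bar>bump a b s\<bar> \<le> C" if "s \<in> {a..b}" for s using that by auto
  have "\<bar>bump a b s\<bar> \<le> max C 0" for s
  proof (cases "s \<in> {a..b}")
    case True
    then show ?thesis using C[of s] by linarith
  next
    case False
    then have "bump a b s = 0" by (intro bump_zero) auto
    then show ?thesis by simp
  qed
  then show "\<exists>C. \<forall>s. \<bar>bump a b s\<bar> \<le> C" by blast
qed (rule bump_zero, auto)

lemma bump_deriv_test_function: "test_function a b (bump_deriv a b)"
  unfolding test_function_def
proof (intro conjI allI impI)
  show "bump_deriv a b \<in> borel_measurable borel" unfolding bump_deriv_def by measurable
  have "\<bar>bump_deriv a b s\<bar> \<le> 6 / (b - a) ^ 3 * (b - a)" for s
  proof (cases "s \<in> {a..b}")
    case True
    then have "\<bar>a + b - 2 * s\<bar> \<le> b - a" by auto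
    then show ?thesis using True ab by (simp add: bump_deriv_def abs_mult mult_left_mono divide_right_mono)
  qed (use ab in \<open>simp add: bump_deriv_def\<close>)
  then show "\<exists>C. \<forall>s. \<bar>bump_deriv a b s\<bar> \<le> C" by blast
qed (simp add: bump_deriv_def)

lemma integral_bump: "integral {a..b} (bump a b) = 1"
proof -
  define k where "k = 6 / (b - a) ^ 3"
  let ?F = "\<lambda>s. k * ((a + b) * s\<^sup>2 / 2 - s ^ 3 / 3 - a * b * s)"
  have "((\<lambda>s. k * ((s - a) * (b - s))) has_integral (?F b - ?F a)) {a..b}"
  proof (rule fundamental_theorem_of_calculus)
    fix s assume "s \<in> {a..b}"
    show "(?F has_vector_derivative k * ((s - a) * (b - s))) (at s within {a..b})"
      unfolding has_real_derivative_iff_has_vector_derivative[symmetric]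
      by (rule derivative_eq_intros refl | simp add: algebra_simps power2_eq_square)+
  qed (use ab in auto)
  then have "(bump a b has_integral (?F b - ?F a)) {a..b}"
    by (rule has_integral_cong[THEN iffD1, rotated]) (simp add: bump_eq k_def)
  moreover have "?F b - ?F a = k * ((b - a) ^ 3 / 6)"
    unfolding right_diff_distrib[symmetric]
    by (rule arg_cong[where f = "\<lambda>t. k * t"]) (simp add: field_simps power2_eq_square power3_eq_cube)
  ultimately show ?thesis using ab by (simp add: integral_unique k_def)
qed

lemma bump_integrable: "(\<lambda>r. exp (m * r) * bump a b r) integrable_on {x..y}"
  by (intro integrable_continuous_interval continuous_intros continuous_bump)

lemma bump_integrable': "bump a b integrable_on {x..y}"
  using bump_integrable[of 0] by simp

lemma integral_bump_beyond:
  assumes "s \<ge> b"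
  shows "integral {a..s} (\<lambda>r. exp (m * r) * bump a b r) = integral {a..b} (\<lambda>r. exp (m * r) * bump a b r)"
proof -
  have "integral {b..s} (\<lambda>r. exp (m * r) * bump a b r) = integral {b..s} (\<lambda>r. 0)"
    by (intro Henstock_Kurzweil_Integration.integral_cong) (simp add: bump_zero)
  then show ?thesis
    using Henstock_Kurzweil_Integration.integral_combine[of a b s "\<lambda>r. exp (m * r) * bump a b r"] bump_integrable ab assms by simp
qed

lemma cutoff_below: "s \<le> a \<Longrightarrow> cutoff a b s = 1"
  by (cases "s = a") (simp_all add: cutoff_def)

lemma cutoff_beyond: "s \<ge> b \<Longrightarrow> cutoff a b s = 0"
  using integral_bump_beyond[of s 0] by (simp add: cutoff_def integral_bump)

lemma cutoff_mono: "s \<le> t \<Longrightarrow> cutoff a b t \<le> cutoff a b s"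
  unfolding cutoff_def
  by (intro diff_left_mono integral_subset_le bump_integrable') (auto simp: bump_nonneg)

lemma cutoff_bounds: "0 \<le> cutoff a b s" "cutoff a b s \<le> 1"
proof -
  show "cutoff a b s \<le> 1"
    using cutoff_mono[of "min s a" s] cutoff_below[of "min s a"] by simp
  show "0 \<le> cutoff a b s"
    using cutoff_mono[of s "max s b"] cutoff_beyond[of "max s b"] by simp
qed

lemma cutoff_measurable: "cutoff a b \<in> borel_measurable borel"
proof -
  have "(\<lambda>s. - cutoff a b s) \<in> borel_measurable borel"
    by (rule borel_measurable_mono) (simp add: mono_def cutoff_mono)
  then have "(\<lambda>s. - (- cutoff a b s)) \<in> borel_measurable borel" by measurable
  then show ?thesis by simp
qed

text \<open>Integration by parts against \<open>e^(m r)\<close>; the boundary term at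
  \<open>a\<close> vanishes with \<open>bump\<close>.\<close>

lemma integral_bump_deriv:
  assumes s: "s \<ge> a"
  shows "(LINT r|lborel. bump_deriv a b r * (of_bool (r < s) * exp (m * r))) =
    exp (m * s) * bump a b s - m * integral {a..s} (\<lambda>r. exp (m * r) * bump a b r)"
proof -
  \<comment> \<open>Up to this point \<open>bump\<close> is a polynomial, so the kink at
    \<open>b\<close> is never crossed.\<close>
  define t where "t = min s b"
  have t: "a \<le> t" "t \<le> b" using s ab by (auto simp: t_def)
  define k where "k = 6 / (b - a) ^ 3"
  let ?p = "\<lambda>r. k * ((r - a) * (b - r))"
  let ?h = "\<lambda>r. exp (m * r) * (k * (a + b - 2 * r)) + m * (exp (m * r) * ?p r)"
  have "(LINT r|lborel. bump_deriv a b r * (of_bool (r < s) * exp (m * r))) =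
    (LINT r|lborel. indicator {a..t} r *\<^sub>R (exp (m * r) * (k * (a + b - 2 * r))))"
  proof (rule integral_cong_AE)
    show "AE r in lborel. bump_deriv a b r * (of_bool (r < s) * exp (m * r)) = indicator {a..t} r *\<^sub>R (exp (m * r) * (k * (a + b - 2 * r)))"
      using AE_lborel_singleton[of s]
      by eventually_elim (auto simp: bump_deriv_def k_def t_def indicator_def)
    show "(\<lambda>r. bump_deriv a b r * (of_bool (r < s) * exp (m * r))) \<in> borel_measurable lborel"
      unfolding bump_deriv_def by measurable
  qed measurable
  also have "\<dots> = integral {a..t} (\<lambda>r. exp (m * r) * (k * (a + b - 2 * r)))"
    unfolding set_lebesgue_integral_def[symmetric]
    by (intro set_borel_integral_eq_integral borel_integrable_atLeastAtMost') (intro continuous_intros)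
  also have "\<dots> = integral {a..t} ?h - integral {a..t} (\<lambda>r. m * (exp (m * r) * ?p r))"
    by (subst Henstock_Kurzweil_Integration.integral_diff[symmetric])
       (auto intro!: integrable_continuous_interval continuous_intros)
  also have "integral {a..t} ?h = exp (m * t) * ?p t"
  proof (rule integral_unique)
    have "(?h has_integral (exp (m * t) * ?p t - exp (m * a) * ?p a)) {a..t}"
    proof (rule fundamental_theorem_of_calculus[OF t(1)])
      fix r assume "r \<in> {a..t}"
      show "((\<lambda>r. exp (m * r) * ?p r) has_vector_derivative ?h r) (at r within {a..t})"
        unfolding has_real_derivative_iff_has_vector_derivative[symmetric]
        by (rule derivative_eq_intros refl | simp add: algebra_simps)+
    qed
    then show "(?h has_integral (exp (m * t) * ?p t)) {a..t}" by simp
  qed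
  also have "integral {a..t} (\<lambda>r. m * (exp (m * r) * ?p r)) = m * integral {a..t} (\<lambda>r. exp (m * r) * bump a b r)"
  proof -
    have "integral {a..t} (\<lambda>r. exp (m * r) * ?p r) = integral {a..t} (\<lambda>r. exp (m * r) * bump a b r)"
      using t by (intro Henstock_Kurzweil_Integration.integral_cong) (simp add: bump_eq k_def)
    then show ?thesis by simp
  qed
  also have "exp (m * t) * ?p t = exp (m * s) * bump a b s"
    using s t by (cases "s \<le> b") (auto simp: t_def k_def bump_eq bump_zero)
  also have "integral {a..t} (\<lambda>r. exp (m * r) * bump a b r) = integral {a..s} (\<lambda>r. exp (m * r) * bump a b r)"
    using integral_bump_beyond[of s m] by (cases "s \<le> b") (auto simp: t_def)
  finally show ?thesis .
qed

text \<open>Integration by parts trades the discontinuous \<open>bump_deriv\<close> for a continuous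
  expression, as the fundamental theorem of calculus will require.\<close>

lemma correction_weight_eq:
  assumes "s \<in> {a..L}"
  shows "correction_weight a b L m s =
    (exp (m * s) * bump a b s + m * integral {a..s} (\<lambda>r. exp (m * r) * bump a b r)) / 2"
  using assms integral_bump_deriv[of s m] by (simp add: correction_weight_def field_simps)

lemma continuous_correction_weight: "continuous_on {a..L} (correction_weight a b L m)"
proof -
  have "continuous_on {a..L} (\<lambda>s. (exp (m * s) * bump a b s + m * integral {a..s} (\<lambda>r. exp (m * r) * bump a b r)) / 2)"
    by (intro continuous_intros continuous_bump indefinite_integral_continuous_1 bump_integrable) auto
  then show ?thesis by (rule continuous_on_cong[THEN iffD1, rotated -1]) (simp_all add: correction_weight_eq)
qed

lemma correction_weight_test_function: "test_function a L (correction_weight a b L m)"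
  unfolding test_function_def
proof (intro conjI allI impI)
  have [measurable]: "bump a b \<in> borel_measurable borel" "bump_deriv a b \<in> borel_measurable borel"
    using bump_test_function bump_deriv_test_function by (simp_all add: test_function_def)
  show "correction_weight a b L m \<in> borel_measurable borel"
    unfolding correction_weight_def by measurable
  have "bounded (correction_weight a b L m ` {a..L})"
    by (intro compact_imp_bounded compact_continuous_image continuous_correction_weight) auto
  then obtain C where "\<forall>y\<in>correction_weight a b L m ` {a..L}. norm y \<le> C" unfolding bounded_iff by blast
  then have C: "\<bar>correction_weight a b L m s\<bar> \<le> C" if "s \<in> {a..L}" for s using that by auto
  have "\<bar>correction_weight a b L m s\<bar> \<le> max C 0" for s
  proof (cases "s \<in> {a..L}")
    case True
    then show ?thesis using C[of s] by linarith
  next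
    case False
    then have "correction_weight a b L m s = 0" by (simp add: correction_weight_def)
    then show ?thesis by simp
  qed
  then show "\<exists>C. \<forall>s. \<bar>correction_weight a b L m s\<bar> \<le> C" by blast
qed (simp add: correction_weight_def)

text \<open>With \<open>X(s) = \<integral>\<^sub>a\<^sup>s e\<^sup>m\<^sup>r bump(r) dr\<close>, the integrand \<open>2 cosh(m(\<rho> - s)) correction_weight(s)\<close> is the derivative of
  \<open>- sinh(m(\<rho> - s)) X(s) - e\<^sup>m\<^sup>\<rho> cutoff(s)\<close>.\<close>

lemma exit_profile_correction_weight:
  assumes \<rho>: "\<rho> \<le> L"
  shows "exit_profile n (correction_weight a b L \<bar>of_int n\<bar>) \<rho> + exit_profile (- n) (correction_weight a b L \<bar>of_int n\<bar>) \<rho> =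
    exp (\<bar>of_int n\<bar> * \<rho>) * (1 - cutoff a b \<rho>)"
proof -
  define m :: real where "m = \<bar>of_int n\<bar>"
  let ?G = "correction_weight a b L m"
  note G = correction_weight_test_function[of L m]
  have int: "integrable lborel (\<lambda>s. ?G s * (of_bool (s < \<rho>) * exp (of_int k * (\<rho> - s))))" for k
  proof (rule test_function_integrable[OF G])
    fix s assume "s \<in> {a..L}"
    from exp_linear_bound[OF this, of "- of_int k"]
    have "exp (of_int k * \<rho>) * exp (- of_int k * s) \<le> exp (of_int k * \<rho>) * exp (\<bar>- of_int k\<bar> * (\<bar>a\<bar> + \<bar>L\<bar>))"
      by (intro mult_left_mono) auto
    moreover have "exp (of_int k * (\<rho> - s)) = exp (of_int k * \<rho>) * exp (- of_int k * s)"
      by (simp add: exp_add[symmetric] algebra_simps)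
    ultimately show "\<bar>of_bool (s < \<rho>) * exp (of_int k * (\<rho> - s))\<bar> \<le> exp (of_int k * \<rho>) * exp (\<bar>- of_int k\<bar> * (\<bar>a\<bar> + \<bar>L\<bar>))"
      by (simp add: of_bool_def)
  qed measurable
  have "exit_profile n ?G \<rho> + exit_profile (- n) ?G \<rho> =
    (LINT s|lborel. ?G s * (of_bool (s < \<rho>) * exp (of_int n * (\<rho> - s))) + ?G s * (of_bool (s < \<rho>) * exp (of_int (- n) * (\<rho> - s))))"
    unfolding exit_profile_def by (rule Bochner_Integration.integral_add[symmetric, OF int int])
  also have "\<dots> = (LINT s|lborel. indicator {a..\<rho>} s *\<^sub>R (2 * cosh (m * (\<rho> - s)) * ?G s))"
  proof (rule integral_cong_AE)
    have ch: "exp (of_int n * x) + exp (of_int (- n) * x) = 2 * cosh (m * x)" for x :: real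
      by (cases "n \<ge> 0") (simp_all add: m_def cosh_field_def)
    show "AE s in lborel. ?G s * (of_bool (s < \<rho>) * exp (of_int n * (\<rho> - s))) + ?G s * (of_bool (s < \<rho>) * exp (of_int (- n) * (\<rho> - s))) =
      indicator {a..\<rho>} s *\<^sub>R (2 * cosh (m * (\<rho> - s)) * ?G s)"
      using AE_lborel_singleton[of \<rho>]
    proof eventually_elim
      case (elim s)
      show ?case
      proof (cases "s \<in> {a..\<rho>}")
        case True
        then show ?thesis using elim by (simp only: ch[symmetric]) (simp add: ring_distribs mult_ac)
      next
        case False
        then show ?thesis using test_function_zero[OF G, of s] by (cases "s < a") auto
      qed
    qed
    have [measurable]: "?G \<in> borel_measurable borel" using G by (simp add: test_function_def)
    show "(\<lambda>s. ?G s * (of_bool (s < \<rho>) * exp (of_int n * (\<rho> - s))) + ?G s * (of_bool (s < \<rho>) * exp (of_int (- n) * (\<rho> - s)))) \<in> borel_measurable lborel"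
      by measurable
    have [measurable]: "(\<lambda>s. cosh (m * (\<rho> - s))) \<in> borel_measurable borel"
      by (intro borel_measurable_continuous_onI continuous_intros)
    show "(\<lambda>s. indicator {a..\<rho>} s *\<^sub>R (2 * cosh (m * (\<rho> - s)) * ?G s)) \<in> borel_measurable lborel"
      by measurable
  qed
  also have "\<dots> = exp (m * \<rho>) * (1 - cutoff a b \<rho>)"
  proof (cases "a \<le> \<rho>")
    case True
    define X where "X s = integral {a..s} (\<lambda>r. exp (m * r) * bump a b r)" for s
    define F where "F s = - (sinh (m * (\<rho> - s)) * X s) - exp (m * \<rho>) * cutoff a b s" for s
    have X: "(X has_real_derivative exp (m * s) * bump a b s) (at s within {a..\<rho>})" if "s \<in> {a..\<rho>}" for s
      unfolding X_def using that by (intro integral_has_real_derivative continuous_intros continuous_bump)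
    have c: "(cutoff a b has_real_derivative - bump a b s) (at s within {a..\<rho>})" if "s \<in> {a..\<rho>}" for s
    proof -
      have "((\<lambda>s. integral {a..s} (bump a b)) has_real_derivative bump a b s) (at s within {a..\<rho>})"
        using that by (intro integral_has_real_derivative continuous_bump)
      from DERIV_diff[OF DERIV_const[of 1] this] show ?thesis by (simp add: cutoff_def[abs_def])
    qed
    have "(LINT s|lborel. indicator {a..\<rho>} s *\<^sub>R (2 * cosh (m * (\<rho> - s)) * ?G s)) = F \<rho> - F a"
    proof (rule integral_FTC_Icc[OF True])
      fix s assume s: "a \<le> s" "s \<le> \<rho>"
      have "2 * cosh (m * (\<rho> - s)) * ?G s = cosh (m * (\<rho> - s)) * (exp (m * s) * bump a b s + m * X s)"
        using correction_weight_eq[of s L m] s \<rho> by (simp add: X_def)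
      also have "\<dots> = m * cosh (m * (\<rho> - s)) * X s - sinh (m * (\<rho> - s)) * (exp (m * s) * bump a b s) + exp (m * \<rho>) * bump a b s"
      proof -
        have "exp (m * \<rho>) = exp (m * s) * (cosh (m * (\<rho> - s)) + sinh (m * (\<rho> - s)))"
          by (simp add: cosh_plus_sinh exp_add[symmetric] algebra_simps)
        then show ?thesis by (simp add: algebra_simps)
      qed
      finally have G_eq: "2 * cosh (m * (\<rho> - s)) * ?G s =
        m * cosh (m * (\<rho> - s)) * X s - sinh (m * (\<rho> - s)) * (exp (m * s) * bump a b s) + exp (m * \<rho>) * bump a b s" .
      have "(F has_real_derivative 2 * cosh (m * (\<rho> - s)) * ?G s) (at s within {a..\<rho>})"
        unfolding F_def G_eq using s
        by (auto intro!: derivative_eq_intros X c simp: algebra_simps)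
      then show "(F has_vector_derivative 2 * cosh (m * (\<rho> - s)) * ?G s) (at s within {a..\<rho>})"
        by (simp add: has_real_derivative_iff_has_vector_derivative)
    next
      show "continuous_on {a..\<rho>} (\<lambda>s. 2 * cosh (m * (\<rho> - s)) * ?G s)"
        using \<rho> by (intro continuous_intros continuous_on_subset[OF continuous_correction_weight]) auto
    qed
    also have "\<dots> = exp (m * \<rho>) * (1 - cutoff a b \<rho>)"
      by (simp add: F_def X_def cutoff_below algebra_simps)
    finally show ?thesis .
  next
    case False
    then show ?thesis by (simp add: cutoff_below)
  qed
  finally show ?thesis by (simp add: m_def)
qed

end

section \<open>Controls on a shorter time interval\<close>

lemma cnj_powi_sphere: "z \<in> sphere 0 1 \<Longrightarrow> cnj (z powi n) = z powi (- n)"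
proof -
  assume "z \<in> sphere 0 1"
  have "cnj (z powi n) = cnj z powi n" by (simp add: power_int_def)
  then show "cnj (z powi n) = z powi (- n)"
    by (simp add: cnj_sphere[OF \<open>z \<in> sphere 0 1\<close>] power_int_minus power_int_inverse)
qed

lemma controls_cnj: "U \<in> controls L \<omega> \<Longrightarrow> (\<lambda>p. cnj (U p)) \<in> controls L \<omega>"
  by (auto simp: controls_def intro: L2_cnj)

text \<open>Conjugation exchanges \<open>D\<close> and \<open>-D\<close>, so results for one of the
  first-order equations give those for the other.\<close>

lemma moment_cnj: "moment (\<lambda>p. cnj (U p)) n = cnj (moment U (- n))"
  unfolding moment_def Bochner_Integration.integral_cnj[symmetric]
  by (intro Bochner_Integration.integral_cong refl) (auto simp: space_pair_measure cnj_sphere power_int_minus power_int_inverse)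

text \<open>This is \<open>H\<close> on \<open>{\<epsilon>..L}\<close>: the second summand solves
  \<open>(d/ds - D) v = -U\<close> and is obtained by conjugation instead of a second kernel. The
  indicator makes the support condition on controls hold everywhere, at the cost of a null set
  only.\<close>

definition double_jump :: "real \<Rightarrow> real \<Rightarrow> complex set \<Rightarrow> (real \<times> complex \<Rightarrow> complex) \<Rightarrow> real \<times> complex \<Rightarrow> complex" where
  "double_jump \<epsilon> L \<omega> U p =
     indicator \<omega> (snd p) * (potential_jump \<epsilon> L U p + cnj (potential_jump \<epsilon> L (\<lambda>p. cnj (U p)) p))"

lemma double_jump_zero: "fst p \<notin> {\<epsilon>..L} \<or> snd p \<notin> \<omega> \<Longrightarrow> double_jump \<epsilon> L \<omega> U p = 0"
  by (auto simp: double_jump_def potential_jump_def)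

context
  fixes U :: "real \<times> complex \<Rightarrow> complex" and \<omega> K :: "complex set" and L C \<epsilon> :: real
  assumes L: "L \<ge> 0" and U: "U \<in> controls L \<omega>" and C: "\<And>n. norm (moment U n) \<le> C" and \<epsilon>: "\<epsilon> > 0"
    and \<omega>: "\<omega> \<in> sets circle_measure" "\<omega> \<subseteq> K" "K \<subseteq> sphere 0 1" "closed K" "finite (K - \<omega>)"
begin

lemma cnj_moment_bound: "norm (moment (\<lambda>p. cnj (U p)) n) \<le> C"
  using C by (simp add: moment_cnj)

lemma double_jump_measurable [measurable]: "double_jump \<epsilon> L \<omega> U \<in> borel_measurable cylinder_measure"
proof -
  note [measurable] = controls_L2D(1)[OF U] \<omega>(1) measurable_potential_jump[OF controls_L2D(1)[OF U]]
    measurable_potential_jump[OF controls_L2D(1)[OF controls_cnj[OF U]]]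
  show ?thesis unfolding double_jump_def by measurable
qed

text \<open>Off \<open>K\<close> both jumps vanish by unique continuation, on \<omega> the indicator
  is 1, and the finite set \<open>K - \<omega>\<close> is null.\<close>

lemma double_jump_AE:
  "AE p in cylinder_measure. double_jump \<epsilon> L \<omega> U p = potential_jump \<epsilon> L U p + cnj (potential_jump \<epsilon> L (\<lambda>p. cnj (U p)) p)"
proof -
  have "AE z in circle_measure. z \<notin> K - \<omega>"
  proof -
    have "AE z in circle_measure. \<forall>\<zeta>\<in>K - \<omega>. z \<noteq> \<zeta>"
      using \<omega>(5) by (intro AE_finite_allI AE_circle_neq)
    then show ?thesis by eventually_elim auto
  qed
  then have "AE p in cylinder_measure. snd p \<notin> K - \<omega>"
  proof (intro cylinder.AE_pair_measure)
    have [measurable]: "K - \<omega> \<in> sets circle_measure"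
    proof (rule sets.Diff[OF _ \<omega>(1)])
      show "K \<in> sets circle_measure"
        using \<omega>(3,4) by (auto simp: sets_circle_measure sets_restrict_space intro!: image_eqI[of _ _ K])
    qed
    show "{p \<in> space cylinder_measure. snd p \<notin> K - \<omega>} \<in> sets cylinder_measure" by measurable
  qed simp
  then show ?thesis
    using AE_space
  proof eventually_elim
    case (elim p)
    show ?case
    proof (cases "snd p \<in> \<omega>")
      case True
      then show ?thesis by (simp add: double_jump_def)
    next
      case False
      then have "snd p \<notin> K" using elim by simp
      then show ?thesis
        using potential_jump_outside[OF U \<omega>(2-4) C L \<epsilon>] potential_jump_outside[OF controls_cnj[OF U] \<omega>(2-4) cnj_moment_bound L \<epsilon>] elim
        by (simp add: double_jump_def)
    qed
  qed
qed

lemma double_jump_L2: "double_jump \<epsilon> L \<omega> U \<in> L2 cylinder_measure"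
proof -
  have m: "(\<lambda>p. indicator \<omega> (snd p) :: complex) \<in> borel_measurable cylinder_measure"
    using \<omega>(1) by measurable
  show ?thesis
    unfolding double_jump_def
  proof (rule L2_mult_bounded[where B = 1, OF _ m])
    show "(\<lambda>p. potential_jump \<epsilon> L U p + cnj (potential_jump \<epsilon> L (\<lambda>p. cnj (U p)) p)) \<in> L2 cylinder_measure"
      by (intro L2_add L2_cnj potential_jump_L2[OF L U C \<epsilon>] potential_jump_L2[OF L controls_cnj[OF U] cnj_moment_bound \<epsilon>])
  qed (simp add: indicator_def)
qed

text \<open>The second summand contributes the identity for the conjugate control at frequency
  \<open>-n\<close>, conjugated; its profile is real. Together the profiles have kernel
  \<open>2 cosh (n (\<sigma> - s))\<close>, which depends on \<open>|n|\<close> only, like the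
  weight in \<open>moment\<close>.\<close>

lemma double_jump_moment:
  assumes G: "test_function \<epsilon> L G"
  shows "integrable cylinder_measure (\<lambda>q. U q * snd q powi (- n) * of_real (exit_profile n G (fst q) + exit_profile (- n) G (fst q)))"
    and "(LINT p|cylinder_measure. double_jump \<epsilon> L \<omega> U p * of_real (G (fst p)) * snd p powi (- n)) =
      (LINT q|cylinder_measure. U q * snd q powi (- n) * of_real (exit_profile n G (fst q) + exit_profile (- n) G (fst q)))"
proof -
  define A where "A p = potential_jump \<epsilon> L U p * of_real (G (fst p)) * snd p powi (- n)" for p
  define A' where "A' p = potential_jump \<epsilon> L (\<lambda>p. cnj (U p)) p * of_real (G (fst p)) * snd p powi (- (- n))" for p
  define B where "B q = U q * snd q powi (- n) * of_real (exit_profile n G (fst q))" for q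
  define B' where "B' q = cnj (U q) * snd q powi (- (- n)) * of_real (exit_profile (- n) G (fst q))" for q
  note 1 = potential_jump_moment[OF L U C \<epsilon> G, of n, folded A_def B_def]
  note 2 = potential_jump_moment[OF L controls_cnj[OF U] cnj_moment_bound \<epsilon> G, of "- n", folded A'_def B'_def]
  have sp: "snd p \<in> sphere 0 1" if "p \<in> space cylinder_measure" for p
    using that by (auto simp: space_pair_measure)
  have B_eq: "U q * snd q powi (- n) * of_real (exit_profile n G (fst q) + exit_profile (- n) G (fst q)) = B q + cnj (B' q)"
    if "q \<in> space cylinder_measure" for q
    using cnj_powi_sphere[OF sp[OF that], of n] by (simp add: B_def B'_def ring_distribs)
  have iB': "integrable cylinder_measure (\<lambda>q. cnj (B' q))" and iA': "integrable cylinder_measure (\<lambda>p. cnj (A' p))"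
    using 2 by simp_all
  have int: "integrable cylinder_measure (\<lambda>q. B q + cnj (B' q))"
    using 1(2) iB' by (rule Bochner_Integration.integrable_add)
  then show "integrable cylinder_measure (\<lambda>q. U q * snd q powi (- n) * of_real (exit_profile n G (fst q) + exit_profile (- n) G (fst q)))"
    by (rule Bochner_Integration.integrable_cong[THEN iffD2, OF refl, rotated]) (rule B_eq)
  have [measurable]: "G \<in> borel_measurable borel" using G by (simp add: test_function_def)
  have "(LINT p|cylinder_measure. double_jump \<epsilon> L \<omega> U p * of_real (G (fst p)) * snd p powi (- n)) = (LINT p|cylinder_measure. A p + cnj (A' p))"
  proof (rule integral_cong_AE)
    show "AE p in cylinder_measure. double_jump \<epsilon> L \<omega> U p * of_real (G (fst p)) * snd p powi (- n) = A p + cnj (A' p)"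
      using double_jump_AE AE_space
    proof eventually_elim
      case (elim p)
      then show ?case using cnj_powi_sphere[OF sp[OF elim(2)], of n]
        by (simp add: A_def A'_def ring_distribs)
    qed
    show "(\<lambda>p. A p + cnj (A' p)) \<in> borel_measurable cylinder_measure"
      using Bochner_Integration.integrable_add[OF 1(1) iA'] by simp
  qed measurable
  also have "\<dots> = (LINT q|cylinder_measure. B q + cnj (B' q))"
    using 1 2 iA' iB' by simp
  also have "\<dots> = (LINT q|cylinder_measure. U q * snd q powi (- n) * of_real (exit_profile n G (fst q) + exit_profile (- n) G (fst q)))"
    by (rule Bochner_Integration.integral_cong[OF refl]) (rule B_eq[symmetric])
  finally show "(LINT p|cylinder_measure. double_jump \<epsilon> L \<omega> U p * of_real (G (fst p)) * snd p powi (- n)) =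
      (LINT q|cylinder_measure. U q * snd q powi (- n) * of_real (exit_profile n G (fst q) + exit_profile (- n) G (fst q)))" .
qed

end

text \<open>For \<open>H\<close> the double jump and times from \<open>\<epsilon>\<close> on, this
  is \<open>2 d\<close>.\<close>

definition tail_integral :: "(real \<times> complex \<Rightarrow> complex) \<Rightarrow> real \<times> complex \<Rightarrow> complex" where
  "tail_integral H p = (LINT \<sigma>|lborel. of_bool (fst p < \<sigma>) * H (\<sigma>, snd p))"

lemma measurable_tail_integral [measurable]:
  assumes [measurable]: "H \<in> borel_measurable cylinder_measure"
  shows "tail_integral H \<in> borel_measurable cylinder_measure"
  unfolding tail_integral_def by measurable

text \<open>For fixed \<open>z\<close> this is an operator in time whose kernel is at most 1 on the
  square of \<open>{0..L}\<close>, so Schur's test applies slice by slice with both bounds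
  \<open>L\<close>.\<close>

lemma tail_integral_L2:
  assumes H: "H \<in> L2 cylinder_measure" and zero: "\<And>s z. s \<notin> {0..L} \<Longrightarrow> H (s, z) = 0"
    and g: "test_function 0 L g" and L: "L \<ge> 0"
  shows "(\<lambda>p. of_real (g (fst p)) * tail_integral H p) \<in> L2 cylinder_measure"
proof -
  obtain B where B: "B \<ge> 0" "\<And>s. \<bar>g s\<bar> \<le> B" by (rule test_function_bound[OF g]) blast
  have H_meas [measurable]: "H \<in> borel_measurable cylinder_measure" and H_int: "integrable cylinder_measure (\<lambda>p. (norm (H p))\<^sup>2)"
    using H by (auto simp: L2_def)
  have g_meas [measurable]: "g \<in> borel_measurable borel" using g by (simp add: test_function_def)
  let ?k = "\<lambda>s \<sigma>. indicator {0..L} s * indicator {0..L} \<sigma> :: real"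
  let ?E = "\<lambda>p. complex_of_real (g (fst p)) * tail_integral H p"
  have pointwise: "ennreal (norm (?E (s, z))) \<le> ennreal B * (\<integral>\<^sup>+\<sigma>. ennreal (?k s \<sigma> * norm (H (\<sigma>, z))) \<partial>lborel)" for s z
  proof (cases "s \<in> {0..L} \<and> integrable lborel (\<lambda>\<sigma>. of_bool (s < \<sigma>) * H (\<sigma>, z))")
    case True
    have "ennreal (norm (?E (s, z))) = ennreal \<bar>g s\<bar> * ennreal (norm (tail_integral H (s, z)))"
      by (simp add: norm_mult ennreal_mult)
    also have "\<dots> \<le> ennreal B * (\<integral>\<^sup>+\<sigma>. ennreal (?k s \<sigma> * norm (H (\<sigma>, z))) \<partial>lborel)"
    proof (rule mult_mono)
      show "ennreal \<bar>g s\<bar> \<le> ennreal B" using B(2) by (rule ennreal_leI)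
      have "ennreal (norm (tail_integral H (s, z))) \<le> (\<integral>\<^sup>+\<sigma>. norm (of_bool (s < \<sigma>) * H (\<sigma>, z)) \<partial>lborel)"
        unfolding tail_integral_def using True by (auto intro: integral_norm_bound_ennreal)
      also have "\<dots> \<le> (\<integral>\<^sup>+\<sigma>. ennreal (?k s \<sigma> * norm (H (\<sigma>, z))) \<partial>lborel)"
      proof (intro nn_integral_mono ennreal_leI)
        fix \<sigma>
        show "norm (of_bool (s < \<sigma>) * H (\<sigma>, z)) \<le> ?k s \<sigma> * norm (H (\<sigma>, z))"
          using True zero[of \<sigma> z] by (cases "\<sigma> \<in> {0..L}") (auto simp: of_bool_def)
      qed
      finally show "ennreal (norm (tail_integral H (s, z))) \<le> (\<integral>\<^sup>+\<sigma>. ennreal (?k s \<sigma> * norm (H (\<sigma>, z))) \<partial>lborel)" .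
    qed simp_all
    finally show ?thesis .
  next
    case False
    then have "?E (s, z) = 0"
      using test_function_zero[OF g, of s] by (auto simp: tail_integral_def not_integrable_integral_eq)
    then show ?thesis by (simp only: norm_zero ennreal_0 zero_le)
  qed
  have "(\<integral>\<^sup>+p. ennreal ((norm (?E p))\<^sup>2) \<partial>cylinder_measure) = (\<integral>\<^sup>+z. (\<integral>\<^sup>+s. ennreal ((norm (?E (s, z)))\<^sup>2) \<partial>lborel) \<partial>circle_measure)"
    by (rule cylinder.nn_integral_snd[symmetric]) measurable
  also have "\<dots> \<le> (\<integral>\<^sup>+z. ennreal (B\<^sup>2 * L\<^sup>2) * (\<integral>\<^sup>+\<sigma>. ennreal ((norm (H (\<sigma>, z)))\<^sup>2) \<partial>lborel) \<partial>circle_measure)"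
  proof (rule nn_integral_mono)
    fix z assume z: "z \<in> space circle_measure"
    have Hz [measurable]: "(\<lambda>\<sigma>. norm (H (\<sigma>, z))) \<in> borel_measurable lborel"
      using measurable_compose[OF measurable_Pair2'[OF z] H_meas] by simp
    have "(\<integral>\<^sup>+s. ennreal ((norm (?E (s, z)))\<^sup>2) \<partial>lborel) \<le>
       (\<integral>\<^sup>+s. ennreal (B\<^sup>2) * (\<integral>\<^sup>+\<sigma>. ennreal (?k s \<sigma> * norm (H (\<sigma>, z))) \<partial>lborel)\<^sup>2 \<partial>lborel)"
    proof (rule nn_integral_mono)
      fix s
      have "ennreal ((norm (?E (s, z)))\<^sup>2) \<le> (ennreal B * (\<integral>\<^sup>+\<sigma>. ennreal (?k s \<sigma> * norm (H (\<sigma>, z))) \<partial>lborel))\<^sup>2"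
        using pointwise[of s z] by (subst ennreal_power[symmetric]) (auto intro!: power_mono)
      then show "ennreal ((norm (?E (s, z)))\<^sup>2) \<le> ennreal (B\<^sup>2) * (\<integral>\<^sup>+\<sigma>. ennreal (?k s \<sigma> * norm (H (\<sigma>, z))) \<partial>lborel)\<^sup>2"
        using B by (simp add: power_mult_distrib ennreal_power)
    qed
    also have "\<dots> = ennreal (B\<^sup>2) * (\<integral>\<^sup>+s. (\<integral>\<^sup>+\<sigma>. ennreal (?k s \<sigma> * norm (H (\<sigma>, z))) \<partial>lborel)\<^sup>2 \<partial>lborel)"
      by (rule nn_integral_cmult) measurable
    also have "(\<integral>\<^sup>+s. (\<integral>\<^sup>+\<sigma>. ennreal (?k s \<sigma> * norm (H (\<sigma>, z))) \<partial>lborel)\<^sup>2 \<partial>lborel) \<le>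
       ennreal L * ennreal L * (\<integral>\<^sup>+\<sigma>. ennreal ((norm (H (\<sigma>, z)))\<^sup>2) \<partial>lborel)"
    proof (rule schur_test)
      have "(\<integral>\<^sup>+x. ennreal (indicator {0..L} x) \<partial>lborel) = ennreal L"
        using L by (simp add: ennreal_indicator)
      then have *: "(\<integral>\<^sup>+x. ennreal (c * indicator {0..L} x) \<partial>lborel) \<le> ennreal L" if "c = 0 \<or> c = 1" for c :: real
        using that by auto
      show "(\<integral>\<^sup>+\<sigma>. ennreal (?k s \<sigma>) \<partial>lborel) \<le> ennreal L" for s
        by (rule *) (auto simp: indicator_def)
      show "(\<integral>\<^sup>+s. ennreal (?k s \<sigma>) \<partial>lborel) \<le> ennreal L" for \<sigma>
        using *[of "indicator {0..L} \<sigma>"] by (auto simp: indicator_def mult.commute)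
    qed (auto simp: lborel.sigma_finite_measure_axioms)
    finally show "(\<integral>\<^sup>+s. ennreal ((norm (?E (s, z)))\<^sup>2) \<partial>lborel) \<le> ennreal (B\<^sup>2 * L\<^sup>2) * (\<integral>\<^sup>+\<sigma>. ennreal ((norm (H (\<sigma>, z)))\<^sup>2) \<partial>lborel)"
      using B L by (simp add: ennreal_mult power2_eq_square mult.assoc mult_left_mono)
  qed
  also have "\<dots> = ennreal (B\<^sup>2 * L\<^sup>2) * (\<integral>\<^sup>+z. (\<integral>\<^sup>+\<sigma>. ennreal ((norm (H (\<sigma>, z)))\<^sup>2) \<partial>lborel) \<partial>circle_measure)"
    by (rule nn_integral_cmult) measurable
  also have "(\<integral>\<^sup>+z. (\<integral>\<^sup>+\<sigma>. ennreal ((norm (H (\<sigma>, z)))\<^sup>2) \<partial>lborel) \<partial>circle_measure) = (\<integral>\<^sup>+p. ennreal ((norm (H p))\<^sup>2) \<partial>cylinder_measure)"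
    by (rule cylinder.nn_integral_snd) measurable
  also have "ennreal (B\<^sup>2 * L\<^sup>2) * (\<integral>\<^sup>+p. ennreal ((norm (H p))\<^sup>2) \<partial>cylinder_measure) < \<infinity>"
    using H_int by (auto simp: integrable_iff_bounded ennreal_mult_less_top)
  finally have "integrable cylinder_measure (\<lambda>p. (norm (?E p))\<^sup>2)"
    by (intro integrableI_bounded) auto
  then show ?thesis by (simp add: L2_def)
qed

interpretation line_cylinder: pair_sigma_finite lborel cylinder_measure ..

lemma norm_exp_powi_le:
  assumes "s \<in> {0..L}" "z \<in> sphere 0 1"
  shows "norm (complex_of_real (exp (of_int \<bar>n\<bar> * s)) * z powi (- n)) \<le> exp (of_int \<bar>n\<bar> * L)"
  using assms norm_powi_sphere[of z "-n"] by (auto simp: norm_mult intro!: mult_left_mono)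

text \<open>Fubini in the variables \<open>s\<close>, \<sigma>, \<open>z\<close>, the last two kept
  together as a point of the cylinder, moves the truncation \<open>s < \<sigma>\<close> from
  \<open>H\<close> to \<open>g\<close>.\<close>

lemma tail_integral_moment:
  assumes H: "H \<in> L2 cylinder_measure" and zero: "\<And>s z. s \<notin> {0..L} \<Longrightarrow> H (s, z) = 0"
    and g: "test_function 0 L g" and L: "L \<ge> 0"
  shows "(LINT p|cylinder_measure. of_real (g (fst p)) * tail_integral H p * (of_real (exp (of_int \<bar>n\<bar> * fst p)) * snd p powi (- n))) =
    (LINT q|cylinder_measure. H q * snd q powi (- n) * of_real (LINT r|lborel. g r * (of_bool (r < fst q) * exp (of_int \<bar>n\<bar> * r))))"
proof -
  define m :: real where "m = of_int \<bar>n\<bar>"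
  have H_meas [measurable]: "H \<in> borel_measurable cylinder_measure" and H_int2: "integrable cylinder_measure (\<lambda>p. (norm (H p))\<^sup>2)"
    using H by (auto simp: L2_def)
  have g_meas [measurable]: "g \<in> borel_measurable borel" using g by (simp add: test_function_def)
  have H_int: "integrable cylinder_measure H"
    using integrable_weighted_control[OF H_meas H_int2 zero, where w = "\<lambda>_. 1" and C = 1] by simp
  define h where "h s q = complex_of_real (g s * (of_bool (s < fst q) * exp (m * s))) * (H q * snd q powi (- n))" for s and q :: "real \<times> complex"
  have h_meas [measurable]: "(\<lambda>(s, q). h s q) \<in> borel_measurable (lborel \<Otimes>\<^sub>M cylinder_measure)"
    unfolding h_def by measurable
  have ge_int: "integrable lborel (\<lambda>s. g s * exp (m * s))"
  proof (rule test_function_integrable[OF g])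
    show "\<bar>exp (m * s)\<bar> \<le> exp (\<bar>m\<bar> * (\<bar>0\<bar> + \<bar>L\<bar>))" if "s \<in> {0..L}" for s
      using exp_linear_bound[OF that, of m] by simp
  qed measurable
  have h_int: "integrable (lborel \<Otimes>\<^sub>M cylinder_measure) (\<lambda>(s, q). h s q)"
  proof (rule integrableI_bounded)
    have "(\<integral>\<^sup>+x. ennreal (norm (case x of (s, q) \<Rightarrow> h s q)) \<partial>(lborel \<Otimes>\<^sub>M cylinder_measure)) =
      (\<integral>\<^sup>+s. (\<integral>\<^sup>+q. ennreal (norm (h s q)) \<partial>cylinder_measure) \<partial>lborel)"
      by (subst cylinder.nn_integral_fst[symmetric]) simp_all
    also have "\<dots> \<le> (\<integral>\<^sup>+s. ennreal \<bar>g s * exp (m * s)\<bar> * (\<integral>\<^sup>+q. ennreal (norm (H q)) \<partial>cylinder_measure) \<partial>lborel)"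
    proof (rule nn_integral_mono)
      fix s :: real
      have "(\<integral>\<^sup>+q. ennreal (norm (h s q)) \<partial>cylinder_measure) \<le> (\<integral>\<^sup>+q. ennreal \<bar>g s * exp (m * s)\<bar> * ennreal (norm (H q)) \<partial>cylinder_measure)"
      proof (rule nn_integral_mono)
        fix q assume "q \<in> space cylinder_measure"
        then have "norm (snd q powi (- n)) = 1" by (intro norm_powi_sphere) (auto simp: space_pair_measure)
        then have "norm (h s q) \<le> \<bar>g s * exp (m * s)\<bar> * norm (H q)"
          by (cases "s < fst q") (simp_all add: h_def norm_mult abs_mult)
        then show "ennreal (norm (h s q)) \<le> ennreal \<bar>g s * exp (m * s)\<bar> * ennreal (norm (H q))"
          by (simp add: ennreal_mult[symmetric] ennreal_leI)
      qed
      also have "\<dots> = ennreal \<bar>g s * exp (m * s)\<bar> * (\<integral>\<^sup>+q. ennreal (norm (H q)) \<partial>cylinder_measure)"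
        by (rule nn_integral_cmult) measurable
      finally show "(\<integral>\<^sup>+q. ennreal (norm (h s q)) \<partial>cylinder_measure) \<le> ennreal \<bar>g s * exp (m * s)\<bar> * (\<integral>\<^sup>+q. ennreal (norm (H q)) \<partial>cylinder_measure)" .
    qed
    also have "\<dots> = (\<integral>\<^sup>+s. ennreal \<bar>g s * exp (m * s)\<bar> \<partial>lborel) * (\<integral>\<^sup>+q. ennreal (norm (H q)) \<partial>cylinder_measure)"
      by (rule nn_integral_multc) measurable
    also have "\<dots> < \<infinity>"
      using ge_int H_int by (simp add: integrable_iff_bounded ennreal_mult_less_top)
    finally show "(\<integral>\<^sup>+x. ennreal (norm (case x of (s, q) \<Rightarrow> h s q)) \<partial>(lborel \<Otimes>\<^sub>M cylinder_measure)) < \<infinity>" .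
  qed measurable
  define E where "E p = complex_of_real (g (fst p)) * tail_integral H p * (of_real (exp (m * fst p)) * snd p powi (- n))" for p
  have E_int: "integrable cylinder_measure E"
    unfolding E_def
  proof (rule integrable_weighted_control)
    show "(\<lambda>p. complex_of_real (g (fst p)) * tail_integral H p) \<in> borel_measurable cylinder_measure"
      "integrable cylinder_measure (\<lambda>p. (norm (complex_of_real (g (fst p)) * tail_integral H p))\<^sup>2)"
      using tail_integral_L2[OF H zero g L] by (auto simp: L2_def)
    show "complex_of_real (g (fst (s, z))) * tail_integral H (s, z) = 0" if "s \<notin> {0..L}" for s z
      using test_function_zero[OF g that] by simp
    show "norm (complex_of_real (exp (m * fst (s, z))) * snd (s, z) powi (- n)) \<le> exp (m * L)"
      if "s \<in> {0..L}" "z \<in> sphere 0 1" for s z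
      using norm_exp_powi_le[OF that, of n] by (simp add: m_def)
  qed measurable
  have "(LINT p|cylinder_measure. E p) = (LINT s|lborel. (LINT z|circle_measure. E (s, z)))"
    by (rule cylinder.integral_fst'[symmetric, OF E_int])
  also have "\<dots> = (LINT s|lborel. (LINT q|cylinder_measure. h s q))"
  proof (rule integral_cong_AE)
    show "AE s in lborel. (LINT z|circle_measure. E (s, z)) = (LINT q|cylinder_measure. h s q)"
      using line_cylinder.AE_integrable_fst[OF h_int]
    proof eventually_elim
      case (elim s)
      have "(LINT q|cylinder_measure. h s q) = (LINT z|circle_measure. (LINT \<sigma>|lborel. h s (\<sigma>, z)))"
        using cylinder.integral_snd[of "\<lambda>\<sigma> z. h s (\<sigma>, z)"] elim by simp
      also have "\<dots> = (LINT z|circle_measure. E (s, z))"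
      proof (rule Bochner_Integration.integral_cong[OF refl])
        fix z
        have "(LINT \<sigma>|lborel. h s (\<sigma>, z)) =
          (LINT \<sigma>|lborel. of_real (g s) * (of_real (exp (m * s)) * z powi (- n)) * (of_bool (s < \<sigma>) * H (\<sigma>, z)))"
          by (intro Bochner_Integration.integral_cong refl) (simp add: h_def)
        also have "\<dots> = of_real (g s) * (of_real (exp (m * s)) * z powi (- n)) * (LINT \<sigma>|lborel. of_bool (s < \<sigma>) * H (\<sigma>, z))"
          by (rule Bochner_Integration.integral_mult_right_zero)
        finally show "(LINT \<sigma>|lborel. h s (\<sigma>, z)) = E (s, z)" by (simp add: E_def tail_integral_def)
      qed
      finally show ?case by simp
    qed
    show "(\<lambda>s. LINT z|circle_measure. E (s, z)) \<in> borel_measurable lborel"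
      using cylinder.integrable_fst'[OF E_int] by simp
    show "(\<lambda>s. LINT q|cylinder_measure. h s q) \<in> borel_measurable lborel"
      using line_cylinder.integrable_fst[OF h_int] by simp
  qed
  also have "\<dots> = (LINT q|cylinder_measure. (LINT s|lborel. h s q))"
    by (rule line_cylinder.Fubini_integral[OF h_int, symmetric])
  also have "\<dots> = (LINT q|cylinder_measure. H q * snd q powi (- n) * of_real (LINT r|lborel. g r * (of_bool (r < fst q) * exp (m * r))))"
  proof (rule Bochner_Integration.integral_cong[OF refl])
    fix q :: "real \<times> complex"
    have "(LINT s|lborel. h s q) = (LINT s|lborel. complex_of_real (g s * (of_bool (s < fst q) * exp (m * s)))) * (H q * snd q powi (- n))"
      unfolding h_def by (rule Bochner_Integration.integral_mult_left_zero)
    then show "(LINT s|lborel. h s q) = H q * snd q powi (- n) * of_real (LINT r|lborel. g r * (of_bool (r < fst q) * exp (m * r)))"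
      by (simp only: integral_complex_of_real mult.commute)
  qed
  finally show ?thesis by (simp add: E_def m_def)
qed

section \<open>The shortened control\<close>

lemma moment_eq: "moment U n = (LINT p|cylinder_measure. U p * (of_real (exp (of_int \<bar>n\<bar> * fst p)) * snd p powi (- n)))"
  by (simp add: moment_def split_beta' mult.assoc)

lemma control_on_shorter_interval:
  assumes U: "U \<in> controls L \<omega>" and C: "\<And>n. norm (moment U n) \<le> C"
    and \<omega>: "\<omega> \<in> sets circle_measure" "\<omega> \<subseteq> K" "K \<subseteq> sphere 0 1" "closed K" "finite (K - \<omega>)"
    and T: "0 < T" "T \<le> L"
  shows "\<exists>V \<in> controls T \<omega>. \<forall>n. moment V n = moment U n"
proof -
  \<comment> \<open>The cut-off descends from 1 to 0 on \<open>{\<epsilon>..T}\<close>; any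
    \<open>\<epsilon>\<close> strictly between 0 and \<open>T\<close> would do.\<close>
  define \<epsilon> where "\<epsilon> = T / 2"
  have \<epsilon>: "0 < \<epsilon>" "\<epsilon> < T" using T by (auto simp: \<epsilon>_def)
  have L: "L \<ge> 0" using T by simp
  define H where "H = double_jump \<epsilon> L \<omega> U"
  define E where "E p = complex_of_real (bump_deriv \<epsilon> T (fst p)) * tail_integral H p" for p
  \<comment> \<open>Since \<open>bump\<close> is \<open>-\<chi>'\<close>, the term
    \<open>2 \<chi>' d_s = -\<chi>' H\<close> is \<open>bump * H\<close>, and
    \<open>\<chi>'' d\<close> is \<open>- bump_deriv\<close> times half of
    \<open>tail_integral H\<close>.\<close>
  define V where "V p = of_real (cutoff \<epsilon> T (fst p)) * U p + of_real (bump \<epsilon> T (fst p)) * H p + - 1 / 2 * E p" for p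
  note hyps = L U C \<epsilon>(1) \<omega>
  have H_L2: "H \<in> L2 cylinder_measure" unfolding H_def by (rule double_jump_L2[OF hyps])
  have H_zero: "H (s, z) = 0" if "s \<notin> {\<epsilon>..L} \<or> z \<notin> \<omega>" for s z
    using that unfolding H_def by (intro double_jump_zero) auto
  have H_zero0: "H (s, z) = 0" if "s \<notin> {0..L}" for s z using H_zero[of s z] that \<epsilon> by auto
  have bd: "test_function \<epsilon> T (bump_deriv \<epsilon> T)" and b: "test_function \<epsilon> T (bump \<epsilon> T)"
    using bump_deriv_test_function[OF \<epsilon>(2)] bump_test_function[OF \<epsilon>(2)] by auto
  have bd0: "test_function 0 L (bump_deriv \<epsilon> T)"
    using bd \<epsilon> T by (auto simp: test_function_def)
  have E_L2: "E \<in> L2 cylinder_measure"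
    unfolding E_def[abs_def] by (rule tail_integral_L2[OF H_L2 H_zero0 bd0 L])
  have [measurable]: "cutoff \<epsilon> T \<in> borel_measurable borel" "bump \<epsilon> T \<in> borel_measurable borel"
    using cutoff_measurable[OF \<epsilon>(2)] b by (simp_all add: test_function_def)
  obtain B where B: "\<And>s. \<bar>bump \<epsilon> T s\<bar> \<le> B" by (rule test_function_bound[OF b]) blast
  have cU_L2: "(\<lambda>p. of_real (cutoff \<epsilon> T (fst p)) * U p) \<in> L2 cylinder_measure"
  proof (rule L2_mult_bounded[where B = 1])
    show "U \<in> L2 cylinder_measure" using U by (simp add: controls_def)
  qed (use cutoff_bounds[OF \<epsilon>(2)] in \<open>measurable, simp\<close>)
  have bH_L2: "(\<lambda>p. of_real (bump \<epsilon> T (fst p)) * H p) \<in> L2 cylinder_measure"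
    by (rule L2_mult_bounded[OF H_L2, where B = B]) (use B in \<open>measurable, simp\<close>)
  have E2_L2: "(\<lambda>p. - 1 / 2 * E p) \<in> L2 cylinder_measure"
    by (rule L2_mult_bounded[OF E_L2, where B = 1]) simp_all
  have V_L2: "V \<in> L2 cylinder_measure"
    unfolding V_def[abs_def] by (intro L2_add cU_L2 bH_L2 E2_L2)
  have V_zero: "V (s, z) = 0" if "s \<notin> {0..T} \<or> z \<notin> \<omega>" for s z
  proof (cases "z \<in> \<omega>")
    case False
    \<comment> \<open>The tail integral runs in time along fixed \<open>z\<close>, so it does not
      leave \<omega>.\<close>
    then have "U (s, z) = 0" "H (s, z) = 0" "tail_integral H (s, z) = 0"
      using controls_zero[OF U] H_zero by (auto simp: tail_integral_def)
    then show ?thesis by (simp add: V_def E_def)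
  next
    case True
    then have s: "s < 0 \<or> s > T" using that by auto
    then have "s \<notin> {\<epsilon>..T}" using \<epsilon> by auto
    then have "bump \<epsilon> T s = 0" "bump_deriv \<epsilon> T s = 0"
      using test_function_zero[OF b] test_function_zero[OF bd] by auto
    moreover have "of_real (cutoff \<epsilon> T s) * U (s, z) = 0"
      using s controls_zero[OF U, of s z] cutoff_beyond[OF \<epsilon>(2), of s] by auto
    ultimately show ?thesis by (simp add: V_def E_def)
  qed
  have V: "V \<in> controls T \<omega>"
    using V_L2 V_zero unfolding controls_def by auto
  have "moment V n = moment U n" for n
  proof -
    define m :: real where "m = \<bar>of_int n\<bar>"
    define w where "w p = complex_of_real (exp (of_int \<bar>n\<bar> * fst p)) * snd p powi (- n)" for p :: "real \<times> complex"
    define G where "G = correction_weight \<epsilon> T L m"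
    have G: "test_function \<epsilon> L G" unfolding G_def by (rule correction_weight_test_function[OF \<epsilon>(2)])
    have [measurable]: "G \<in> borel_measurable borel" "bump_deriv \<epsilon> T \<in> borel_measurable borel"
      using G bd by (simp_all add: test_function_def)
    have w_meas [measurable]: "w \<in> borel_measurable cylinder_measure" unfolding w_def by measurable
    have int: "integrable cylinder_measure (\<lambda>p. X p * w p)"
      if "X \<in> L2 cylinder_measure" "\<And>s z. s \<notin> {0..L} \<Longrightarrow> X (s, z) = 0" for X
    proof (rule integrable_weighted_control[where a = 0 and b = L, OF _ _ _ w_meas])
      show "X \<in> borel_measurable cylinder_measure" "integrable cylinder_measure (\<lambda>p. (norm (X p))\<^sup>2)"
        using that(1) by (auto simp: L2_def)
      show "X (s, z) = 0" if "s \<notin> {0..L}" for s z using that by (rule \<open>\<And>s z. s \<notin> {0..L} \<Longrightarrow> X (s, z) = 0\<close>)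
      show "norm (w (s, z)) \<le> exp (of_int \<bar>n\<bar> * L)" if "s \<in> {0..L}" "z \<in> sphere 0 1" for s z
        using norm_exp_powi_le[OF that, of n] by (simp add: w_def)
    qed
    have i1: "integrable cylinder_measure (\<lambda>p. of_real (cutoff \<epsilon> T (fst p)) * U p * w p)"
      by (rule int[OF cU_L2]) (use controls_zero[OF U] in simp)
    have i2: "integrable cylinder_measure (\<lambda>p. of_real (bump \<epsilon> T (fst p)) * H p * w p)"
      by (rule int[OF bH_L2]) (use H_zero0 in simp)
    have i3: "integrable cylinder_measure (\<lambda>p. E p * w p)"
      by (rule int[OF E_L2]) (use test_function_zero[OF bd0] in \<open>simp add: E_def\<close>)
    define W where "W q = complex_of_real (LINT r|lborel. bump_deriv \<epsilon> T r * (of_bool (r < fst q) * exp (of_int \<bar>n\<bar> * r)))" for q :: "real \<times> complex"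
    have E_mom: "(LINT p|cylinder_measure. E p * w p) = (LINT q|cylinder_measure. H q * snd q powi (- n) * W q)"
      unfolding E_def w_def W_def by (rule tail_integral_moment[OF H_L2 H_zero0 bd0 L])
    have W_meas [measurable]: "W \<in> borel_measurable cylinder_measure" unfolding W_def by measurable
    \<comment> \<open>By the choice of \<open>correction_weight\<close>, the two terms of
      \<open>V\<close> that contain \<open>H\<close> combine into one pairing of \<open>H\<close>
      with \<open>G\<close>.\<close>
    have HG: "H q * of_real (G (fst q)) * snd q powi (- n) =
      of_real (bump \<epsilon> T (fst q)) * H q * w q - 1 / 2 * (H q * snd q powi (- n) * W q)" for q
    proof (cases "fst q \<in> {\<epsilon>..L}")
      case True
      then have G_eq: "complex_of_real (G (fst q)) = of_real (bump \<epsilon> T (fst q)) * of_real (exp (of_int \<bar>n\<bar> * fst q)) - W q / 2"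
        by (simp add: G_def correction_weight_def W_def m_def)
      show ?thesis unfolding G_eq w_def by (simp add: algebra_simps)
    next
      case False
      then have "H q = 0" using H_zero[of "fst q" "snd q"] by simp
      then show ?thesis by simp
    qed
    \<comment> \<open>\<open>HG\<close> is solved for this term: the other two are integrable
      because \<open>G\<close> and \<open>bump\<close> are bounded.\<close>
    have H_int: "integrable cylinder_measure (\<lambda>q. H q * snd q powi (- n) * W q)"
    proof -
      obtain D where D: "D \<ge> 0" "\<And>s. \<bar>G s\<bar> \<le> D" by (rule test_function_bound[OF G]) blast
      have "integrable cylinder_measure (\<lambda>q. H q * (of_real (G (fst q)) * snd q powi (- n)))"
      proof (rule integrable_weighted_control[where a = 0 and b = L and C = D])
        show "H \<in> borel_measurable cylinder_measure" "integrable cylinder_measure (\<lambda>p. (norm (H p))\<^sup>2)"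
          using H_L2 by (auto simp: L2_def)
        show "norm (complex_of_real (G (fst (s, z))) * snd (s, z) powi (- n)) \<le> D" if "z \<in> sphere 0 1" for s z
          using D norm_powi_sphere[OF that, of "-n"] by (simp add: norm_mult)
      qed (use H_zero0 in \<open>simp, measurable\<close>)
      then have "integrable cylinder_measure (\<lambda>q. 2 * (of_real (bump \<epsilon> T (fst q)) * H q * w q - H q * of_real (G (fst q)) * snd q powi (- n)))"
        using i2 by (intro integrable_mult_right Bochner_Integration.integrable_diff) (simp_all add: mult.assoc)
      then show ?thesis unfolding HG by simp
    qed
    have "moment V n = (LINT p|cylinder_measure. of_real (cutoff \<epsilon> T (fst p)) * U p * w p +
        (of_real (bump \<epsilon> T (fst p)) * H p * w p - 1 / 2 * (E p * w p)))"
      unfolding moment_eq w_def[symmetric] V_def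
      by (intro Bochner_Integration.integral_cong refl) (simp add: algebra_simps)
    also have "\<dots> = (LINT p|cylinder_measure. of_real (cutoff \<epsilon> T (fst p)) * U p * w p) +
        ((LINT p|cylinder_measure. of_real (bump \<epsilon> T (fst p)) * H p * w p) - 1 / 2 * (LINT p|cylinder_measure. E p * w p))"
      using i1 i2 i3 by simp
    also have "(LINT p|cylinder_measure. of_real (bump \<epsilon> T (fst p)) * H p * w p) - 1 / 2 * (LINT p|cylinder_measure. E p * w p) =
        (LINT q|cylinder_measure. H q * of_real (G (fst q)) * snd q powi (- n))"
      unfolding HG E_mom using i2 H_int by simp
    also have "\<dots> = (LINT q|cylinder_measure. U q * snd q powi (- n) * of_real (exit_profile n G (fst q) + exit_profile (- n) G (fst q)))"
      unfolding H_def by (rule double_jump_moment(2)[OF hyps G])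
    \<comment> \<open>The sum of the profiles is
      \<open>e^(|n| \<sigma>) (1 - \<chi>(\<sigma>))\<close>: the correction terms restore exactly
      the part of the moment lost when \<open>U\<close> is multiplied by \<chi>.\<close>
    also have "\<dots> = (LINT q|cylinder_measure. U q * w q - of_real (cutoff \<epsilon> T (fst q)) * U q * w q)"
    proof (rule Bochner_Integration.integral_cong[OF refl])
      fix q :: "real \<times> complex"
      show "U q * snd q powi (- n) * of_real (exit_profile n G (fst q) + exit_profile (- n) G (fst q)) =
        U q * w q - of_real (cutoff \<epsilon> T (fst q)) * U q * w q"
      proof (cases "fst q \<le> L")
        case True
        from exit_profile_correction_weight[OF \<epsilon>(2) True, of n]
        have "exit_profile n G (fst q) + exit_profile (- n) G (fst q) = exp (of_int \<bar>n\<bar> * fst q) * (1 - cutoff \<epsilon> T (fst q))"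
          by (simp add: G_def m_def)
        then show ?thesis by (simp only: w_def of_real_mult of_real_diff of_real_1) (simp add: algebra_simps)
      next
        case False
        then have "U q = 0" using controls_zero[OF U, of "fst q" "snd q"] by simp
        then show ?thesis by simp
      qed
    qed
    also have "\<dots> = (LINT q|cylinder_measure. U q * w q) - (LINT q|cylinder_measure. of_real (cutoff \<epsilon> T (fst q)) * U q * w q)"
    proof (rule Bochner_Integration.integral_diff[OF _ i1])
      show "integrable cylinder_measure (\<lambda>q. U q * w q)"
        by (rule int) (use U controls_zero[OF U] in \<open>simp_all add: controls_def\<close>)
    qed
    finally show ?thesis by (simp add: moment_eq w_def)
  qed
  with V show ?thesis by blast
qed

section \<open>Independence of the time horizon\<close>

lemma controls_mono: "T \<le> T' \<Longrightarrow> controls T \<omega> \<subseteq> controls T' \<omega>"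
proof
  fix U assume "T \<le> T'" and U: "U \<in> controls T \<omega>"
  then have "{0..T} \<times> \<omega> \<subseteq> {0..T'} \<times> \<omega>" by auto
  with U show "U \<in> controls T' \<omega>" unfolding controls_def by blast
qed

text \<open>Unique continuation takes place off a closed set, so the closed arc replaces \<omega>;
  it adds at most the two endpoints.\<close>

lemma open_strict_interval_closure:
  assumes "open_strict_interval \<omega>"
  obtains K where "\<omega> \<in> sets circle_measure" "\<omega> \<subseteq> K" "K \<subseteq> sphere 0 1" "closed K" "finite (K - \<omega>)"
proof -
  obtain a b where ab: "\<omega> = cis ` {a<..<b}" using assms by (auto simp: open_strict_interval_def)
  define K where "K = cis ` {a..b}"
  have "compact K" unfolding K_def by (intro compact_continuous_image continuous_intros) auto
  have sub: "K - \<omega> \<subseteq> {cis a, cis b}"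
  proof
    fix z assume "z \<in> K - \<omega>"
    then obtain x where x: "x \<in> {a..b}" "z = cis x" and "z \<notin> \<omega>" by (auto simp: K_def)
    then have "x \<notin> {a<..<b}" by (auto simp: ab)
    with x show "z \<in> {cis a, cis b}" by (cases "x = a") auto
  qed
  then have fin: "finite (K - \<omega>)" by (rule finite_subset) simp
  have 1: "\<omega> \<subseteq> K" "K \<subseteq> sphere 0 1" by (auto simp: K_def ab)
  have "\<omega> = K - (K - \<omega>)" using 1 by auto
  also have "\<dots> \<in> sets borel"
    using compact_imp_closed[OF \<open>compact K\<close>] finite_imp_closed[OF fin] by (intro sets.Diff borel_closed)
  finally have "\<omega> \<in> sets borel" .
  then have "\<omega> \<in> sets circle_measure"
    using 1 by (auto simp: sets_circle_measure sets_restrict_space intro!: image_eqI[of _ _ \<omega>])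
  then show ?thesis using 1 fin compact_imp_closed[OF \<open>compact K\<close>] that by blast
qed

lemma NC_L2_iff_moments:
  assumes "\<omega> \<in> sets circle_measure" "T > 0"
  shows "f\<^sub>0 \<in> NC_L2 \<omega> T \<longleftrightarrow> f\<^sub>0 \<in> L2 circle_measure \<and>
    (\<exists>U \<in> controls T \<omega>. \<forall>n. moment U n = - (2 * pi) * fourier_coeff f\<^sub>0 n)"
  unfolding NC_L2_iff_controls[OF assms(1)]
  by (intro conj_cong refl bex_cong half_heat_solution_zero_iff_moments[OF assms(2)])

theorem corollary1p12:
  fixes \<omega> :: "complex set" and T T' :: real
  assumes "open_strict_interval \<omega>" and "T > 0" and "T' > 0"
  shows "NC_L2 \<omega> T = NC_L2 \<omega> T'"
proof -
  obtain K where K: "\<omega> \<in> sets circle_measure" "\<omega> \<subseteq> K" "K \<subseteq> sphere 0 1" "closed K" "finite (K - \<omega>)"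
    by (rule open_strict_interval_closure[OF assms(1)])
  have "NC_L2 \<omega> S = NC_L2 \<omega> S'" if S: "0 < S" "S \<le> S'" for S S'
  proof (intro equalityI subsetI)
    fix f\<^sub>0 assume "f\<^sub>0 \<in> NC_L2 \<omega> S"
    then have "f\<^sub>0 \<in> L2 circle_measure \<and> (\<exists>U \<in> controls S \<omega>. \<forall>n. moment U n = - (2 * pi) * fourier_coeff f\<^sub>0 n)"
      unfolding NC_L2_iff_moments[OF K(1) S(1)] .
    then show "f\<^sub>0 \<in> NC_L2 \<omega> S'"
      unfolding NC_L2_iff_moments[OF K(1) order_less_le_trans[OF S]]
      using controls_mono[OF S(2)] by blast
  next
    fix f\<^sub>0 assume f\<^sub>0: "f\<^sub>0 \<in> NC_L2 \<omega> S'"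
    then obtain U where L2: "f\<^sub>0 \<in> L2 circle_measure" and U: "U \<in> controls S' \<omega>"
      and mom: "\<And>n. moment U n = - (2 * pi) * fourier_coeff f\<^sub>0 n"
      unfolding NC_L2_iff_moments[OF K(1) order_less_le_trans[OF S]] by blast
    \<comment> \<open>The moments are multiples of the Fourier coefficients of one integrable
      function, so they are bounded uniformly in \<open>n\<close> however long the control
      acts.\<close>
    have bound: "norm (moment U n) \<le> 2 * pi * ((LINT z|circle_measure. norm (f\<^sub>0 z)) / (2 * pi))" for n
      unfolding mom norm_mult
      using norm_fourier_coeff_le[OF integrable_L2_circle[OF L2], of n] by (intro mult_mono) auto
    from control_on_shorter_interval[OF U bound K S] L2 show "f\<^sub>0 \<in> NC_L2 \<omega> S"
      unfolding NC_L2_iff_moments[OF K(1) S(1)] mom[symmetric] by blast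
  qed
  note le = this
  show ?thesis
  proof (cases "T \<le> T'")
    case True
    then show ?thesis by (rule le[OF assms(2)])
  next
    case False
    then show ?thesis using le[OF assms(3), of T] by simp
  qed
qed

end
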